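(* Let $k$ be an algebraically closed field of characteristic $p$, $t$ transcendental over $k$, $d\ge2$, $N\ge1$ with $(d,p)\neq(2,2)$. If $f(x)\in H(d,N,k)$, then $\operatorname{Gal}(f^N(x)-t/k(t))\cong[S_d]^N$.
   Context: $H(d,N,k)$ is the set of polynomials $f\in k[x]$ of degree exactly $d$ such that: (1) $f'(x)$ is separable if $p\neq2$, and $f'(x)$ is the square of a separable polynomial if $p=2$; (2) if $w_1,\dots,w_r$ are the distinct critical points (zeros of $f'$) of $f$, then $f^n(w_i)\neq f^m(w_j)$ for all $1\le i,j\le r$ and all integers $0\le m,n\le N$, unless $m=n$ and $i=j$; (3) if $p=2$: for all $b,c\in k$, $(x-b)^3\nmid f(x)-c$; (4) if $p\mid d$: $f$ is indecomposable in $k[x]$ and $\deg f'=d-2$. $f^N$ is $N$-fold composition; $\operatorname{Gal}(f^N(x)-t/k(t))$ is the Galois group of the splitting field of $f^N(x)-t$ over $k(t)$. $[S_d]^N$ is the $N$-th wreath power of $S_d$ ($[S_d]^1=S_d$, $[S_d]^n=[S_d]^{n-1}[S_d]$, with $G[H]$ acting on pairs by $(i,r)\mapsto(\pi(i),\tau_i(r))$), i.e. the automorphism group of the $d$-ary rooted tree to level $N$. *)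

theory Defs
  imports "HOL-Computational_Algebra.Polynomial"
          "HOL-Computational_Algebra.Fraction_Field"
          "HOL-Algebra.Group"
begin

definition poly_iter :: "'a::comm_ring_1 poly \<Rightarrow> nat \<Rightarrow> 'a poly" where
  "poly_iter f N = ((\<lambda>g. pcompose f g) ^^ N) [:0, 1:]"

definition alg_closed_field :: "'k::field itself \<Rightarrow> bool" where
  "alg_closed_field _ \<longleftrightarrow> (\<forall>q::'k poly. degree q \<ge> 1 \<longrightarrow> (\<exists>x. poly q x = 0))"

definition separable_poly :: "'k::field poly \<Rightarrow> bool" where
  "separable_poly q \<longleftrightarrow> coprime q (pderiv q)"

definition indecomposable_poly :: "'k::field poly \<Rightarrow> bool" where
  "indecomposable_poly f \<longleftrightarrow>
     (\<forall>g h. f = pcompose g h \<longrightarrow> degree g = 1 \<or> degree h = 1)"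

definition critical_points :: "'k::field poly \<Rightarrow> 'k set" where
  "critical_points f = {w. poly (pderiv f) w = 0}"

definition H_set :: "nat \<Rightarrow> nat \<Rightarrow> 'k::field itself \<Rightarrow> 'k poly set" where
  "H_set d N _ = {f. degree f = d \<and>
     (CHAR('k) \<noteq> 2 \<longrightarrow> separable_poly (pderiv f)) \<and>
     (CHAR('k) = 2 \<longrightarrow> (\<exists>g. pderiv f = g ^ 2 \<and> separable_poly g)) \<and>
     (\<forall>w\<in>critical_points f. \<forall>w'\<in>critical_points f. \<forall>m\<le>N. \<forall>n\<le>N.
         (n, w) \<noteq> (m, w') \<longrightarrow> (poly f ^^ n) w \<noteq> (poly f ^^ m) w') \<and>
     (CHAR('k) = 2 \<longrightarrow> (\<forall>b c. \<not> [:-b, 1:] ^ 3 dvd f - [:c:])) \<and>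
     (CHAR('k) dvd d \<longrightarrow> indecomposable_poly f \<and> degree (pderiv f) = d - 2)}"

(* k(t) is the fraction field 'k poly fract, t = Fract [:0,1:] 1.
   The polynomial f^N(x) - t in k(t)[x]. *)
definition gal_poly :: "'k::field poly \<Rightarrow> nat \<Rightarrow> 'k poly fract poly" where
  "gal_poly f N = map_poly (\<lambda>c. Fract [:c:] 1) (poly_iter f N) - [:Fract [:0, 1:] 1:]"

definition is_field_hom :: "('a::field \<Rightarrow> 'b::field) \<Rightarrow> bool" where
  "is_field_hom \<phi> \<longleftrightarrow> \<phi> 1 = 1 \<and> (\<forall>x y. \<phi> (x + y) = \<phi> x + \<phi> y) \<and>
                       (\<forall>x y. \<phi> (x * y) = \<phi> x * \<phi> y)"

definition is_subfield :: "'b::field set \<Rightarrow> bool" where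
  "is_subfield S \<longleftrightarrow> 0 \<in> S \<and> 1 \<in> S \<and> (\<forall>x\<in>S. \<forall>y\<in>S. x + y \<in> S \<and> x * y \<in> S) \<and>
                    (\<forall>x\<in>S. - x \<in> S \<and> inverse x \<in> S)"

(* L (the whole type 'b) together with \<phi> : K \<rightarrow> L is a splitting field of P over K *)
definition is_splitting_field :: "('a::field \<Rightarrow> 'b::field) \<Rightarrow> 'a poly \<Rightarrow> bool" where
  "is_splitting_field \<phi> P \<longleftrightarrow> is_field_hom \<phi> \<and>
     (\<exists>c rs. map_poly \<phi> P = smult c (\<Prod>r\<leftarrow>rs. [:- r, 1:])) \<and>
     (\<forall>S. is_subfield S \<and> range \<phi> \<subseteq> S \<and> {x. poly (map_poly \<phi> P) x = 0} \<subseteq> S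
          \<longrightarrow> S = UNIV)"

definition gal_group :: "('a::field \<Rightarrow> 'b::field) \<Rightarrow> ('b \<Rightarrow> 'b) monoid" where
  "gal_group \<phi> = \<lparr> carrier = {\<sigma>. bij \<sigma> \<and> is_field_hom \<sigma> \<and> (\<forall>x. \<sigma> (\<phi> x) = \<phi> x)},
                   mult = (\<circ>), one = id \<rparr>"

(* vertices of the d-ary rooted tree to level N: words over {0..<d} of length \<le> N *)
definition tree_verts :: "nat \<Rightarrow> nat \<Rightarrow> nat list set" where
  "tree_verts d N = {v. length v \<le> N \<and> set v \<subseteq> {0..<d}}"

(* [S_d]^N realised as the automorphism group of the d-ary rooted tree of level N *)
definition wreath_power :: "nat \<Rightarrow> nat \<Rightarrow> (nat list \<Rightarrow> nat list) monoid" where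
  "wreath_power d N = \<lparr> carrier = {\<sigma>. bij_betw \<sigma> (tree_verts d N) (tree_verts d N) \<and>
        (\<forall>v. v \<notin> tree_verts d N \<longrightarrow> \<sigma> v = v) \<and>
        (\<forall>v\<in>tree_verts d N. length (\<sigma> v) = length v \<and> \<sigma> (butlast v) = butlast (\<sigma> v))},
     mult = (\<circ>), one = id \<rparr>"

end

theory Submission
  imports Defs
    "HOL-Computational_Algebra.Formal_Laurent_Series"
    "HOL-Computational_Algebra.Polynomial_FPS"
begin

text \<open>
  The roots of \<open>f^n(x) - t\<close>, \<open>n \<le> N\<close>, form the \<open>d\<close>-ary tree, and the Galois group acts on it
  faithfully. By induction on the levels it suffices that for every \<open>n\<close> each transposition of two
  siblings of level \<open>n\<close> is induced on that level by the Galois group.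

  One transposition exists: at the critical value \<open>c = f^n(w)\<close> the polynomial \<open>f^n - c\<close> has a single
  double root and otherwise simple roots, so over \<open>k((t - c))\<close> all but two of the roots of
  \<open>f^n(x) - t\<close> are rational and the other two are not. Being equal or exchanged by a transposition
  is then a Galois-invariant equivalence relation on level \<open>n\<close> that refines the sibling relation.
  Its class of a root \<open>\<beta>\<close> is a block, which by a Lueroth argument is the zero set of
  \<open>h(x) - h(\<beta>)\<close> for a right composition factor \<open>h\<close> of \<open>f\<close>. As \<open>f\<close> is indecomposable and the group
  is transitive on level \<open>n\<close>, the classes are the full sets of siblings.
\<close>

section \<open>Subfields, homomorphisms and simple extensions\<close>

text \<open>All algebraic fields here are subsets of the given splitting field, and embeddings live
  on such subsets. Galois theory enters in two forms: an embedding over \<open>k(t)\<close> extends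
  to an automorphism, and the product of the \<open>x - b\<close> over an invariant set of roots has
  coefficients in the base subfield. The single double root comes from condition (2): another
  ramified point above \<open>c\<close>, or a further critical point on the orbit of
  \<open>w\<close>, would be a collision of critical orbits. Working in \<open>k((t - c))\<close>
  needs no case distinction between tame and wild ramification: it only matters that a double zero
  does not lift to a root there, and this holds in characteristic 2 as well. A transposition is
  controlled on a single level and may act in any way further away from the root of the tree. This
  suffices: an automorphism that agrees with a prescribed tree automorphism on level
  \<open>n\<close> differs from it on level \<open>n + 1\<close> by a permutation that preserves
  every set of siblings, and such a permutation is a product of transpositions of siblings.\<close>

definition polys_over :: "'a::comm_ring_1 set \<Rightarrow> 'a poly set" where
  "polys_over E = {p. \<forall>i. coeff p i \<in> E}"

text \<open>Values outside \<open>E\<close> are unconstrained: a partial embedding is a total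
  function, and extending it means agreeing with it on \<open>E\<close>. The condition at 1 excludes
  the zero map and so yields injectivity on \<open>E\<close>.\<close>

definition hom_on :: "'a::field set \<Rightarrow> ('a \<Rightarrow> 'b::field) \<Rightarrow> bool" where
  "hom_on E \<tau> \<longleftrightarrow> \<tau> 1 = 1 \<and> (\<forall>x\<in>E. \<forall>y\<in>E. \<tau> (x + y) = \<tau> x + \<tau> y \<and> \<tau> (x * y) = \<tau> x * \<tau> y)"

lemma is_field_hom_iff_hom_on: "is_field_hom \<tau> \<longleftrightarrow> hom_on UNIV \<tau>"
  unfolding is_field_hom_def hom_on_def by auto

lemma is_subfield_UNIV [simp]: "is_subfield UNIV"
  by (simp add: is_subfield_def)

lemma polys_over_UNIV [simp]: "p \<in> polys_over UNIV"
  by (simp add: polys_over_def)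

lemma polys_over_pConsD:
  assumes "pCons a p \<in> polys_over E"
  shows "a \<in> E" "p \<in> polys_over E"
proof -
  have *: "coeff (pCons a p) i \<in> E" for i using assms by (simp add: polys_over_def)
  show "a \<in> E" using *[of 0] by simp
  show "p \<in> polys_over E" using *[of "Suc _"] by (simp add: polys_over_def)
qed

context
  fixes E :: "'a::field set"
  assumes E: "is_subfield E"
begin

lemma subfield_0: "0 \<in> E" and subfield_1: "1 \<in> E"
  and subfield_add: "x \<in> E \<Longrightarrow> y \<in> E \<Longrightarrow> x + y \<in> E"
  and subfield_mult: "x \<in> E \<Longrightarrow> y \<in> E \<Longrightarrow> x * y \<in> E"
  and subfield_uminus: "x \<in> E \<Longrightarrow> - x \<in> E"
  and subfield_inverse: "x \<in> E \<Longrightarrow> inverse x \<in> E"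
  using E by (auto simp: is_subfield_def)

lemma subfield_diff: "x \<in> E \<Longrightarrow> y \<in> E \<Longrightarrow> x - y \<in> E"
  using subfield_add[of x "- y"] subfield_uminus[of y] by simp

lemma subfield_divide: "x \<in> E \<Longrightarrow> y \<in> E \<Longrightarrow> x / y \<in> E"
  using subfield_mult[of x "inverse y"] subfield_inverse[of y] by (simp add: divide_inverse)

lemma subfield_sum: "(\<And>i. i \<in> A \<Longrightarrow> g i \<in> E) \<Longrightarrow> sum g A \<in> E"
  by (induction A rule: infinite_finite_induct) (auto simp: subfield_0 subfield_add)

lemma subfield_power: "x \<in> E \<Longrightarrow> x ^ n \<in> E"
  by (induction n) (auto simp: subfield_1 subfield_mult)

lemma polys_over_0: "0 \<in> polys_over E"
  by (simp add: polys_over_def subfield_0)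

lemma polys_over_pCons: "a \<in> E \<Longrightarrow> p \<in> polys_over E \<Longrightarrow> pCons a p \<in> polys_over E"
  by (auto simp: polys_over_def coeff_pCons split: nat.split)

lemma polys_over_1: "1 \<in> polys_over E"
  by (auto simp: one_pCons intro!: polys_over_pCons polys_over_0 subfield_1)

lemma polys_over_add: "p \<in> polys_over E \<Longrightarrow> q \<in> polys_over E \<Longrightarrow> p + q \<in> polys_over E"
  by (simp add: polys_over_def subfield_add)

lemma polys_over_diff: "p \<in> polys_over E \<Longrightarrow> q \<in> polys_over E \<Longrightarrow> p - q \<in> polys_over E"
  by (simp add: polys_over_def subfield_diff)

lemma polys_over_mult: "p \<in> polys_over E \<Longrightarrow> q \<in> polys_over E \<Longrightarrow> p * q \<in> polys_over E"
  by (auto simp: polys_over_def coeff_mult intro!: subfield_sum subfield_mult)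

lemma polys_over_smult: "a \<in> E \<Longrightarrow> p \<in> polys_over E \<Longrightarrow> smult a p \<in> polys_over E"
  by (simp add: polys_over_def subfield_mult)

lemma polys_over_monom: "a \<in> E \<Longrightarrow> monom a n \<in> polys_over E"
  by (simp add: polys_over_def subfield_0)

lemma polys_over_const: "a \<in> E \<Longrightarrow> [:a:] \<in> polys_over E"
  by (intro polys_over_pCons polys_over_0)

lemma polys_over_linear: "a \<in> E \<Longrightarrow> [:- a, 1:] \<in> polys_over E"
  by (intro polys_over_pCons polys_over_0 subfield_1 subfield_uminus)

lemma polys_over_prod: "(\<And>i. i \<in> A \<Longrightarrow> g i \<in> polys_over E) \<Longrightarrow> prod g A \<in> polys_over E"
  by (induction A rule: infinite_finite_induct) (auto simp: polys_over_1 polys_over_mult)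

text \<open>Division by an element of least degree, carried out over \<open>E\<close>: leading
  coefficients are divided inside \<open>E\<close>, so the cofactor is over \<open>E\<close> again.
  It serves for the annihilator of an element and for an ideal generated by two polynomials.\<close>

lemma polys_over_ideal_principal:
  assumes I: "I \<subseteq> polys_over E" "p0 \<in> I" "p0 \<noteq> 0"
    and diff: "\<And>p q. p \<in> I \<Longrightarrow> q \<in> I \<Longrightarrow> p - q \<in> I"
    and mult: "\<And>p q. p \<in> I \<Longrightarrow> q \<in> polys_over E \<Longrightarrow> p * q \<in> I"
  obtains m where "m \<in> I" "m \<noteq> 0" "\<And>q. q \<in> I \<Longrightarrow> \<exists>s\<in>polys_over E. q = m * s"
proof -
  obtain m where m: "m \<in> I" "m \<noteq> 0" "\<And>q. q \<in> I \<Longrightarrow> q \<noteq> 0 \<Longrightarrow> degree m \<le> degree q"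
    using ex_has_least_nat[of "\<lambda>p. p \<in> I \<and> p \<noteq> 0" p0 degree] I by blast
  have "\<exists>s\<in>polys_over E. q = m * s" if "q \<in> I" for q
    using that
  proof (induction "degree q" arbitrary: q rule: less_induct)
    case less
    show ?case
    proof (cases "q = 0")
      case True
      then show ?thesis using polys_over_0 by (intro bexI[of _ 0]) auto
    next
      case False
      define c where "c = lead_coeff q / lead_coeff m"
      define u where "u = monom c (degree q - degree m)"
      have le: "degree m \<le> degree q" using m(3) less.prems False by blast
      have cE: "c \<in> E" unfolding c_def
        using I(1) less.prems m(1) by (intro subfield_divide) (auto simp: polys_over_def)
      have c0: "c \<noteq> 0" using False m(2) by (simp add: c_def)
      have uE: "u \<in> polys_over E" unfolding u_def by (rule polys_over_monom[OF cE])
      have du: "degree (m * u) = degree q"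
        using le m(2) c0 by (simp add: u_def degree_mult_eq degree_monom_eq monom_eq_0_iff)
      have lu: "lead_coeff (m * u) = lead_coeff q"
        using m(2) c0 by (simp add: lead_coeff_mult u_def degree_monom_eq c_def)
      define r where "r = q - m * u"
      have rI: "r \<in> I" unfolding r_def using diff mult m(1) uE less.prems by blast
      have "\<exists>s\<in>polys_over E. r = m * s"
      \<comment> \<open>In degree 0 the remainder cannot drop in degree, so it is shown to vanish
        directly.\<close>
      proof (cases "degree q = 0")
        case True
        have "degree r \<le> 0" using du True unfolding r_def by (intro degree_diff_le) auto
        moreover have "coeff r 0 = 0" using lu du True by (simp add: r_def)
        ultimately have "r = 0" by (metis degree_eq_zeroE le_zero_eq coeff_pCons_0 pCons_0_0)
        then show ?thesis using polys_over_0 by (intro bexI[of _ 0]) auto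
      next
        case False
        have "degree r < degree q"
        proof (rule degree_lessI)
          show "r \<noteq> 0 \<or> degree q > 0" using False by simp
          show "\<forall>k\<ge>degree q. coeff r k = 0"
          proof (intro allI impI)
            fix k assume k: "k \<ge> degree q"
            show "coeff r k = 0"
            proof (cases "k = degree q")
              case True then show ?thesis using lu du by (simp add: r_def)
            next
              case False
              then have "k > degree q" using k by simp
              then show ?thesis using du by (simp add: r_def coeff_eq_0)
            qed
          qed
        qed
        then show ?thesis using less.hyps rI by blast
      qed
      then obtain s where s: "s \<in> polys_over E" "r = m * s" by blast
      have "q = m * (u + s)" using s(2) by (simp add: r_def algebra_simps)
      then show ?thesis using polys_over_add[OF uE s(1)] by blast
    qed
  qed
  then show thesis using that m(1,2) by blast
qed

end

text \<open>A generator of the annihilator of \<open>x\<close> in \<open>E[x]\<close>, determined up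
  to a unit and not normalised to be monic.\<close>

definition is_minpoly :: "'a::field set \<Rightarrow> 'a \<Rightarrow> 'a poly \<Rightarrow> bool" where
  "is_minpoly E x m \<longleftrightarrow> m \<in> polys_over E \<and> m \<noteq> 0 \<and> poly m x = 0 \<and>
     (\<forall>q\<in>polys_over E. poly q x = 0 \<longrightarrow> (\<exists>s\<in>polys_over E. q = m * s))"

lemma minpoly_exists:
  assumes "is_subfield E" "p \<in> polys_over E" "p \<noteq> 0" "poly p x = 0"
  obtains m where "is_minpoly E x m"
proof -
  let ?I = "{q \<in> polys_over E. poly q x = 0}"
  obtain m where "m \<in> ?I" "m \<noteq> 0" "\<And>q. q \<in> ?I \<Longrightarrow> \<exists>s\<in>polys_over E. q = m * s"
  proof (rule polys_over_ideal_principal[OF assms(1), of ?I p])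
    show "?I \<subseteq> polys_over E" "p \<in> ?I" "p \<noteq> 0" using assms by auto
    show "q1 - q2 \<in> ?I" if "q1 \<in> ?I" "q2 \<in> ?I" for q1 q2
      using that polys_over_diff[OF assms(1)] by simp
    show "q1 * q2 \<in> ?I" if "q1 \<in> ?I" "q2 \<in> polys_over E" for q1 q2
      using that polys_over_mult[OF assms(1)] by simp
  qed blast
  then show thesis using that unfolding is_minpoly_def by blast
qed

section \<open>Homomorphisms on a subfield and their extension by one element\<close>

context
  fixes E :: "'a::field set" and \<tau> :: "'a \<Rightarrow> 'b::field"
  assumes E: "is_subfield E" and hom: "hom_on E \<tau>"
begin

lemma hom_on_1: "\<tau> 1 = 1"
  and hom_on_add: "x \<in> E \<Longrightarrow> y \<in> E \<Longrightarrow> \<tau> (x + y) = \<tau> x + \<tau> y"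
  and hom_on_mult: "x \<in> E \<Longrightarrow> y \<in> E \<Longrightarrow> \<tau> (x * y) = \<tau> x * \<tau> y"
  using hom by (auto simp: hom_on_def)

lemma hom_on_0: "\<tau> 0 = 0"
proof -
  have "\<tau> 0 + \<tau> 0 = \<tau> 0 + 0" using hom_on_add[of 0 0] subfield_0[OF E] by simp
  then show ?thesis by (rule add_left_imp_eq)
qed

lemma hom_on_uminus: "x \<in> E \<Longrightarrow> \<tau> (- x) = - \<tau> x"
  using hom_on_add[of x "- x"] subfield_uminus[OF E, of x] hom_on_0
  by (simp add: eq_neg_iff_add_eq_0 add.commute)

lemma hom_on_diff: "x \<in> E \<Longrightarrow> y \<in> E \<Longrightarrow> \<tau> (x - y) = \<tau> x - \<tau> y"
  using hom_on_add[of x "- y"] subfield_uminus[OF E, of y] hom_on_uminus by simp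

lemma hom_on_eq_0_iff: "x \<in> E \<Longrightarrow> \<tau> x = 0 \<longleftrightarrow> x = 0"
  using hom_on_mult[of x "inverse x"] subfield_inverse[OF E, of x] hom_on_0 hom_on_1
  by (cases "x = 0") auto

lemma hom_on_eq_iff: "x \<in> E \<Longrightarrow> y \<in> E \<Longrightarrow> \<tau> x = \<tau> y \<longleftrightarrow> x = y"
  using hom_on_eq_0_iff[of "x - y"] hom_on_diff subfield_diff[OF E] by simp

lemma hom_on_inverse: "x \<in> E \<Longrightarrow> \<tau> (inverse x) = inverse (\<tau> x)"
  using hom_on_mult[of x "inverse x"] subfield_inverse[OF E, of x] hom_on_0 hom_on_1
    inverse_unique[of "\<tau> x" "\<tau> (inverse x)"]
  by (cases "x = 0") auto

lemma hom_on_divide: "x \<in> E \<Longrightarrow> y \<in> E \<Longrightarrow> \<tau> (x / y) = \<tau> x / \<tau> y"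
  by (simp add: divide_inverse hom_on_mult hom_on_inverse subfield_inverse[OF E])

lemma hom_on_sum: "(\<And>i. i \<in> A \<Longrightarrow> g i \<in> E) \<Longrightarrow> \<tau> (sum g A) = (\<Sum>i\<in>A. \<tau> (g i))"
  by (induction A rule: infinite_finite_induct)
    (auto simp: hom_on_0 hom_on_add subfield_sum[OF E])

lemma hom_on_power: "x \<in> E \<Longrightarrow> \<tau> (x ^ n) = \<tau> x ^ n"
  by (induction n) (auto simp: hom_on_1 hom_on_mult subfield_power[OF E])

lemma coeff_map_hom_on: "coeff (map_poly \<tau> p) i = \<tau> (coeff p i)"
  by (simp add: coeff_map_poly hom_on_0)

lemma map_poly_hom_on_add:
  "p \<in> polys_over E \<Longrightarrow> q \<in> polys_over E \<Longrightarrow> map_poly \<tau> (p + q) = map_poly \<tau> p + map_poly \<tau> q"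
  by (rule poly_eqI) (auto simp: coeff_map_hom_on polys_over_def hom_on_add)

lemma map_poly_hom_on_diff:
  "p \<in> polys_over E \<Longrightarrow> q \<in> polys_over E \<Longrightarrow> map_poly \<tau> (p - q) = map_poly \<tau> p - map_poly \<tau> q"
  by (rule poly_eqI) (auto simp: coeff_map_hom_on polys_over_def hom_on_diff)

lemma map_poly_hom_on_mult:
  assumes "p \<in> polys_over E" "q \<in> polys_over E"
  shows "map_poly \<tau> (p * q) = map_poly \<tau> p * map_poly \<tau> q"
proof (rule poly_eqI)
  fix n
  have *: "coeff p i * coeff q j \<in> E" for i j
    using assms by (auto simp: polys_over_def intro!: subfield_mult[OF E])
  show "coeff (map_poly \<tau> (p * q)) n = coeff (map_poly \<tau> p * map_poly \<tau> q) n"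
    using assms
    by (auto simp: coeff_map_hom_on coeff_mult hom_on_sum * polys_over_def hom_on_mult)
qed

lemma map_poly_hom_on_prod:
  assumes "\<And>i. i \<in> A \<Longrightarrow> g i \<in> polys_over E"
  shows "map_poly \<tau> (prod g A) = (\<Prod>i\<in>A. map_poly \<tau> (g i))"
  using assms
  by (induction A rule: infinite_finite_induct)
    (auto simp: map_poly_hom_on_mult polys_over_prod[OF E] hom_on_1)

lemma map_poly_hom_on_linear: "b \<in> E \<Longrightarrow> map_poly \<tau> [:- b, 1:] = [:- \<tau> b, 1:]"
  by (simp add: map_poly_pCons hom_on_0 hom_on_1 hom_on_uminus)

lemma degree_map_hom_on: "p \<in> polys_over E \<Longrightarrow> degree (map_poly \<tau> p) = degree p"
  by (cases "p = 0") (auto intro!: map_poly_degree_eq simp: hom_on_eq_0_iff polys_over_def)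

lemma poly_map_hom_on:
  assumes "p \<in> polys_over E" "x \<in> E"
  shows "poly (map_poly \<tau> p) (\<tau> x) = \<tau> (poly p x)"
proof -
  have "poly (map_poly \<tau> p) (\<tau> x) = (\<Sum>i\<le>degree p. \<tau> (coeff p i) * \<tau> x ^ i)"
    using degree_map_hom_on[OF assms(1)] by (simp add: poly_altdef coeff_map_hom_on)
  also have "\<dots> = (\<Sum>i\<le>degree p. \<tau> (coeff p i * x ^ i))"
    using assms by (intro sum.cong) (auto simp: polys_over_def hom_on_mult hom_on_power subfield_power[OF E])
  also have "\<dots> = \<tau> (poly p x)"
    using assms
    by (subst hom_on_sum[symmetric])
      (auto simp: poly_altdef polys_over_def intro!: subfield_mult[OF E] subfield_power[OF E])
  finally show ?thesis .
qed

text \<open>\<open>E(x) = {q(x). q \<in> E[x]}\<close>, and \<open>q(x) \<mapsto> \<tau>(q)(r)\<close> is well defined since \<open>r\<close> is a zero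
  of the image of the minimal polynomial.\<close>

lemma hom_on_extend_root:
  assumes m: "is_minpoly E x m" and r: "poly (map_poly \<tau> m) r = 0"
  obtains E' \<tau>' where "is_subfield E'" "E \<subseteq> E'" "x \<in> E'" "hom_on E' \<tau>'"
    "\<And>y. y \<in> E \<Longrightarrow> \<tau>' y = \<tau> y" "\<tau>' x = r"
proof -
  define E' where "E' = (\<lambda>q. poly q x) ` polys_over E"
  define \<tau>' where "\<tau>' y = poly (map_poly \<tau> (SOME q. q \<in> polys_over E \<and> y = poly q x)) r" for y
  have mE: "m \<in> polys_over E" "m \<noteq> 0" "poly m x = 0"
    and mdvd: "\<And>q. q \<in> polys_over E \<Longrightarrow> poly q x = 0 \<Longrightarrow> \<exists>s\<in>polys_over E. q = m * s"
    using m by (auto simp: is_minpoly_def)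
  have \<tau>': "\<tau>' (poly q x) = poly (map_poly \<tau> q) r" if q: "q \<in> polys_over E" for q
  proof -
    define q' where "q' = (SOME q'. q' \<in> polys_over E \<and> poly q x = poly q' x)"
    have "q' \<in> polys_over E \<and> poly q x = poly q' x"
      unfolding q'_def by (rule someI[of _ q]) (use q in auto)
    then have q': "q' \<in> polys_over E" "poly q x = poly q' x" by auto
    obtain s where s: "s \<in> polys_over E" "q - q' = m * s"
      using mdvd[OF polys_over_diff[OF E q q'(1)]] q'(2) by auto
    have "map_poly \<tau> q - map_poly \<tau> q' = map_poly \<tau> m * map_poly \<tau> s"
      using map_poly_hom_on_diff[OF q q'(1)] map_poly_hom_on_mult[OF mE(1) s(1)] s(2) by simp
    then have "poly (map_poly \<tau> q) r - poly (map_poly \<tau> q') r = 0"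
      using r by (metis mult_zero_left poly_diff poly_mult)
    then show ?thesis unfolding \<tau>'_def q'_def by simp
  qed
  have inv: "\<exists>q'\<in>polys_over E. poly q' x = inverse (poly q x)" if q: "q \<in> polys_over E" for q
  proof (cases "poly q x = 0")
    case True
    then show ?thesis using polys_over_0[OF E] by (intro bexI[of _ 0]) auto
  next
    case False
    \<comment> \<open>Bezout for \<open>m\<close> and \<open>q\<close>. A generator \<open>g\<close>
      of this ideal does not vanish at \<open>x\<close>, as it divides \<open>q\<close>; so its
      cofactor in \<open>m\<close> does, is therefore a multiple of \<open>m\<close>, and
      \<open>g\<close> is constant. Writing this constant as \<open>a * m + b * q\<close> inverts
      \<open>q(x)\<close> up to a scalar.\<close>
    define I where "I = {a * m + b * q | a b. a \<in> polys_over E \<and> b \<in> polys_over E}"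
    have I: "a * m + b * q \<in> I" if "a \<in> polys_over E" "b \<in> polys_over E" for a b
      unfolding I_def using that by blast
    have "m \<in> I" "q \<in> I"
      using I[OF polys_over_1[OF E] polys_over_0[OF E]] I[OF polys_over_0[OF E] polys_over_1[OF E]]
      by simp_all
    have "I \<subseteq> polys_over E" unfolding I_def
      by (auto intro!: polys_over_add[OF E] polys_over_mult[OF E] q mE(1))
    have diff: "p1 - p2 \<in> I" if "p1 \<in> I" "p2 \<in> I" for p1 p2
    proof -
      from that obtain a b c d where *: "p1 = a * m + b * q" "p2 = c * m + d * q"
        "a \<in> polys_over E" "b \<in> polys_over E" "c \<in> polys_over E" "d \<in> polys_over E"
        unfolding I_def by blast
      have "p1 - p2 = (a - c) * m + (b - d) * q" using * by (simp add: algebra_simps)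
      then show ?thesis unfolding I_def using * polys_over_diff[OF E] by blast
    qed
    have mult: "p1 * p2 \<in> I" if "p1 \<in> I" "p2 \<in> polys_over E" for p1 p2
    proof -
      from that obtain a b where *: "p1 = a * m + b * q" "a \<in> polys_over E" "b \<in> polys_over E"
        unfolding I_def by blast
      have "p1 * p2 = (a * p2) * m + (b * p2) * q" using * by (simp add: algebra_simps)
      then show ?thesis unfolding I_def using * that(2) polys_over_mult[OF E] by blast
    qed
    obtain g where g: "g \<in> I" "g \<noteq> 0" "\<And>p. p \<in> I \<Longrightarrow> \<exists>s\<in>polys_over E. p = g * s"
      using polys_over_ideal_principal[OF E \<open>I \<subseteq> polys_over E\<close> \<open>m \<in> I\<close> mE(2) diff mult] by blast
    obtain s1 where s1: "s1 \<in> polys_over E" "m = g * s1" using g(3) \<open>m \<in> I\<close> by blast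
    obtain s2 where s2: "s2 \<in> polys_over E" "q = g * s2" using g(3) \<open>q \<in> I\<close> by blast
    have gx: "poly g x \<noteq> 0" using False s2(2) by auto
    then have "poly s1 x = 0" using s1(2) mE(3) by simp
    then obtain s3 where s3: "s1 = m * s3" using mdvd s1(1) by blast
    have "degree m = degree g + (degree m + degree s3)"
      using s1(2) s3 mE(2) by (metis degree_mult_eq mult_eq_0_iff)
    then have "degree g = 0" by simp
    then obtain c where c: "g = [:c:]" by (metis degree_eq_zeroE)
    have "c \<noteq> 0" using g(2) c by auto
    have "coeff g 0 \<in> E" using g(1) \<open>I \<subseteq> polys_over E\<close> by (auto simp: polys_over_def)
    then have "c \<in> E" using c by simp
    obtain a b where ab: "g = a * m + b * q" "a \<in> polys_over E" "b \<in> polys_over E"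
      using g(1) unfolding I_def by blast
    have "c = poly b x * poly q x"
      using arg_cong[OF ab(1), of "\<lambda>p. poly p x"] mE(3) c by simp
    then have "inverse c * poly b x = inverse (poly q x)"
      using \<open>c \<noteq> 0\<close> by (auto simp: field_simps)
    then have "poly (smult (inverse c) b) x = inverse (poly q x)" by simp
    then show ?thesis
      using polys_over_smult[OF E subfield_inverse[OF E \<open>c \<in> E\<close>] ab(3)] by blast
  qed
  have sub: "is_subfield E'"
    unfolding is_subfield_def
  proof (intro conjI ballI)
    show "0 \<in> E'" unfolding E'_def using polys_over_0[OF E] by force
    show "1 \<in> E'" unfolding E'_def using polys_over_1[OF E] by force
    fix y assume "y \<in> E'"
    then obtain p where p: "p \<in> polys_over E" "y = poly p x" unfolding E'_def by blast
    show "- y \<in> E'" unfolding E'_def p(2)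
      using polys_over_diff[OF E polys_over_0[OF E] p(1)] by (intro image_eqI[of _ _ "0 - p"]) auto
    show "inverse y \<in> E'" using inv[OF p(1)] unfolding E'_def p(2) by force
    fix z assume "z \<in> E'"
    then obtain q where q: "q \<in> polys_over E" "z = poly q x" unfolding E'_def by blast
    show "y + z \<in> E'" unfolding E'_def p(2) q(2)
      using polys_over_add[OF E p(1) q(1)] by (intro image_eqI[of _ _ "p + q"]) auto
    show "y * z \<in> E'" unfolding E'_def p(2) q(2)
      using polys_over_mult[OF E p(1) q(1)] by (intro image_eqI[of _ _ "p * q"]) auto
  qed
  have ext: "y \<in> E' \<and> \<tau>' y = \<tau> y" if "y \<in> E" for y
  proof -
    have *: "[:y:] \<in> polys_over E" using polys_over_const[OF E that] .
    have "\<tau>' (poly [:y:] x) = \<tau> y" using \<tau>'[OF *] by (simp add: map_poly_pCons hom_on_0)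
    moreover have "poly [:y:] x \<in> E'" unfolding E'_def using * by blast
    ultimately show ?thesis by simp
  qed
  have X: "[:0, 1:] \<in> polys_over E"
    using polys_over_linear[OF E subfield_0[OF E]] by simp
  have "x \<in> E'" unfolding E'_def using X by (intro image_eqI[of _ _ "[:0,1:]"]) auto
  moreover have "\<tau>' x = r" using \<tau>'[OF X] by (simp add: map_poly_pCons hom_on_0 hom_on_1)
  moreover have "hom_on E' \<tau>'"
    unfolding hom_on_def
  proof (intro conjI ballI)
    show "\<tau>' 1 = 1" using ext[OF subfield_1[OF E]] hom_on_1 by simp
    fix y z assume "y \<in> E'" "z \<in> E'"
    then obtain p q where p: "p \<in> polys_over E" "y = poly p x" and q: "q \<in> polys_over E" "z = poly q x"
      unfolding E'_def by blast
    show "\<tau>' (y + z) = \<tau>' y + \<tau>' z"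
      using \<tau>'[OF p(1)] \<tau>'[OF q(1)] \<tau>'[OF polys_over_add[OF E p(1) q(1)]] map_poly_hom_on_add[OF p(1) q(1)]
      by (simp add: p q)
    show "\<tau>' (y * z) = \<tau>' y * \<tau>' z"
      using \<tau>'[OF p(1)] \<tau>'[OF q(1)] \<tau>'[OF polys_over_mult[OF E p(1) q(1)]] map_poly_hom_on_mult[OF p(1) q(1)]
      by (simp add: p q)
  qed
  ultimately show thesis using that sub ext by blast
qed

text \<open>Here the zero \<open>r\<close> is given in the target and has to be hit. Minimal
  polynomials of zeros of \<open>Q\<close> are split off one after another until the image of one of
  them vanishes at \<open>r\<close>; then \<open>hom_on_extend_root\<close> sends a zero of that
  factor to \<open>r\<close>. The hypothesis \<open>split\<close> supplies zeros for the remaining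
  cofactors.\<close>

lemma hom_on_lift_root:
  assumes Q: "Q \<in> polys_over E" "Q \<noteq> 0"
    and split: "\<And>s. s dvd Q \<Longrightarrow> degree s > 0 \<Longrightarrow> \<exists>b. poly s b = 0"
    and r: "poly (map_poly \<tau> Q) r = 0"
  obtains E' \<tau>' b where "is_subfield E'" "E \<subseteq> E'" "b \<in> E'" "hom_on E' \<tau>'"
    "\<And>y. y \<in> E \<Longrightarrow> \<tau>' y = \<tau> y" "\<tau>' b = r" "poly Q b = 0"
proof -
  have "\<exists>b m. poly Q b = 0 \<and> is_minpoly E b m \<and> poly (map_poly \<tau> m) r = 0"
    using assms
  proof (induction "degree Q" arbitrary: Q rule: less_induct)
    case less
    have "degree Q > 0"
    proof (rule ccontr)
      assume "\<not> ?thesis"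
      then obtain c where c: "Q = [:c:]" by (metis degree_eq_zeroE neq0_conv)
      then have "c \<in> E" "c \<noteq> 0" using less.prems by (auto simp: polys_over_def) (metis coeff_pCons_0)
      then show False using less.prems(4) c hom_on_0 hom_on_eq_0_iff by (simp add: map_poly_pCons)
    qed
    then obtain b where b: "poly Q b = 0" using less.prems(3)[of Q] by auto
    obtain m where m: "is_minpoly E b m" using minpoly_exists[OF E less.prems(1,2) b] .
    then obtain s where s: "s \<in> polys_over E" "Q = m * s" and mE: "m \<in> polys_over E" "m \<noteq> 0" "poly m b = 0"
      using less.prems(1) b unfolding is_minpoly_def by blast
    show ?case
    proof (cases "poly (map_poly \<tau> m) r = 0")
      case True then show ?thesis using b m by blast
    next
      case False
      have s0: "s \<noteq> 0" using less.prems(2) s(2) by auto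
      have "degree m > 0"
      proof (rule ccontr)
        assume "\<not> ?thesis"
        then obtain c where "m = [:c:]" by (metis degree_eq_zeroE neq0_conv)
        then show False using mE by simp
      qed
      then have "degree s < degree Q" using s mE s0 by (simp add: degree_mult_eq)
      moreover have "poly (map_poly \<tau> s) r = 0"
        using less.prems(4) False s mE by (simp add: map_poly_hom_on_mult)
      moreover have "\<exists>b. poly s' b = 0" if "s' dvd s" "degree s' > 0" for s'
        using less.prems(3)[OF _ that(2)] that(1) s(2) by simp
      ultimately obtain b' m' where "poly s b' = 0" "is_minpoly E b' m'" "poly (map_poly \<tau> m') r = 0"
        using less.hyps[OF _ s(1) s0] by blast
      then show ?thesis using s(2) by auto
    qed
  qed
  then show thesis using hom_on_extend_root that by metis
qed

end

section \<open>Rational function fields\<close>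

abbreviation peval :: "('k::field \<Rightarrow> 'b::field) \<Rightarrow> 'k poly \<Rightarrow> 'b \<Rightarrow> 'b" where
  "peval \<kappa> p y \<equiv> poly (map_poly \<kappa> p) y"

definition transcendental_over :: "('k::field \<Rightarrow> 'b::field) \<Rightarrow> 'b \<Rightarrow> bool" where
  "transcendental_over \<kappa> y \<longleftrightarrow> (\<forall>p. p \<noteq> 0 \<longrightarrow> peval \<kappa> p y \<noteq> 0)"

text \<open>Substitution of \<open>y\<close> for \<open>t\<close> in \<open>k(t)\<close>. For
  transcendental \<open>y\<close> no denominator vanishes and the chosen representative does not
  matter (\<open>fract_eval_Fract\<close>).\<close>

definition fract_eval :: "('k::field \<Rightarrow> 'b::field) \<Rightarrow> 'b \<Rightarrow> 'k poly fract \<Rightarrow> 'b" where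
  "fract_eval \<kappa> y z = (SOME w. \<exists>p q. q \<noteq> 0 \<and> z = Fract p q \<and> w = peval \<kappa> p y / peval \<kappa> q y)"

context
  fixes \<kappa> :: "'k::field \<Rightarrow> 'b::field"
  assumes \<kappa>: "is_field_hom \<kappa>"
begin

lemma field_hom_hom_on: "hom_on UNIV \<kappa>"
  using \<kappa> is_field_hom_iff_hom_on by blast

lemmas field_hom_1 = hom_on_1[OF is_subfield_UNIV field_hom_hom_on]
  and field_hom_0 = hom_on_0[OF is_subfield_UNIV field_hom_hom_on]
  and field_hom_add = hom_on_add[OF is_subfield_UNIV field_hom_hom_on UNIV_I UNIV_I]
  and field_hom_diff = hom_on_diff[OF is_subfield_UNIV field_hom_hom_on UNIV_I UNIV_I]
  and field_hom_mult = hom_on_mult[OF is_subfield_UNIV field_hom_hom_on UNIV_I UNIV_I]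
  and field_hom_divide = hom_on_divide[OF is_subfield_UNIV field_hom_hom_on UNIV_I UNIV_I]
  and field_hom_uminus = hom_on_uminus[OF is_subfield_UNIV field_hom_hom_on UNIV_I]
  and field_hom_inverse = hom_on_inverse[OF is_subfield_UNIV field_hom_hom_on UNIV_I]
  and field_hom_eq_0_iff = hom_on_eq_0_iff[OF is_subfield_UNIV field_hom_hom_on UNIV_I]
  and field_hom_eq_iff = hom_on_eq_iff[OF is_subfield_UNIV field_hom_hom_on UNIV_I UNIV_I]
  and coeff_map_field_hom = coeff_map_hom_on[OF is_subfield_UNIV field_hom_hom_on]
  and map_field_hom_add = map_poly_hom_on_add[OF is_subfield_UNIV field_hom_hom_on polys_over_UNIV polys_over_UNIV]
  and map_field_hom_diff = map_poly_hom_on_diff[OF is_subfield_UNIV field_hom_hom_on polys_over_UNIV polys_over_UNIV]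
  and map_field_hom_mult = map_poly_hom_on_mult[OF is_subfield_UNIV field_hom_hom_on polys_over_UNIV polys_over_UNIV]
  and map_field_hom_prod = map_poly_hom_on_prod[OF is_subfield_UNIV field_hom_hom_on polys_over_UNIV]
  and map_field_hom_linear = map_poly_hom_on_linear[OF is_subfield_UNIV field_hom_hom_on UNIV_I]
  and degree_map_field_hom = degree_map_hom_on[OF is_subfield_UNIV field_hom_hom_on polys_over_UNIV]
  and peval_field_hom = poly_map_hom_on[OF is_subfield_UNIV field_hom_hom_on polys_over_UNIV UNIV_I]

lemma map_field_hom_pCons: "map_poly \<kappa> (pCons a p) = pCons (\<kappa> a) (map_poly \<kappa> p)"
  by (simp add: map_poly_pCons field_hom_0)

lemma map_field_hom_const: "map_poly \<kappa> [:a:] = [:\<kappa> a:]"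
  by (simp add: map_field_hom_pCons)

lemma map_field_hom_smult: "map_poly \<kappa> (smult a p) = smult (\<kappa> a) (map_poly \<kappa> p)"
  by (rule poly_eqI) (simp add: coeff_map_field_hom field_hom_mult)

lemma map_field_hom_pcompose: "map_poly \<kappa> (pcompose p q) = pcompose (map_poly \<kappa> p) (map_poly \<kappa> q)"
  by (induction p)
    (auto simp: pcompose_pCons map_field_hom_pCons map_field_hom_add map_field_hom_mult)

lemma peval_pcompose: "peval \<kappa> (pcompose p q) y = peval \<kappa> p (peval \<kappa> q y)"
  by (simp add: map_field_hom_pcompose poly_pcompose)

lemma map_field_hom_pderiv: "map_poly \<kappa> (pderiv p) = pderiv (map_poly \<kappa> p)"
proof -
  have "\<kappa> (of_nat n) = of_nat n" for n
    by (induction n) (auto simp: field_hom_0 field_hom_1 field_hom_add)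
  then show ?thesis
    by (intro poly_eqI) (simp add: coeff_map_field_hom coeff_pderiv field_hom_mult del: of_nat_Suc)
qed

lemma is_subfield_range: "is_subfield (range \<kappa>)"
proof -
  have "\<exists>z. \<kappa> x + \<kappa> y = \<kappa> z" "\<exists>z. \<kappa> x * \<kappa> y = \<kappa> z" "\<exists>z. - \<kappa> x = \<kappa> z" "\<exists>z. inverse (\<kappa> x) = \<kappa> z" for x y
    by (metis field_hom_add field_hom_mult field_hom_uminus field_hom_inverse)+
  moreover have "\<exists>z. 0 = \<kappa> z" "\<exists>z. 1 = \<kappa> z" by (metis field_hom_0 field_hom_1)+
  ultimately show ?thesis unfolding is_subfield_def by (auto simp: image_iff)
qed

lemma fract_eval_Fract:
  assumes y: "transcendental_over \<kappa> y" and q: "q \<noteq> 0"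
  shows "fract_eval \<kappa> y (Fract p q) = peval \<kappa> p y / peval \<kappa> q y"
  unfolding fract_eval_def
proof (rule some_equality)
  show "\<exists>p' q'. q' \<noteq> 0 \<and> Fract p q = Fract p' q' \<and> peval \<kappa> p y / peval \<kappa> q y = peval \<kappa> p' y / peval \<kappa> q' y"
    using q by blast
  fix w assume "\<exists>p' q'. q' \<noteq> 0 \<and> Fract p q = Fract p' q' \<and> w = peval \<kappa> p' y / peval \<kappa> q' y"
  then obtain p' q' where *: "q' \<noteq> 0" "Fract p q = Fract p' q'" "w = peval \<kappa> p' y / peval \<kappa> q' y"
    by blast
  have "p * q' = p' * q" using *(2) q *(1) by (simp add: eq_fract)
  then have "peval \<kappa> p y * peval \<kappa> q' y = peval \<kappa> p' y * peval \<kappa> q y"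
    by (metis map_field_hom_mult poly_mult)
  then show "w = peval \<kappa> p y / peval \<kappa> q y"
    using y q * by (simp add: transcendental_over_def frac_eq_eq)
qed

lemma is_field_hom_fract_eval:
  assumes y: "transcendental_over \<kappa> y"
  shows "is_field_hom (fract_eval \<kappa> y)"
proof -
  have nz: "peval \<kappa> q y \<noteq> 0" if "q \<noteq> 0" for q using y that by (simp add: transcendental_over_def)
  have "fract_eval \<kappa> y 1 = 1"
    using fract_eval_Fract[OF y, of 1 1] by (simp add: One_fract_def field_hom_1)
  moreover have "fract_eval \<kappa> y (a + b) = fract_eval \<kappa> y a + fract_eval \<kappa> y b
     \<and> fract_eval \<kappa> y (a * b) = fract_eval \<kappa> y a * fract_eval \<kappa> y b" for a b
    by (cases a; cases b)
      (auto simp: fract_eval_Fract[OF y] map_field_hom_mult map_field_hom_add nz field_simps)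
  ultimately show ?thesis unfolding is_field_hom_def by blast
qed

lemma fract_eval_poly:
  assumes y: "transcendental_over \<kappa> y"
  shows "fract_eval \<kappa> y (Fract p 1) = peval \<kappa> p y"
  using fract_eval_Fract[OF y, of 1 p] by (simp add: field_hom_1)

end

lemma field_hom_peval:
  assumes "is_field_hom \<kappa>" "is_subfield E" "hom_on E \<sigma>" "range \<kappa> \<subseteq> E" "y \<in> E"
  shows "\<sigma> (peval \<kappa> p y) = peval (\<lambda>a. \<sigma> (\<kappa> a)) p (\<sigma> y)"
proof -
  have "map_poly \<kappa> p \<in> polys_over E"
    using assms(4) by (auto simp: polys_over_def coeff_map_field_hom[OF assms(1)])
  then have "poly (map_poly \<sigma> (map_poly \<kappa> p)) (\<sigma> y) = \<sigma> (peval \<kappa> p y)"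
    using poly_map_hom_on assms by blast
  moreover have "map_poly \<sigma> (map_poly \<kappa> p) = map_poly (\<lambda>a. \<sigma> (\<kappa> a)) p"
    by (subst map_poly_map_poly) (auto simp: field_hom_0 hom_on_0[OF assms(2,3)] assms(1) o_def)
  ultimately show ?thesis by simp
qed

text \<open>Injectivity of a field homomorphism makes the image of \<open>t\<close> transcendental
  over the constants, and quotients of polynomials then determine \<phi>. The structure map of the
  splitting field thus has the same form as the embeddings of \<open>k(t)\<close> that send
  \<open>t\<close> to a root or to a Laurent series.\<close>

lemma field_hom_fract_decomp:
  fixes \<phi> :: "'k::field poly fract \<Rightarrow> 'b::field"
  assumes \<phi>: "is_field_hom \<phi>"
  defines "\<kappa> \<equiv> \<lambda>a. \<phi> (Fract [:a:] 1)" and "T \<equiv> \<phi> (Fract [:0, 1:] 1)"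
  shows "is_field_hom \<kappa>" "transcendental_over \<kappa> T" "\<phi> = fract_eval \<kappa> T"
proof -
  show \<kappa>: "is_field_hom \<kappa>"
    unfolding is_field_hom_def \<kappa>_def
    using field_hom_1[OF \<phi>] field_hom_add[OF \<phi>, symmetric] field_hom_mult[OF \<phi>, symmetric]
    by (simp add: One_fract_def[symmetric] one_pCons[symmetric] mult.commute)
  have p: "\<phi> (Fract p 1) = peval \<kappa> p T" for p
  proof (induction p)
    case 0
    show ?case using field_hom_0[OF \<phi>] by (simp add: Zero_fract_def)
  next
    case (pCons a p)
    have "Fract (pCons a p) 1 = Fract [:a:] 1 + Fract [:0, 1:] 1 * Fract p 1" by simp
    then have "\<phi> (Fract (pCons a p) 1) = \<kappa> a + T * peval \<kappa> p T"
      using pCons.IH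
      by (simp add: field_hom_add[OF \<phi>] field_hom_mult[OF \<phi>] \<kappa>_def T_def del: mult_fract add_fract)
    then show ?case by (simp add: map_field_hom_pCons[OF \<kappa>])
  qed
  show T: "transcendental_over \<kappa> T"
    unfolding transcendental_over_def
  proof (intro allI impI)
    fix p :: "'k poly" assume "p \<noteq> 0"
    then have "Fract p 1 \<noteq> 0" by (simp add: Zero_fract_def eq_fract)
    then show "peval \<kappa> p T \<noteq> 0" using p field_hom_eq_0_iff[OF \<phi>] by metis
  qed
  show "\<phi> = fract_eval \<kappa> T"
  proof
    fix z :: "'k poly fract"
    obtain a b where z: "z = Fract a b" "b \<noteq> 0" by (cases z)
    have "z = Fract a 1 / Fract b 1" using z by simp
    then show "\<phi> z = fract_eval \<kappa> T z"
      using fract_eval_Fract[OF \<kappa> T z(2), of a] p field_hom_divide[OF \<phi>] z by (metis)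
  qed
qed

section \<open>Polynomials with generic critical orbits\<close>

lemma alg_closed_root:
  fixes q :: "'k::field poly"
  assumes "alg_closed_field TYPE('k)" "degree q \<ge> 1"
  obtains x where "poly q x = 0"
  using assms unfolding alg_closed_field_def by blast

lemma degree_minus_const [simp]:
  fixes p :: "'a::ab_group_add poly"
  shows "degree (p - [:c:]) = degree p"
  by (cases p) (simp add: degree_pCons_eq_if)

lemma card_simple_roots:
  fixes h :: "'k::field poly"
  assumes ac: "alg_closed_field TYPE('k)" and "h \<noteq> 0"
    and "\<And>x. poly h x = 0 \<Longrightarrow> poly (pderiv h) x \<noteq> 0"
  shows "card {x. poly h x = 0} = degree h"
  using assms(2,3)
proof (induction "degree h" arbitrary: h)
  case 0
  then obtain c where "h = [:c:]" by (metis degree_eq_zeroE)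
  then show ?case using 0 by auto
next
  case (Suc n)
  obtain a where a: "poly h a = 0" using alg_closed_root[OF ac, of h] Suc.hyps(2) by auto
  then obtain s where s: "h = [:-a, 1:] * s" by (metis dvd_def poly_eq_0_iff_dvd)
  have s0: "s \<noteq> 0" using s Suc.prems(1) by auto
  have ds: "degree h = Suc (degree s)" using s s0 by (simp add: degree_mult_eq del: mult_pCons_left)
  have der: "poly (pderiv h) x = poly s x + (x - a) * poly (pderiv s) x" for x
    unfolding s pderiv_mult by (simp add: pderiv_pCons algebra_simps del: mult_pCons_left)
  have "poly s a \<noteq> 0" using Suc.prems(2)[OF a] der[of a] by simp
  moreover have roots: "poly h x = 0 \<longleftrightarrow> x = a \<or> poly s x = 0" for x
    unfolding s by (auto simp del: mult_pCons_left)
  ultimately have "card {x. poly h x = 0} = Suc (card {x. poly s x = 0})"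
    using poly_roots_finite[OF s0] by (simp add: Collect_disj_eq)
  moreover have "poly (pderiv s) x \<noteq> 0" if "poly s x = 0" for x
    using Suc.prems(2)[of x] der[of x] roots[of x] that by auto
  ultimately show ?case using Suc.hyps(1)[of s] Suc.hyps(2) ds s0 by simp
qed

lemma separable_poly_no_double_root:
  assumes "separable_poly q" "[:-a, 1:] ^ 2 dvd q"
  shows False
proof -
  obtain s where s: "q = [:-a, 1:] ^ 2 * s" using assms(2) by (auto simp: dvd_def)
  have "[:-a, 1:] dvd pderiv q"
    unfolding s power2_eq_square mult.assoc pderiv_mult[of "[:-a, 1:]" "[:-a, 1:] * s"]
    by (intro dvd_add dvd_triv_left dvd_mult2)
  moreover have "[:-a, 1:] dvd q" using assms(2) by (metis dvd_mult_left power2_eq_square)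
  ultimately have "is_unit [:-a, 1:]"
    using assms(1) unfolding separable_poly_def by (meson coprime_common_divisor)
  then show False by (simp add: is_unit_poly_iff)
qed

lemma degree_pderiv_of_nat_nonzero:
  fixes g :: "'k::field poly"
  assumes "of_nat (degree g) \<noteq> (0 :: 'k)"
  shows "degree (pderiv g) = degree g - 1"
proof (cases "degree g")
  case 0
  then show ?thesis using assms by simp
next
  case (Suc n)
  then have "coeff (pderiv g) n \<noteq> 0"
    using assms by (auto simp: coeff_pderiv simp del: of_nat_Suc)
      (metis Suc leading_coeff_0_iff degree_0 nat.distinct(1))
  then have "degree (pderiv g) \<ge> n" by (rule le_degree)
  moreover have "degree (pderiv g) \<le> n"
    by (rule degree_le) (use Suc in \<open>auto simp: coeff_pderiv coeff_eq_0\<close>)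
  ultimately show ?thesis using Suc by simp
qed

lemma poly_iter_0 [simp]: "poly_iter f 0 = [:0, 1:]"
  by (simp add: poly_iter_def)

lemma poly_iter_Suc: "poly_iter f (Suc n) = pcompose f (poly_iter f n)"
  by (simp add: poly_iter_def)

lemma poly_iter_Suc': "poly_iter f (Suc n) = pcompose (poly_iter f n) f"
proof (induction n)
  case 0
  then show ?case by (simp add: poly_iter_Suc pcompose_pCons)
next
  case (Suc n)
  then show ?case by (metis poly_iter_Suc pcompose_assoc)
qed

lemma poly_poly_iter: "poly (poly_iter f n) x = (poly f ^^ n) x"
  by (induction n) (auto simp: poly_iter_Suc poly_pcompose)

lemma degree_poly_iter:
  fixes f :: "'a::idom poly"
  shows "degree (poly_iter f n) = degree f ^ n"
  by (induction n) (auto simp: poly_iter_Suc degree_pcompose)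

lemma poly_pderiv_poly_iter_eq_0:
  fixes f :: "'k::field poly"
  assumes "poly (pderiv (poly_iter f n)) x = 0"
  shows "\<exists>j<n. (poly f ^^ j) x \<in> critical_points f"
  using assms
proof (induction n)
  case 0
  then show ?case by (simp add: pderiv_pCons)
next
  case (Suc n)
  then have "poly (pderiv f) ((poly f ^^ n) x) = 0 \<or> poly (pderiv (poly_iter f n)) x = 0"
    by (simp add: poly_iter_Suc pderiv_pcompose poly_pcompose poly_poly_iter)
  then show ?case using Suc.IH by (auto simp: critical_points_def less_Suc_eq)
qed

lemma poly_pderiv_linear_mult:
  fixes s :: "'k::field poly"
  shows "poly (pderiv ([:-a, 1:] * s)) a = poly s a"
  unfolding pderiv_mult by (simp add: pderiv_pCons del: mult_pCons_left)

section \<open>Polynomials in \<open>H_set\<close>: decompositions, critical points,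
  iterates\<close>

context
  fixes f :: "'k::field poly" and d N :: nat
  assumes ac: "alg_closed_field TYPE('k)"
    and d: "d \<ge> 2" and N: "N \<ge> 1" and d2: "\<not> (d = 2 \<and> CHAR('k) = 2)"
    and f: "f \<in> H_set d N TYPE('k)"
begin

lemma H_set_degree: "degree f = d"
  using f by (simp add: H_set_def)

lemma H_set_orbits_disjoint:
  assumes "w \<in> critical_points f" "w' \<in> critical_points f" "m \<le> N" "n \<le> N"
    "(poly f ^^ n) w = (poly f ^^ m) w'"
  shows "n = m \<and> w = w'"
  using f assms unfolding H_set_def by blast

text \<open>If \<open>p\<close> does not divide \<open>d\<close> and \<open>f = g o h\<close> with
  both degrees at least 2, then \<open>g'\<close> has a zero \<open>v\<close>. All zeros of
  \<open>u = h - v\<close> are critical points of \<open>f\<close> with the common value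
  \<open>g(v)\<close>, so by condition (2) they coincide in one point \<open>a\<close>. For
  \<open>p\<close> other than 2, \<open>(x - a)^2\<close> divides \<open>f'\<close>, against
  separability. For \<open>p = 2\<close> the degree \<open>d\<close> is odd, hence \<open>h\<close>
  has degree at least 3, and \<open>(x - a)^3\<close> divides \<open>f - g(v)\<close>, against
  condition (3).\<close>

lemma H_set_indecomposable: "indecomposable_poly f"
proof (cases "CHAR('k) dvd d")
  case True
  then show ?thesis using f by (simp add: H_set_def)
next
  case False
  show ?thesis
    unfolding indecomposable_poly_def
  proof (intro allI impI, rule ccontr)
    fix g h assume fgh: "f = pcompose g h" and neg: "\<not> (degree g = 1 \<or> degree h = 1)"
    have dd: "d = degree g * degree h"
      using H_set_degree fgh degree_pcompose[of g h] by simp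
    then have "degree g \<noteq> 0" "degree h \<noteq> 0" using d by (metis mult_0 mult_0_right not_numeral_le_zero)+
    then have dg: "degree g \<ge> 2" and dh: "degree h \<ge> 2" using neg by linarith+
    have "of_nat (degree g) \<noteq> (0::'k)"
      using False dd by (metis dvd_mult2 of_nat_eq_0_iff_char_dvd)
    then have "degree (pderiv g) \<ge> 1" using degree_pderiv_of_nat_nonzero[of g] dg by simp
    then obtain v where v: "poly (pderiv g) v = 0" using alg_closed_root[OF ac] by blast
    define u where "u = h - [:v:]"
    have du: "degree u = degree h" unfolding u_def by simp
    have "[:-v, 1:] dvd pderiv g" using v by (simp add: poly_eq_0_iff_dvd)
    then obtain q where q: "pderiv g = [:-v, 1:] * q" by (auto simp: dvd_def)
    have uu: "pcompose [:-v, 1:] h = u" by (simp add: u_def pcompose_pCons)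
    have udvd: "u dvd pderiv f"
      unfolding fgh pderiv_pcompose q pcompose_mult uu by (simp add: mult.assoc)
    have "[:-v, 1:] dvd g - [:poly g v:]" by (simp add: poly_eq_0_iff_dvd[symmetric])
    then obtain q' where q': "g - [:poly g v:] = [:-v, 1:] * q'" by (auto simp: dvd_def)
    have "f - [:poly g v:] = pcompose (g - [:poly g v:]) h"
      by (simp add: fgh pcompose_diff)
    then have udvd': "u dvd f - [:poly g v:]"
      unfolding q' pcompose_mult uu by simp
    have same: "x = y" if "poly u x = 0" "poly u y = 0" for x y
    proof -
      have "x \<in> critical_points f" "y \<in> critical_points f"
        using that udvd unfolding critical_points_def by (auto simp: dvd_def)
      moreover have "poly f x = poly f y"
        using that by (simp add: fgh poly_pcompose u_def)
      ultimately show ?thesis using H_set_orbits_disjoint[of x y 1 1] N by simp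
    qed
    obtain a where a: "poly u a = 0" using alg_closed_root[OF ac, of u] du dh by auto
    then obtain s where s: "u = [:-a, 1:] * s" by (metis dvd_def poly_eq_0_iff_dvd)
    have s0: "s \<noteq> 0" using s du dh by auto
    have ds: "degree u = Suc (degree s)" using s s0 by (simp add: degree_mult_eq del: mult_pCons_left)
    obtain b where b: "poly s b = 0" using alg_closed_root[OF ac, of s] du ds dh by auto
    have "b = a" using same[of b a] a b s by (simp del: mult_pCons_left)
    then obtain s2 where s2: "s = [:-a, 1:] * s2" using b by (metis dvd_def poly_eq_0_iff_dvd)
    have us2: "u = [:-a, 1:] ^ 2 * s2" unfolding s s2 by (simp only: power2_eq_square mult.assoc)
    show False
    proof (cases "CHAR('k) = 2")
      case False
      then have "separable_poly (pderiv f)" using f by (simp add: H_set_def)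
      moreover have "[:-a, 1:] ^ 2 dvd pderiv f" using udvd us2 by (metis dvd_mult_left)
      ultimately show False by (rule separable_poly_no_double_root)
    next
      case True
      then have "odd d" using False by simp
      then have "degree h \<noteq> 2" using dd by auto
      moreover have "degree s = Suc (degree s2)"
        using s2 s0 by (auto simp: degree_mult_eq simp del: mult_pCons_left)
      ultimately have "degree s2 \<ge> 1" using du ds dh by linarith
      then obtain b' where b': "poly s2 b' = 0" using alg_closed_root[OF ac, of s2] by auto
      have "b' = a" using same[of b' a] a b' us2 by (simp del: mult_pCons_left)
      then obtain s3 where s3: "s2 = [:-a, 1:] * s3" using b' by (metis dvd_def poly_eq_0_iff_dvd)
      have "u = [:-a, 1:] ^ 3 * s3"
        unfolding us2 s3 by (simp only: power3_eq_cube power2_eq_square mult.assoc)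
      then have "[:-a, 1:] ^ 3 dvd f - [:poly g v:]" using udvd' by (metis dvd_mult_left)
      then show False using f True by (auto simp: H_set_def)
    qed
  qed
qed

text \<open>The exclusion of \<open>d = p = 2\<close> enters here: when \<open>p\<close> divides
  \<open>d\<close>, the degree of \<open>f'\<close> is \<open>d - 2\<close>, which is positive once
  \<open>d\<close> is at least 3. It provides the critical point from which the transpositions
  come.\<close>

lemma H_set_degree_pderiv: "degree (pderiv f) \<ge> 1"
proof (cases "CHAR('k) dvd d")
  case True
  have "d \<noteq> 2"
  proof
    assume "d = 2"
    then have "CHAR('k) dvd 2" "CHAR('k) \<noteq> 2" using True d2 by auto
    moreover have "CHAR('k) \<noteq> 1" using CHAR_not_1[where ?'a='k] by simp
    moreover have "CHAR('k) \<noteq> 0" using \<open>CHAR('k) dvd 2\<close> by (metis dvd_0_left_iff zero_neq_numeral)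
    moreover have "CHAR('k) \<le> 2" using \<open>CHAR('k) dvd 2\<close> dvd_imp_le by force
    ultimately show False by linarith
  qed
  then show ?thesis using f True d by (simp add: H_set_def)
next
  case False
  then have "of_nat (degree f) \<noteq> (0::'k)"
    using H_set_degree by (simp add: of_nat_eq_0_iff_char_dvd)
  then show ?thesis using degree_pderiv_of_nat_nonzero[of f] H_set_degree d by simp
qed

lemma H_set_critical_point_exists: obtains w where "w \<in> critical_points f"
  using alg_closed_root[OF ac H_set_degree_pderiv] unfolding critical_points_def by blast

text \<open>By the chain rule this derivative is a product of composites of \<open>f'\<close>, none
  of which is the zero polynomial. It makes \<open>f^n(x) - t\<close> separable in every
  characteristic.\<close>

lemma H_set_pderiv_poly_iter_nonzero: "pderiv (poly_iter f n) \<noteq> 0"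
proof (induction n)
  case 0
  then show ?case by (simp add: pderiv_pCons)
next
  case (Suc n)
  have "degree (poly_iter f n) \<noteq> 0" using degree_poly_iter[of f n] H_set_degree d by simp
  then have "pcompose (pderiv f) (poly_iter f n) \<noteq> 0"
    using H_set_degree_pderiv by (auto simp: pcompose_eq_0_iff)
  then show ?case using Suc by (simp add: poly_iter_Suc pderiv_pcompose)
qed

text \<open>A zero of order 3 of \<open>f - f(w)\<close> is forbidden by condition (3) if
  \<open>p = 2\<close>; for other \<open>p\<close> it would give a double zero of the separable
  polynomial \<open>f'\<close>.\<close>

lemma H_set_simple_critical_point:
  assumes w: "w \<in> critical_points f"
  obtains u where "f - [:poly f w:] = [:-w, 1:] ^ 2 * u" "poly u w \<noteq> 0"
proof -
  have "poly (f - [:poly f w:]) w = 0" by simp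
  then obtain s where s: "f - [:poly f w:] = [:-w, 1:] * s" by (metis dvd_def poly_eq_0_iff_dvd)
  have pd: "pderiv f = pderiv ([:-w, 1:] * s)"
    unfolding s[symmetric] by (simp add: pderiv_diff)
  have "poly s w = 0" using w poly_pderiv_linear_mult[of w s] pd by (simp add: critical_points_def)
  then obtain u where u: "s = [:-w, 1:] * u" by (metis dvd_def poly_eq_0_iff_dvd)
  have eq: "f - [:poly f w:] = [:-w, 1:] ^ 2 * u"
    unfolding s u by (simp only: power2_eq_square mult.assoc)
  moreover have "poly u w \<noteq> 0"
  proof
    assume "poly u w = 0"
    then obtain u' where u': "u = [:-w, 1:] * u'" by (metis dvd_def poly_eq_0_iff_dvd)
    have eq3: "f - [:poly f w:] = [:-w, 1:] ^ 3 * u'"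
      unfolding eq u' by (simp only: power3_eq_cube power2_eq_square mult.assoc)
    show False
    proof (cases "CHAR('k) = 2")
      case True
      moreover have "[:-w, 1:] ^ 3 dvd f - [:poly f w:]" unfolding eq3 by simp
      ultimately show False using f by (auto simp: H_set_def)
    next
      case False
      then have "separable_poly (pderiv f)" using f by (simp add: H_set_def)
      moreover have "[:-w, 1:] ^ 2 dvd pderiv f"
      proof -
        have "pderiv f = pderiv ([:-w, 1:] ^ 3 * u')" unfolding eq3[symmetric] by (simp add: pderiv_diff)
        also have "\<dots> = [:-w, 1:] ^ 2 * (smult 3 u' * pderiv [:-w, 1:] + [:-w, 1:] * pderiv u')"
          unfolding pderiv_mult pderiv_power
          by (simp add: numeral_3_eq_3 algebra_simps power2_eq_square del: mult_pCons_left mult_pCons_right)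
        finally show ?thesis by simp
      qed
      ultimately show False by (rule separable_poly_no_double_root)
    qed
  qed
  ultimately show thesis using that by blast
qed

text \<open>In \<open>F = G o f\<close> the multiplicity 2 comes from \<open>f\<close> alone:
  \<open>G\<close> is unramified at \<open>f(w)\<close>, since a critical point
  \<open>f^j(f(w))\<close> would be hit by critical orbits at the different heights
  \<open>j + 1\<close> and 0. For another \<open>x\<close> above the same value, a critical point
  \<open>f^j(x)\<close> reaches \<open>F(w)\<close> after \<open>n - j\<close> steps and
  \<open>w\<close> does so after \<open>n\<close>; condition (2) forces \<open>j = 0\<close> and
  \<open>x = w\<close>.\<close>

lemma H_set_iter_double_root:
  assumes w: "w \<in> critical_points f" and n: "1 \<le> n" "n \<le> N"
  defines "F \<equiv> poly_iter f n"
  obtains h where "F - [:poly F w:] = [:-w, 1:] ^ 2 * h" "poly h w \<noteq> 0"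
    "\<And>x. poly F x = poly F w \<Longrightarrow> x \<noteq> w \<Longrightarrow> poly (pderiv F) x \<noteq> 0"
proof -
  obtain n' where n': "n = Suc n'" using n(1) by (cases n) auto
  define G where "G = poly_iter f n'"
  define v where "v = poly f w"
  have FG: "F = pcompose G f" unfolding F_def G_def n' by (rule poly_iter_Suc')
  obtain u where u: "f - [:v:] = [:-w, 1:] ^ 2 * u" "poly u w \<noteq> 0"
    using H_set_simple_critical_point[OF w] unfolding v_def by blast
  have "poly (G - [:poly G v:]) v = 0" by simp
  then obtain s where s: "G - [:poly G v:] = [:-v, 1:] * s" by (metis dvd_def poly_eq_0_iff_dvd)
  have "pderiv G = pderiv ([:-v, 1:] * s)"
    unfolding s[symmetric] by (simp add: pderiv_diff)
  then have sv: "poly s v = poly (pderiv G) v" by (simp only: poly_pderiv_linear_mult)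
  have "poly (pderiv G) v \<noteq> 0"
  proof
    assume "poly (pderiv G) v = 0"
    then obtain j where j: "j < n'" "(poly f ^^ j) v \<in> critical_points f"
      using poly_pderiv_poly_iter_eq_0 unfolding G_def by blast
    have "(poly f ^^ Suc j) w = (poly f ^^ 0) ((poly f ^^ j) v)"
      by (simp add: v_def funpow_swap1)
    then have "Suc j = 0" using H_set_orbits_disjoint[OF w j(2), of 0 "Suc j"] j(1) n' n by simp
    then show False by simp
  qed
  have "F - [:poly F w:] = pcompose (G - [:poly G v:]) f"
    by (simp add: FG v_def pcompose_diff poly_pcompose)
  also have "\<dots> = (f - [:v:]) * pcompose s f"
    unfolding s pcompose_mult by (simp add: pcompose_pCons)
  also have "\<dots> = [:-w, 1:] ^ 2 * (u * pcompose s f)" unfolding u by (simp only: mult.assoc)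
  finally have eq: "F - [:poly F w:] = [:-w, 1:] ^ 2 * (u * pcompose s f)" .
  have "poly (u * pcompose s f) w \<noteq> 0"
    using u(2) sv \<open>poly (pderiv G) v \<noteq> 0\<close> by (simp add: poly_pcompose v_def[symmetric])
  moreover have "poly (pderiv F) x \<noteq> 0" if x: "poly F x = poly F w" "x \<noteq> w" for x
  proof
    assume "poly (pderiv F) x = 0"
    then obtain j where j: "j < n" "(poly f ^^ j) x \<in> critical_points f"
      using poly_pderiv_poly_iter_eq_0 unfolding F_def by blast
    have "(poly f ^^ (n - j)) ((poly f ^^ j) x) = (poly f ^^ n) x"
      using j(1) by (simp flip: funpow_add[THEN fun_cong, unfolded o_apply])
    also have "\<dots> = (poly f ^^ n) w" using x(1) by (simp add: F_def poly_poly_iter)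
    finally have "n - j = n \<and> (poly f ^^ j) x = w"
      using H_set_orbits_disjoint[OF j(2) w, of n "n - j"] n by simp
    then have "j = 0" "(poly f ^^ j) x = w" using j(1) by auto
    then show False using x(2) by simp
  qed
  ultimately show thesis using that eq by blast
qed

end

text \<open>At a zero of \<open>h\<close> the derivative of \<open>F\<close> equals
  \<open>(x - w)^2 h'(x)\<close>, so the simplicity of the zeros of \<open>F - c\<close> away from
  \<open>w\<close> passes to \<open>h\<close>, whose zeros are then counted by its degree.\<close>

lemma card_roots_one_double_root:
  fixes F :: "'k::field poly"
  assumes ac: "alg_closed_field TYPE('k)"
    and F: "F - [:c:] = [:-w, 1:] ^ 2 * h" "poly h w \<noteq> 0"
    and simple: "\<And>x. poly F x = c \<Longrightarrow> x \<noteq> w \<Longrightarrow> poly (pderiv F) x \<noteq> 0"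
  shows "card {r. poly F r = c \<and> r \<noteq> w} + 2 = degree F"
proof -
  have h0: "h \<noteq> 0" using F(2) by auto
  have roots: "poly F x - c = (x - w)\<^sup>2 * poly h x" for x
    using arg_cong[OF F(1), of "\<lambda>p. poly p x"] by (simp del: mult_pCons_left)
  have "pderiv F = pderiv ([:-w, 1:] ^ 2 * h)" unfolding F(1)[symmetric] by (simp add: pderiv_diff)
  also have "\<dots> = [:-w, 1:] ^ 2 * pderiv h + h * pderiv ([:-w, 1:] ^ 2)" by (rule pderiv_mult)
  finally have der: "poly (pderiv F) x = (x - w)\<^sup>2 * poly (pderiv h) x" if "poly h x = 0" for x
    using that by simp
  have eq: "{r. poly F r = c \<and> r \<noteq> w} = {x. poly h x = 0}"
    using roots F(2) by (auto simp: eq_iff_diff_eq_0[of _ c])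
  have "card {x. poly h x = 0} = degree h"
  proof (rule card_simple_roots[OF ac h0])
    fix x assume "poly h x = 0"
    then show "poly (pderiv h) x \<noteq> 0" using der[of x] simple[of x] eq by auto
  qed
  moreover have "degree (F - [:c:]) = 2 + degree h"
    unfolding F(1) using h0 by (simp add: degree_mult_eq degree_power_eq del: mult_pCons_left)
  ultimately show ?thesis using eq by (simp only: degree_minus_const)
qed

section \<open>Roots in a field of Laurent series\<close>

lemma is_field_hom_fls_const: "is_field_hom (fls_const :: 'k::field \<Rightarrow> 'k fls)"
  unfolding is_field_hom_def by (simp add: fls_plus_const fls_const_mult_const)

lemma poly_map_fps_const_compose:
  fixes p :: "'k::field poly"
  assumes "U $ 0 = 0"
  shows "poly (map_poly fps_const p) U = fps_of_poly p oo U"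
proof (induction p)
  case (pCons a p)
  then show ?case using assms
    by (simp add: map_poly_pCons fps_of_poly_pCons fps_compose_add_distrib fps_compose_mult_distrib mult.commute)
qed simp

lemma peval_fls_const_fps:
  fixes p :: "'k::field poly"
  shows "peval fls_const p (fps_to_fls Y) = fps_to_fls (poly (map_poly fps_const p) Y)"
proof (induction p)
  case (pCons a p)
  then show ?case
    by (simp add: map_poly_pCons fls_plus_const fls_times_fps_to_fls)
qed simp

lemma map_fps_const_pcompose:
  fixes p :: "'k::field poly"
  shows "poly (map_poly fps_const (pcompose p [:r, 1:])) Y = poly (map_poly fps_const p) (fps_const r + Y)"
proof -
  have "map_poly fps_const (p + q) = map_poly fps_const p + map_poly fps_const q" for p q :: "'k poly"
    by (rule poly_eqI) (simp add: coeff_map_poly)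
  moreover have "map_poly fps_const (smult a q) = smult (fps_const a) (map_poly fps_const q)" for a and q :: "'k poly"
    by (rule poly_eqI) (simp add: coeff_map_poly)
  ultimately show ?thesis
    by (induction p) (auto simp: pcompose_pCons map_poly_pCons algebra_simps)
qed

lemma transcendental_fls_X_plus_const:
  fixes c :: "'k::field"
  shows "transcendental_over fls_const (fls_const c + fls_X)"
  unfolding transcendental_over_def
proof (intro allI impI)
  fix p :: "'k poly" assume p: "p \<noteq> 0"
  have "peval fls_const p (fps_to_fls (fps_const c + fps_X))
    = fps_to_fls (fps_of_poly (pcompose p [:c, 1:]))"
    unfolding peval_fls_const_fps map_fps_const_pcompose[symmetric]
    by (subst poly_map_fps_const_compose) auto
  moreover have "pcompose p [:c, 1:] \<noteq> 0" using p by (simp add: pcompose_eq_0_iff)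
  ultimately show "peval fls_const p (fls_const c + fls_X) \<noteq> 0"
    by (simp add: fls_plus_const fps_to_fls_eq_0_iff)
qed

section \<open>Lifting simple zeros to power series\<close>

context
  fixes F :: "'k::field poly" and c r :: 'k
  assumes r: "poly F r = c" "poly (pderiv F) r \<noteq> 0"
begin

abbreviation (input) shifted_series :: "'k fps" where
  "shifted_series \<equiv> fps_of_poly (pcompose F [:r, 1:] - [:c:])"

lemma shifted_series_nth: "shifted_series $ 0 = 0" "shifted_series $ 1 \<noteq> 0"
proof -
  show "shifted_series $ 0 = 0" using r by (simp add: pcompose_coeff_0)
  have "coeff (pcompose F [:r, 1:]) 1 = poly (pderiv (pcompose F [:r, 1:])) 0"
    by (simp add: poly_0_coeff_0 coeff_pderiv)
  also have "\<dots> = poly (pderiv F) r"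
    by (simp add: pderiv_pcompose poly_pcompose pderiv_pCons)
  finally show "shifted_series $ 1 \<noteq> 0" using r by simp
qed

lemma poly_fps_eq_iff_shifted:
  assumes "U $ 0 = 0"
  shows "poly (map_poly fps_const F) (fps_const r + U) = fps_const c + fps_X \<longleftrightarrow> shifted_series oo U = fps_X"
proof -
  have "poly (map_poly fps_const F) (fps_const r + U) = fps_of_poly (pcompose F [:r, 1:]) oo U"
    unfolding map_fps_const_pcompose[symmetric] poly_map_fps_const_compose[OF assms] ..
  also have "fps_of_poly (pcompose F [:r, 1:]) = shifted_series + fps_const c"
    by (simp add: fps_of_poly_diff)
  also have "\<dots> oo U = (shifted_series oo U) + fps_const c"
    by (simp add: fps_compose_add_distrib)
  finally show ?thesis by (simp add: add.commute)
qed

text \<open>\<open>F(r + U) - c\<close> is a series in \<open>U\<close> with zero constant term and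
  nonzero linear coefficient, so its compositional inverse is the one \<open>U\<close> without
  constant term that solves \<open>F(r + U) = c + X\<close>.\<close>

lemma simple_root_lifts: "\<exists>!Y. Y $ 0 = r \<and> poly (map_poly fps_const F) Y = fps_const c + fps_X"
proof (rule ex_ex1I)
  have i0: "fps_inv shifted_series $ 0 = 0" by (simp add: fps_inv_def)
  show "\<exists>Y. Y $ 0 = r \<and> poly (map_poly fps_const F) Y = fps_const c + fps_X"
    using poly_fps_eq_iff_shifted[OF i0] fps_inv_right[OF shifted_series_nth] i0
    by (intro exI[of _ "fps_const r + fps_inv shifted_series"]) simp
next
  have U: "Y = fps_const r + fps_inv shifted_series"
    if Y: "Y $ 0 = r \<and> poly (map_poly fps_const F) Y = fps_const c + fps_X" for Y
  proof -
    define U where "U = Y - fps_const r"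
    have U0: "U $ 0 = 0" using Y by (simp add: U_def)
    have "shifted_series oo U = fps_X"
      using poly_fps_eq_iff_shifted[OF U0] Y by (simp add: U_def)
    then have "fps_inv shifted_series oo (shifted_series oo U) = fps_inv shifted_series" by simp
    then have "fps_X oo U = fps_inv shifted_series"
      using fps_compose_assoc[OF U0 shifted_series_nth(1)] fps_inv[OF shifted_series_nth] by metis
    then show ?thesis using U0 by (simp add: U_def algebra_simps)
  qed
  fix Y Y' assume "Y $ 0 = r \<and> poly (map_poly fps_const F) Y = fps_const c + fps_X"
    "Y' $ 0 = r \<and> poly (map_poly fps_const F) Y' = fps_const c + fps_X"
  then show "Y = Y'" using U by metis
qed

end

lemma poly_map_fps_const_nth_0:
  fixes p :: "'k::field poly"
  shows "poly (map_poly fps_const p) Y $ 0 = poly p (Y $ 0)"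
  by (induction p) (auto simp: map_poly_pCons)

text \<open>If \<open>Y\<close> had a pole, only the top term of \<open>F\<close> would contribute
  at order \<open>n * fls_subdegree Y\<close>, leaving a pole in \<open>F(Y)\<close>, whereas
  \<open>c + X\<close> has none.\<close>

lemma fls_root_integral:
  fixes F :: "'k::field poly"
  assumes "peval fls_const F Y = fls_const c + fls_X" "degree F \<ge> 1"
  shows "fls_subdegree Y \<ge> 0"
proof (rule ccontr)
  assume neg: "\<not> ?thesis"
  define n where "n = degree F"
  have Y0: "Y \<noteq> 0" using neg by auto
  have sum_nth: "fls_nth (sum g A) i = (\<Sum>j\<in>A. fls_nth (g j) i)" for A i and g :: "nat \<Rightarrow> 'k fls"
    by (induction A rule: infinite_finite_induct) auto
  have low: "fls_nth (fls_const (coeff F i) * Y ^ i) (int n * fls_subdegree Y) = 0" if "i < n" for i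
  proof -
    have "fls_subdegree (Y ^ i) = int i * fls_subdegree Y" by (simp add: fls_subdegree_pow)
    then have "int n * fls_subdegree Y < fls_subdegree (Y ^ i)"
      using that neg by simp
    then show ?thesis by (simp add: fls_eq0_below_subdegree)
  qed
  have "peval fls_const F Y = (\<Sum>i\<le>n. fls_const (coeff F i) * Y ^ i)"
    using degree_map_field_hom[OF is_field_hom_fls_const, of F]
    by (simp add: poly_altdef n_def coeff_map_poly)
  then have "fls_nth (peval fls_const F Y) (int n * fls_subdegree Y)
    = fls_nth (fls_const (coeff F n) * Y ^ n) (int n * fls_subdegree Y)"
    using low by (auto simp: sum_nth lessThan_Suc_atMost[symmetric] intro!: sum.neutral)
  also have "\<dots> \<noteq> 0"
  proof -
    have "coeff F n \<noteq> 0" unfolding n_def using assms(2) by (metis degree_0 leading_coeff_0_iff not_one_le_zero)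
    moreover have "fls_nth (Y ^ n) (fls_subdegree (Y ^ n)) \<noteq> 0" using Y0 by (simp add: nth_fls_subdegree_nonzero)
    ultimately show ?thesis by (simp add: fls_subdegree_pow)
  qed
  also have "fls_nth (peval fls_const F Y) (int n * fls_subdegree Y) = 0"
  proof -
    have "int n * fls_subdegree Y < 0" using neg assms(2) by (simp add: n_def mult_pos_neg)
    then show ?thesis unfolding assms(1) by auto
  qed
  finally show False by simp
qed

text \<open>The solutions are power series by \<open>fls_root_integral\<close>, and taking the
  constant term identifies them with the simple zeros of \<open>F - c\<close> by
  \<open>simple_root_lifts\<close>.\<close>

lemma card_fls_roots:
  fixes F :: "'k::field poly"
  assumes F: "F - [:c:] = [:-w, 1:] ^ 2 * h" "h \<noteq> 0"
    and simple: "\<And>x. poly F x = c \<Longrightarrow> x \<noteq> w \<Longrightarrow> poly (pderiv F) x \<noteq> 0"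
  shows "card {Y. peval fls_const F Y = fls_const c + fls_X} = card {r. poly F r = c \<and> r \<noteq> w}"
proof -
  define S where "S = {Y :: 'k fps. poly (map_poly fps_const F) Y = fps_const c + fps_X}"
  have deg: "degree F \<ge> 1"
  proof (rule ccontr)
    assume "\<not> ?thesis"
    then obtain a where "F = [:a:]" by (metis degree_eq_zeroE less_one not_le)
    then have "degree ([:-w, 1:] ^ 2 * h) = 0" using F(1) by (metis degree_pCons_0 diff_pCons diff_self)
    then show False using F(2) by (simp add: degree_mult_eq degree_power_eq del: mult_pCons_left)
  qed
  have const: "fls_const c + fls_X = fps_to_fls (fps_const c + fps_X)" by (simp add: fls_plus_const)
  have "{Y. peval fls_const F Y = fls_const c + fls_X} = fps_to_fls ` S"
  proof (intro equalityI subsetI)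
    fix Y assume "Y \<in> {Y. peval fls_const F Y = fls_const c + fls_X}"
    then have Y: "peval fls_const F Y = fls_const c + fls_X" by simp
    then have "fls_subdegree Y \<ge> 0" using fls_root_integral deg by blast
    then have eq: "fps_to_fls (fls_regpart Y) = Y" by simp
    have "fps_to_fls (poly (map_poly fps_const F) (fls_regpart Y)) = fps_to_fls (fps_const c + fps_X)"
      unfolding peval_fls_const_fps[symmetric] eq Y const ..
    then have "fls_regpart Y \<in> S"
      unfolding S_def fps_to_fls_eq_iff by blast
    then show "Y \<in> fps_to_fls ` S" using eq by (metis image_eqI)
  next
    fix Y assume "Y \<in> fps_to_fls ` S"
    then show "Y \<in> {Y. peval fls_const F Y = fls_const c + fls_X}"
      unfolding S_def const by (auto simp: peval_fls_const_fps)
  qed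
  then have "card {Y. peval fls_const F Y = fls_const c + fls_X} = card S"
    by (simp add: card_image inj_on_def)
  also have "bij_betw (\<lambda>Y. Y $ 0) S {r. poly F r = c \<and> r \<noteq> w}"
  proof (rule bij_betwI')
    have S0: "poly F (Y $ 0) = c \<and> Y $ 0 \<noteq> w" if "Y \<in> S" for Y
    proof
      have Y: "poly (map_poly fps_const F) Y = fps_const c + fps_X" using that by (simp add: S_def)
      show "poly F (Y $ 0) = c" using Y poly_map_fps_const_nth_0[of F Y] by simp
      show "Y $ 0 \<noteq> w"
      proof
        assume "Y $ 0 = w"
        define Z where "Z = fps_const (- w) + Y"
        have Z: "Z $ 0 = 0" using \<open>Y $ 0 = w\<close> by (simp add: Z_def)
        have sum: "fps_const (sum g A) = (\<Sum>i\<in>A. fps_const (g i))" for A and g :: "nat \<Rightarrow> 'k"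
          by (induction A rule: infinite_finite_induct) (auto simp flip: fps_const_add)
        have map: "map_poly fps_const (p * q) = map_poly fps_const p * map_poly fps_const q"
          "map_poly fps_const (p - q) = map_poly fps_const p - map_poly fps_const q" for p q :: "'k poly"
          by (rule poly_eqI; simp add: coeff_map_poly coeff_mult sum)+
        have "map_poly fps_const F - [:fps_const c:] = map_poly fps_const (F - [:c:])"
          by (simp add: map map_poly_pCons)
        also have "\<dots> = [:- fps_const w, 1:] ^ 2 * map_poly fps_const h"
          unfolding F(1) by (simp add: map map_poly_pCons power2_eq_square del: mult_pCons_left mult_pCons_right)
        finally have "poly (map_poly fps_const F - [:fps_const c:]) Y
          = poly ([:- fps_const w, 1:] ^ 2 * map_poly fps_const h) Y" by simp
        then have "poly (map_poly fps_const F) Y - fps_const c = Z ^ 2 * poly (map_poly fps_const h) Y"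
          by (simp add: Z_def del: mult_pCons_left)
        \<comment> \<open>The right-hand side has order at least 2 because \<open>Z\<close> has no
          constant term: the double zero \<open>w\<close> does not lift.\<close>
        then have "fps_X = Z * (Z * poly (map_poly fps_const h) Y)"
          using Y by (simp add: power2_eq_square mult.assoc)
        then have "fps_X $ 1 = (Z * (Z * poly (map_poly fps_const h) Y)) $ 1" by simp
        then show False using Z by (simp add: fps_mult_nth_1)
      qed
    qed
    then show "Y $ 0 \<in> {r. poly F r = c \<and> r \<noteq> w}" if "Y \<in> S" for Y using that by simp
    show "(Y $ 0 = Y' $ 0) = (Y = Y')" if "Y \<in> S" "Y' \<in> S" for Y Y'
    proof
      assume eq: "Y $ 0 = Y' $ 0"
      have "\<exists>!Z. Z $ 0 = Y $ 0 \<and> poly (map_poly fps_const F) Z = fps_const c + fps_X"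
        using S0[OF that(1)] simple by (intro simple_root_lifts) auto
      moreover have "Y $ 0 = Y $ 0 \<and> poly (map_poly fps_const F) Y = fps_const c + fps_X"
        using that(1) by (simp add: S_def)
      moreover have "Y' $ 0 = Y $ 0 \<and> poly (map_poly fps_const F) Y' = fps_const c + fps_X"
        using that(2) eq by (simp add: S_def)
      ultimately show "Y = Y'" by metis
    qed simp
    show "\<exists>Y\<in>S. r = Y $ 0" if "r \<in> {r. poly F r = c \<and> r \<noteq> w}" for r
      using that simple_root_lifts[of F r c] simple[of r] unfolding S_def by blast
  qed
  then have "card S = card {r. poly F r = c \<and> r \<noteq> w}" by (rule bij_betw_same_card)
  finally show ?thesis .
qed

section \<open>Blocks and polynomial decompositions\<close>

lemma map_poly_ring_hom:
  fixes h :: "'a::comm_ring_1 \<Rightarrow> 'b::comm_ring_1"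
  assumes "h 0 = 0" "\<And>x y. h (x + y) = h x + h y" "\<And>x y. h (x * y) = h x * h y"
  shows "map_poly h (p + q) = map_poly h p + map_poly h q"
    and "map_poly h (p * q) = map_poly h p * map_poly h q"
proof -
  have sum: "h (sum g A) = (\<Sum>i\<in>A. h (g i))" for A and g :: "nat \<Rightarrow> 'a"
    by (induction A rule: infinite_finite_induct) (auto simp: assms)
  show "map_poly h (p + q) = map_poly h p + map_poly h q"
    by (rule poly_eqI) (simp add: coeff_map_poly assms)
  show "map_poly h (p * q) = map_poly h p * map_poly h q"
    by (rule poly_eqI) (simp add: coeff_map_poly assms coeff_mult sum)
qed

lemma smult_left_imp_eq:
  fixes p q :: "'a::field poly"
  assumes "a \<noteq> 0" "smult a p = smult a q"
  shows "p = q"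
proof -
  have "smult (inverse a) (smult a p) = smult (inverse a) (smult a q)" using assms(2) by simp
  then show ?thesis using assms(1) by simp
qed

lemma prod_linear_dvd:
  fixes P :: "'a::field poly"
  assumes "finite B" "\<And>b. b \<in> B \<Longrightarrow> poly P b = 0"
  shows "(\<Prod>b\<in>B. [:- b, 1:]) dvd P"
  using assms
proof (induction B arbitrary: P rule: finite_induct)
  case (insert a B)
  have "poly P a = 0" using insert.prems by simp
  then obtain s where s: "P = [:-a, 1:] * s" by (metis dvd_def poly_eq_0_iff_dvd)
  have "poly s b = 0" if "b \<in> B" for b
    using insert.prems[of b] insert.hyps that s by (auto simp del: mult_pCons_left)
  then have "(\<Prod>b\<in>B. [:- b, 1:]) dvd s" using insert.IH by blast
  then show ?case using insert.hyps s by (simp add: mult_dvd_mono del: mult_pCons_left)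
qed simp

lemma degree_prod_linear:
  fixes B :: "'a::field set"
  shows "finite B \<Longrightarrow> degree (\<Prod>b\<in>B. [:- b, 1:]) = card B"
  by (subst degree_prod_eq_sum_degree) auto

lemma lead_coeff_prod_linear:
  fixes B :: "'a::field set"
  shows "lead_coeff (\<Prod>b\<in>B. [:- b, 1:]) = 1"
  by (simp add: lead_coeff_prod)

lemma poly_prod_linear_eq_0_iff:
  fixes B :: "'a::field set"
  shows "finite B \<Longrightarrow> poly (\<Prod>b\<in>B. [:- b, 1:]) x = 0 \<longleftrightarrow> x \<in> B"
  by (auto simp: poly_prod)

text \<open>\<open>i\<close> is the largest index of a coefficient of maximal degree, so that the degree with respect
  to the inner variable is additive under multiplication.\<close>

definition dominant_coeff :: "'k::field poly poly \<Rightarrow> nat \<Rightarrow> bool" where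
  "dominant_coeff P i \<longleftrightarrow> coeff P i \<noteq> 0 \<and> (\<forall>j. degree (coeff P j) \<le> degree (coeff P i)) \<and>
     (\<forall>j>i. coeff P j = 0 \<or> degree (coeff P j) < degree (coeff P i))"

lemma dominant_coeff_exists:
  assumes "P \<noteq> 0"
  obtains i where "dominant_coeff P i"
proof -
  define S where "S = {i. coeff P i \<noteq> 0}"
  have "S \<subseteq> {..degree P}" unfolding S_def using le_degree by auto
  then have fin: "finite S" using finite_subset by blast
  have ne: "S \<noteq> {}" unfolding S_def using assms by (auto simp: poly_eq_iff)
  define D where "D = Max ((\<lambda>i. degree (coeff P i)) ` S)"
  define S' where "S' = {i\<in>S. degree (coeff P i) = D}"
  have "D \<in> (\<lambda>i. degree (coeff P i)) ` S" unfolding D_def using fin ne by (intro Max_in) auto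
  then have ne': "S' \<noteq> {}" "finite S'" unfolding S'_def using fin by auto
  have le: "degree (coeff P j) \<le> D" if "j \<in> S" for j
    unfolding D_def using fin that by (intro Max_ge) auto
  define i where "i = Max S'"
  have i: "i \<in> S'" unfolding i_def using ne' by (intro Max_in) auto
  have "degree (coeff P j) \<le> D" for j using le[of j] by (cases "j \<in> S") (auto simp: S_def)
  moreover have "coeff P j = 0 \<or> degree (coeff P j) < D" if "j > i" for j
  proof -
    have "j \<notin> S'" using that ne' unfolding i_def by (metis Max_ge not_le)
    then show ?thesis using le[of j] unfolding S'_def S_def by fastforce
  qed
  ultimately show thesis using i that[of i] unfolding dominant_coeff_def S'_def S_def by auto
qed

text \<open>For \<open>l\<close> other than \<open>i\<close>, one of the indices \<open>l\<close>
  and \<open>i + j - l\<close> lies beyond its dominant index, so that product stays below the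
  extreme degree. Only the product of the two dominant coefficients reaches it, and nothing cancels
  its leading term.\<close>

lemma degree_coeff_mult_dominant:
  assumes "dominant_coeff P i" "dominant_coeff Q j"
  shows "degree (coeff (P * Q) (i + j)) \<ge> degree (coeff P i) + degree (coeff Q j)"
proof (rule le_degree)
  define D where "D = degree (coeff P i) + degree (coeff Q j)"
  have zero: "coeff (coeff P l * coeff Q (i + j - l)) D = 0" if l: "l \<le> i + j" "l \<noteq> i" for l
  proof (cases "coeff P l = 0 \<or> coeff Q (i + j - l) = 0")
    case False
    have "degree (coeff P l) + degree (coeff Q (i + j - l)) < D"
    proof (cases "l > i")
      case True
      then have "degree (coeff P l) < degree (coeff P i)" using False assms(1) by (auto simp: dominant_coeff_def)
      moreover have "degree (coeff Q (i + j - l)) \<le> degree (coeff Q j)" using assms(2) by (auto simp: dominant_coeff_def)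
      ultimately show ?thesis by (simp add: D_def)
    next
      case False2: False
      then have "i + j - l > j" using l by simp
      then have "degree (coeff Q (i + j - l)) < degree (coeff Q j)" using False assms(2) by (auto simp: dominant_coeff_def)
      moreover have "degree (coeff P l) \<le> degree (coeff P i)" using assms(1) by (auto simp: dominant_coeff_def)
      ultimately show ?thesis by (simp add: D_def)
    qed
    then show ?thesis using False by (intro coeff_eq_0) (simp add: degree_mult_eq)
  qed auto
  have "coeff (coeff (P * Q) (i + j)) D = (\<Sum>l\<le>i + j. coeff (coeff P l * coeff Q (i + j - l)) D)"
    by (simp add: coeff_mult coeff_sum)
  also have "\<dots> = (\<Sum>l\<in>{i}. coeff (coeff P l * coeff Q (i + j - l)) D)"
    using zero by (intro sum.mono_neutral_right) auto
  also have "\<dots> = lead_coeff (coeff P i) * lead_coeff (coeff Q j)"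
    by (simp add: D_def coeff_mult_degree_sum)
  also have "\<dots> \<noteq> 0" using assms by (simp add: dominant_coeff_def)
  finally show "coeff (coeff (P * Q) (i + j)) (degree (coeff P i) + degree (coeff Q j)) \<noteq> 0"
    unfolding D_def .
qed

text \<open>Repeated division by \<open>h\<close>, with the digits sorted by powers of
  \<open>x\<close>: the powers of \<open>x\<close> below \<open>degree h\<close> generate
  \<open>k[x]\<close> as a module over \<open>k[h]\<close>.\<close>

lemma base_expansion:
  fixes h p :: "'k::field poly"
  assumes h: "degree h \<ge> 1"
  shows "\<exists>A. p = (\<Sum>i<degree h. monom 1 i * pcompose (A i) h)"
proof (induction "degree p" arbitrary: p rule: less_induct)
  case less
  define r where "r = p mod h"
  have h0: "h \<noteq> 0" using h by auto
  have dr: "degree r < degree h" unfolding r_def using h degree_mod_less[OF h0, of p] by auto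
  have r: "r = (\<Sum>i<degree h. monom (coeff r i) i)"
  proof -
    have "r = (\<Sum>i\<le>degree h - 1. monom (coeff r i) i)"
      using dr by (intro poly_as_sum_of_monoms'[symmetric]) simp
    moreover have "{..degree h - 1} = {..<degree h}" using h by auto
    ultimately show ?thesis by simp
  qed
  show ?case
  proof (cases "degree p < degree h")
    case True
    then have "p = r" unfolding r_def by (simp add: mod_poly_less)
    then have "p = (\<Sum>i<degree h. monom 1 i * pcompose [:coeff r i:] h)"
      using r by (simp add: mult.commute[of "monom 1 _"] smult_monom)
    then show ?thesis by (rule exI[of _ "\<lambda>i. [:coeff r i:]"])
  next
    case False
    define q where "q = p div h"
    have p: "p = h * q + r" unfolding q_def r_def by (simp add: mult.commute)
    have q0: "q \<noteq> 0" using p dr False by auto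
    have "degree p = degree (h * q)"
      unfolding p using dr h0 q0 by (intro degree_add_eq_left) (simp add: degree_mult_eq)
    then have "degree q < degree p" using h0 q0 h by (simp add: degree_mult_eq)
    then obtain A where A: "q = (\<Sum>i<degree h. monom 1 i * pcompose (A i) h)" using less by blast
    have "p = (\<Sum>i<degree h. monom 1 i * pcompose (A i * [:0, 1:] + [:coeff r i:]) h)"
    proof -
      have "h * q = (\<Sum>i<degree h. monom 1 i * (pcompose (A i) h * h))"
        unfolding A by (simp add: sum_distrib_left algebra_simps)
      then show ?thesis
        unfolding p using r
        by (simp add: pcompose_add pcompose_mult pcompose_pCons distrib_left sum.distrib
            mult.commute[of "monom 1 _" "[:_:]"] smult_monom one_pCons[symmetric] pcompose_1 del: mult_pCons_right)
    qed
    then show ?thesis by (rule exI[of _ "\<lambda>i. A i * [:0, 1:] + [:coeff r i:]"])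
  qed
qed

section \<open>Polynomials over \<open>k(\<beta>)\<close> for transcendental
  \<open>\<beta>\<close>\<close>

context
  fixes \<kappa> :: "'k::field \<Rightarrow> 'b::field" and \<beta> :: 'b
  assumes ac: "alg_closed_field TYPE('k)" and \<kappa>: "is_field_hom \<kappa>" and \<beta>: "transcendental_over \<kappa> \<beta>"
begin

text \<open>The outer variable is kept and the inner one is specialised to \<beta>. As \<beta> is
  transcendental this is injective and identifies polynomials in two variables with polynomials over
  \<open>k[\<beta>]\<close>, where degrees in \<beta> make sense.\<close>

abbreviation (input) coeff_eval :: "'k poly poly \<Rightarrow> 'b poly" where
  "coeff_eval \<equiv> map_poly (\<lambda>p. peval \<kappa> p \<beta>)"

lemma coeff_eval_hom:
  "coeff_eval (P + Q) = coeff_eval P + coeff_eval Q"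
  "coeff_eval (P * Q) = coeff_eval P * coeff_eval Q"
  by (rule map_poly_ring_hom; simp add: map_field_hom_add[OF \<kappa>] map_field_hom_mult[OF \<kappa>])+

lemma coeff_coeff_eval: "coeff (coeff_eval P) i = peval \<kappa> (coeff P i) \<beta>"
  by (simp add: coeff_map_poly)

lemma peval_transcendental_eq_0_iff: "peval \<kappa> p \<beta> = 0 \<longleftrightarrow> p = 0"
  using \<beta> by (auto simp: transcendental_over_def)

lemma coeff_eval_eq_0_iff: "coeff_eval P = 0 \<longleftrightarrow> P = 0"
  by (simp add: poly_eq_iff[of _ 0] coeff_coeff_eval peval_transcendental_eq_0_iff)

lemma degree_coeff_eval: "degree (coeff_eval P) = degree P"
  by (cases "P = 0") (auto intro!: map_poly_degree_eq simp: peval_transcendental_eq_0_iff)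

lemma coeff_eval_eq_iff: "coeff_eval P = coeff_eval Q \<longleftrightarrow> P = Q"
proof
  assume "coeff_eval P = coeff_eval Q"
  then have "peval \<kappa> (coeff P i - coeff Q i) \<beta> = 0" for i
    by (metis coeff_coeff_eval map_field_hom_diff[OF \<kappa>] poly_diff right_minus_eq)
  then show "P = Q" by (simp add: poly_eq_iff[of P] peval_transcendental_eq_0_iff)
qed simp

lemma common_denominator:
  assumes "C \<in> polys_over (range (fract_eval \<kappa> \<beta>))"
  shows "\<exists>c. c \<noteq> 0 \<and> (\<exists>C1. coeff_eval C1 = smult (peval \<kappa> c \<beta>) C)"
  using assms
proof (induction C)
  case 0
  show ?case by (intro exI[of _ 1] conjI exI[of _ 0]) auto
next
  case (pCons a C)
  have "a \<in> range (fract_eval \<kappa> \<beta>)" using pCons.prems polys_over_pConsD by blast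
  then obtain z where z: "a = fract_eval \<kappa> \<beta> z" by blast
  obtain p q where pq: "z = Fract p q" "q \<noteq> 0" by (cases z)
  have a: "peval \<kappa> q \<beta> * a = peval \<kappa> p \<beta>"
    using pq(2) peval_transcendental_eq_0_iff[of q] by (simp add: z pq fract_eval_Fract[OF \<kappa> \<beta>])
  have "C \<in> polys_over (range (fract_eval \<kappa> \<beta>))" using pCons.prems polys_over_pConsD by blast
  then obtain c C1 where c: "c \<noteq> 0" "coeff_eval C1 = smult (peval \<kappa> c \<beta>) C" using pCons.IH by blast
  have "coeff_eval (pCons (p * c) (smult q C1)) = smult (peval \<kappa> (q * c) \<beta>) (pCons a C)"
  proof (rule poly_eqI)
    fix i
    have "coeff (coeff_eval C1) j = peval \<kappa> c \<beta> * coeff C j" for j using c(2) by simp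
    then show "coeff (coeff_eval (pCons (p * c) (smult q C1))) i = coeff (smult (peval \<kappa> (q * c) \<beta>) (pCons a C)) i"
      using a by (cases i) (auto simp: coeff_coeff_eval map_field_hom_mult[OF \<kappa>] mult_ac)
  qed
  then show ?case using c(1) pq(2) by (metis mult_eq_0_iff)
qed

lemma coeffwise_root_factor:
  fixes P :: "'k poly poly"
  assumes "map_poly (\<lambda>p. poly p a) P = 0"
  obtains P' where "P = smult [:-a, 1:] P'"
proof -
  have "[:-a, 1:] dvd coeff P i" for i
    using assms by (metis coeff_0 coeff_map_poly poly_0 poly_eq_0_iff_dvd)
  then have "P = smult [:-a, 1:] (map_poly (\<lambda>p. p div [:-a, 1:]) P)"
    by (intro poly_eqI) (simp add: coeff_map_poly dvd_mult_div_cancel del: mult_pCons_left)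
  then show thesis using that by blast
qed

text \<open>Gauss's lemma: a root of a minimal common denominator of one factor would make the
  reduction of the product vanish.\<close>

lemma monic_factors_integral:
  assumes C: "C \<in> polys_over (range (fract_eval \<kappa> \<beta>))" "lead_coeff C = 1"
    and D: "D \<in> polys_over (range (fract_eval \<kappa> \<beta>))" "lead_coeff D = 1"
    and CD: "C * D = coeff_eval P"
  obtains c where "C = coeff_eval c"
proof -
  have least: "\<exists>c X1. c \<noteq> 0 \<and> coeff_eval X1 = smult (peval \<kappa> c \<beta>) X \<and>
      (\<forall>a. poly c a = 0 \<longrightarrow> map_poly (\<lambda>p. poly p a) X1 \<noteq> 0) \<and> lead_coeff X1 = c"
    if X: "X \<in> polys_over (range (fract_eval \<kappa> \<beta>))" "lead_coeff X = 1" for X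
  proof -
    define den where "den c \<longleftrightarrow> c \<noteq> 0 \<and> (\<exists>X1. coeff_eval X1 = smult (peval \<kappa> c \<beta>) X)" for c
    obtain c where c: "den c" "\<And>c'. den c' \<Longrightarrow> degree c \<le> degree c'"
      using common_denominator[OF X(1)] ex_has_least_nat[of den _ degree] unfolding den_def by blast
    then obtain X1 where X1: "coeff_eval X1 = smult (peval \<kappa> c \<beta>) X" and c0: "c \<noteq> 0"
      unfolding den_def by blast
    have e0: "peval \<kappa> c \<beta> \<noteq> 0" using c0 peval_transcendental_eq_0_iff by blast
    have "degree X1 = degree X" using degree_coeff_eval[of X1] X1 e0 by simp
    then have "peval \<kappa> (lead_coeff X1) \<beta> = peval \<kappa> c \<beta>"
      using X(2) X1 by (metis coeff_coeff_eval coeff_smult mult.right_neutral)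
    then have "peval \<kappa> (lead_coeff X1 - c) \<beta> = 0" by (simp add: map_field_hom_diff[OF \<kappa>])
    then have lc: "lead_coeff X1 = c" by (simp add: peval_transcendental_eq_0_iff)
    \<comment> \<open>A zero of the denominator \<open>c\<close> common to all coefficients of
      \<open>X1\<close> could be cancelled, leaving a denominator of smaller degree.\<close>
    have "map_poly (\<lambda>p. poly p a) X1 \<noteq> 0" if a: "poly c a = 0" for a
    proof
      assume "map_poly (\<lambda>p. poly p a) X1 = 0"
      then obtain X2 where X2: "X1 = smult [:-a, 1:] X2" using coeffwise_root_factor by blast
      obtain c' where c': "c = [:-a, 1:] * c'" using a by (metis dvd_def poly_eq_0_iff_dvd)
      have l0: "peval \<kappa> [:-a, 1:] \<beta> \<noteq> 0" using peval_transcendental_eq_0_iff by force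
      have "smult (peval \<kappa> [:-a, 1:] \<beta>) (coeff_eval X2) = smult (peval \<kappa> [:-a, 1:] \<beta>) (smult (peval \<kappa> c' \<beta>) X)"
      proof (rule poly_eqI)
        fix i
        have "coeff (coeff_eval X1) i = peval \<kappa> c \<beta> * coeff X i" using X1 by simp
        then show "coeff (smult (peval \<kappa> [:-a, 1:] \<beta>) (coeff_eval X2)) i
          = coeff (smult (peval \<kappa> [:-a, 1:] \<beta>) (smult (peval \<kappa> c' \<beta>) X)) i"
          unfolding X2 c' by (simp add: coeff_coeff_eval map_field_hom_mult[OF \<kappa>] mult.assoc del: mult_pCons_left)
      qed
      then have "coeff_eval X2 = smult (peval \<kappa> c' \<beta>) X" using smult_left_imp_eq[OF l0] by blast
      then have "den c'" unfolding den_def using c' c0 by auto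
      moreover have "degree c = Suc (degree c')" using c' c0 by (auto simp: degree_mult_eq simp del: mult_pCons_left)
      ultimately show False using c(2) by fastforce
    qed
    then show ?thesis using c0 X1 lc by blast
  qed
  obtain c C1 where c: "c \<noteq> 0" "coeff_eval C1 = smult (peval \<kappa> c \<beta>) C"
    "\<And>a. poly c a = 0 \<Longrightarrow> map_poly (\<lambda>p. poly p a) C1 \<noteq> 0"
    using least[OF C] by blast
  obtain e D1 where e: "e \<noteq> 0" "coeff_eval D1 = smult (peval \<kappa> e \<beta>) D"
    "\<And>a. poly e a = 0 \<Longrightarrow> map_poly (\<lambda>p. poly p a) D1 \<noteq> 0" "lead_coeff D1 = e"
    using least[OF D] by blast
  have "coeff_eval (C1 * D1) = smult (peval \<kappa> (c * e) \<beta>) (coeff_eval P)"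
    unfolding coeff_eval_hom c e CD[symmetric] by (simp add: map_field_hom_mult[OF \<kappa>] mult.commute)
  also have "\<dots> = coeff_eval (smult (c * e) P)"
    by (rule poly_eqI) (simp add: coeff_coeff_eval map_field_hom_mult[OF \<kappa>])
  finally have prod: "C1 * D1 = smult (c * e) P" unfolding coeff_eval_eq_iff .
  have "degree c = 0"
  proof (rule ccontr)
    assume "degree c \<noteq> 0"
    then obtain a where a: "poly c a = 0" using alg_closed_root[OF ac, of c] by (auto simp: Suc_le_eq)
    have "map_poly (\<lambda>p. poly p a) C1 * map_poly (\<lambda>p. poly p a) D1 = map_poly (\<lambda>p. poly p a) (C1 * D1)"
      by (rule map_poly_ring_hom(2)[symmetric]) auto
    also have "\<dots> = 0" unfolding prod using a by (intro poly_eqI) (simp add: coeff_map_poly)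
    \<comment> \<open>The reductions lie in the integral domain \<open>k[x]\<close> and that of
      \<open>C1\<close> is nonzero. So \<open>D1\<close> reduces to 0; its leading coefficient is
      the denominator \<open>e\<close>, hence \<open>e\<close> vanishes at \<open>a\<close> too,
      against the minimality of \<open>e\<close>.\<close>
    finally have D10: "map_poly (\<lambda>p. poly p a) D1 = 0" using c(3)[OF a] by simp
    then have "poly e a = 0" using e(4) by (metis coeff_0 coeff_map_poly poly_0)
    then show False using D10 e(3) by blast
  qed
  then obtain c0 where c0: "c = [:c0:]" by (metis degree_eq_zeroE)
  have "C = coeff_eval (smult [:inverse c0:] C1)"
  proof (rule poly_eqI)
    fix i
    have "c0 \<noteq> 0" using c(1) c0 by auto
    moreover have "peval \<kappa> (coeff C1 i) \<beta> = \<kappa> c0 * coeff C i"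
      using arg_cong[OF c(2), of "\<lambda>p. coeff p i"] by (simp add: coeff_coeff_eval c0 map_field_hom_const[OF \<kappa>])
    ultimately show "coeff C i = coeff (coeff_eval (smult [:inverse c0:] C1)) i"
      by (simp add: coeff_coeff_eval map_field_hom_smult[OF \<kappa>] field_hom_inverse[OF \<kappa>] field_hom_eq_0_iff[OF \<kappa>])
  qed
  then show thesis using that by blast
qed

text \<open>Lueroth's argument: comparing degrees in both variables, a coefficient of maximal degree of
  the minimal polynomial already generates the intermediate field.\<close>

lemma intermediate_generator:
  assumes B: "finite B" "\<beta> \<in> B" and C: "(\<Prod>b\<in>B. [:- b, 1:]) = coeff_eval c"
    and inv: "\<And>b i. b \<in> B \<Longrightarrow> peval \<kappa> (coeff c i) b = peval \<kappa> (coeff c i) \<beta>"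
  obtains h where "degree h = card B" "\<And>b. b \<in> B \<Longrightarrow> peval \<kappa> h b = peval \<kappa> h \<beta>"
proof -
  have deg: "degree c = card B" using degree_coeff_eval[of c] degree_prod_linear[OF B(1)] C by simp
  have "peval \<kappa> (lead_coeff c) \<beta> = 1"
    using lead_coeff_prod_linear[of B] unfolding C by (simp add: degree_coeff_eval coeff_coeff_eval)
  then have "peval \<kappa> (lead_coeff c - 1) \<beta> = 0" by (simp add: map_field_hom_diff[OF \<kappa>] field_hom_1[OF \<kappa>])
  then have lc: "lead_coeff c = 1" by (simp add: peval_transcendental_eq_0_iff)
  then have c0: "c \<noteq> 0" by auto
  obtain i where i: "dominant_coeff c i" using dominant_coeff_exists[OF c0] .
  define h where "h = coeff c i"
  have hle: "degree (coeff c j) \<le> degree h" for j using i by (simp add: h_def dominant_coeff_def)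
  \<comment> \<open>Otherwise \<open>c\<close> has constant coefficients, and its zero \<beta> would
    be algebraic over \<open>k\<close>.\<close>
  have dh: "degree h \<ge> 1"
  proof (rule ccontr)
    assume "\<not> ?thesis"
    then have "degree (coeff c j) = 0" for j using hle[of j] by simp
    then have cc: "coeff c j = [:coeff (coeff c j) 0:]" for j by (metis degree_eq_zeroE coeff_pCons_0)
    define c' where "c' = map_poly (\<lambda>p. coeff p 0) c"
    have "coeff_eval c = map_poly \<kappa> c'"
    proof (rule poly_eqI)
      fix j
      have "peval \<kappa> (coeff c j) \<beta> = \<kappa> (coeff (coeff c j) 0)"
        by (subst cc) (simp add: map_field_hom_const[OF \<kappa>])
      then show "coeff (coeff_eval c) j = coeff (map_poly \<kappa> c') j"
        by (simp add: coeff_coeff_eval coeff_map_field_hom[OF \<kappa>] c'_def coeff_map_poly)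
    qed
    then have "peval \<kappa> c' \<beta> = 0" using poly_prod_linear_eq_0_iff[OF B(1), of \<beta>] B(2) C by simp
    then have "c' = 0" using peval_transcendental_eq_0_iff by blast
    then have "coeff (lead_coeff c) 0 = 0" unfolding c'_def by (metis coeff_0 coeff_map_poly)
    then show False using lc by simp
  qed
  \<comment> \<open>This is \<open>h(x) - h(y)\<close> with \<open>x\<close> the outer and
    \<open>y\<close> the inner variable.\<close>
  define H where "H = map_poly (\<lambda>a. [:a:]) h - [:h:]"
  have coeffH: "coeff H j = (if j = 0 then [:coeff h 0:] - h else [:coeff h j:])" for j
    by (simp add: H_def coeff_map_poly coeff_pCons split: nat.split)
  have evH: "coeff_eval H = map_poly \<kappa> h - [:peval \<kappa> h \<beta>:]"
    by (rule poly_eqI)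
      (simp add: coeff_coeff_eval coeffH coeff_map_field_hom[OF \<kappa>] map_field_hom_diff[OF \<kappa>]
        map_field_hom_const[OF \<kappa>] coeff_pCons split: nat.split)
  have dH: "degree H = degree h"
    using degree_coeff_eval[of H] evH degree_map_field_hom[OF \<kappa>, of h] by simp
  have "coeff_eval c dvd coeff_eval H"
    unfolding evH C[symmetric] by (rule prod_linear_dvd[OF B(1)]) (use inv in \<open>simp add: h_def\<close>)
  then obtain Q where Q: "coeff_eval H = coeff_eval c * Q" by (auto simp: dvd_def)
  \<comment> \<open>Since \<open>c\<close> is monic, pseudo-division is division over
    \<open>k[y]\<close>. The remainder vanishes because \<open>c\<close> divides \<open>H\<close>
    after \<open>y\<close> is specialised to \<beta>.\<close>
  obtain q r where qr: "H = c * q + r" "r = 0 \<or> degree r < degree c"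
    using pseudo_divmod[OF c0, of H "fst (pseudo_divmod H c)" "snd (pseudo_divmod H c)"] lc by auto
  have "r = 0"
  proof (rule ccontr)
    assume "r \<noteq> 0"
    have "coeff_eval r = coeff_eval c * (Q - coeff_eval q)"
      using Q unfolding qr(1) coeff_eval_hom by (simp add: algebra_simps)
    moreover have "coeff_eval r \<noteq> 0" using \<open>r \<noteq> 0\<close> coeff_eval_eq_0_iff by blast
    ultimately have "degree (coeff_eval r) \<ge> degree (coeff_eval c)"
      by (metis dvd_imp_degree_le dvd_triv_left)
    then show False using qr(2) \<open>r \<noteq> 0\<close> by (simp add: degree_coeff_eval)
  qed
  then have Hcq: "H = c * q" using qr by simp
  have "H \<noteq> 0" using dH dh by auto
  then have q0: "q \<noteq> 0" using Hcq by auto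
  obtain j where j: "dominant_coeff q j" using dominant_coeff_exists[OF q0] .
  \<comment> \<open>\<open>c\<close> alone uses up the whole degree of \<open>H\<close> in
    \<open>y\<close>, so \<open>q\<close> is free of \<open>y\<close>.\<close>
  have "degree h + degree (coeff q j) \<le> degree (coeff H (i + j))"
    using degree_coeff_mult_dominant[OF i j] by (simp add: Hcq h_def)
  also have "\<dots> \<le> degree h" by (auto simp: coeffH intro: degree_diff_le)
  finally have "degree (coeff q l) = 0" for l using j by (simp add: dominant_coeff_def)
  then have qc: "coeff q l = [:coeff (coeff q l) 0:]" for l by (metis degree_eq_zeroE coeff_pCons_0)
  define q' where "q' = map_poly (\<lambda>p. coeff p 0) q"
  have q': "q = map_poly (\<lambda>a. [:a:]) q'"
    by (rule poly_eqI) (use qc in \<open>simp add: q'_def coeff_map_poly\<close>)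
  have ev: "poly (map_poly (\<lambda>a. [:a:]) p) [:a:] = [:poly p a:]" for p :: "'k poly" and a
    by (simp add: pcompose_altdef[symmetric] pcompose_pCons_0)
  \<comment> \<open>A zero \<open>a\<close> of \<open>q'\<close> would make
    \<open>h(a) - h(y)\<close> the zero polynomial, but \<open>h\<close> is not constant.\<close>
  have "degree q' = 0"
  proof (rule ccontr)
    assume "degree q' \<noteq> 0"
    then obtain a where a: "poly q' a = 0" using alg_closed_root[OF ac, of q'] by (auto simp: Suc_le_eq)
    have "poly H [:a:] = 0" unfolding Hcq poly_mult q' ev using a by simp
    then have "h = [:poly h a:]" unfolding H_def by (simp add: ev)
    then show False using dh by (metis degree_pCons_0 not_one_le_zero)
  qed
  moreover have "degree q = degree q'"
    unfolding q' by (rule map_poly_degree_eq) (use q0 q' in auto)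
  ultimately have "degree h = card B" using dH Hcq c0 q0 deg by (simp add: degree_mult_eq)
  then show thesis using that[of h] inv by (simp add: h_def)
qed

text \<open>Write \<open>f\<close> as the sum of \<open>x^i A_i(h)\<close> with
  \<open>i < degree h\<close>. On \<open>B\<close> the value of \<open>h\<close> is constant, so
  \<open>f\<close> agrees there with a polynomial \<open>Z\<close> of degree below
  \<open>card B\<close>; as \<open>f\<close> is constant on \<open>B\<close> as well,
  \<open>Z\<close> is constant. Hence \<open>A_i(h(\<beta>)) = 0\<close> for positive
  \<open>i\<close>, transcendence gives \<open>A_i = 0\<close>, and
  \<open>f = A_0 o h\<close>.\<close>

lemma decompose_through_generator:
  assumes B: "finite B" "\<beta> \<in> B" and h: "degree h = card B"
    and hB: "\<And>b. b \<in> B \<Longrightarrow> peval \<kappa> h b = peval \<kappa> h \<beta>"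
    and fB: "\<And>b. b \<in> B \<Longrightarrow> peval \<kappa> f b = peval \<kappa> f \<beta>"
  obtains g where "f = pcompose g h"
proof -
  have m: "degree h \<ge> 1" using B h by (metis One_nat_def Suc_leI card_gt_0_iff empty_iff)
  obtain A where A: "f = (\<Sum>i<degree h. monom 1 i * pcompose (A i) h)" using base_expansion[OF m] by blast
  define Z where "Z = (\<Sum>i<degree h. monom (peval \<kappa> (A i) (peval \<kappa> h \<beta>)) i)"
  have sum: "peval \<kappa> (sum g I) y = (\<Sum>i\<in>I. peval \<kappa> (g i) y)" for g :: "nat \<Rightarrow> 'k poly" and I y
    by (induction I rule: infinite_finite_induct) (auto simp: map_field_hom_add[OF \<kappa>])
  have "peval \<kappa> f b = poly Z b" if "b \<in> B" for b
    using hB[OF that] unfolding Z_def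
    by (subst A) (simp add: sum map_field_hom_mult[OF \<kappa>] peval_pcompose[OF \<kappa>] poly_sum poly_monom
        map_poly_monom field_hom_0[OF \<kappa>] field_hom_1[OF \<kappa>] mult.commute)
  then have roots: "poly (Z - [:peval \<kappa> f \<beta>:]) b = 0" if "b \<in> B" for b using fB that by simp
  have coeffZ: "coeff Z i = (if i < degree h then peval \<kappa> (A i) (peval \<kappa> h \<beta>) else 0)" for i
    unfolding Z_def by (simp add: coeff_sum)
  have "Z - [:peval \<kappa> f \<beta>:] = 0"
  proof (rule ccontr)
    assume nz: "Z - [:peval \<kappa> f \<beta>:] \<noteq> 0"
    have "degree Z < degree h"
      using m by (intro degree_lessI) (auto simp: coeffZ)
    moreover have "card B \<le> card {x. poly (Z - [:peval \<kappa> f \<beta>:]) x = 0}"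
      using roots poly_roots_finite[OF nz] by (intro card_mono) auto
    ultimately show False using card_poly_roots_bound[OF nz] h by simp
  qed
  then have Zc: "coeff Z i = 0" if "i > 0" for i
    using that by (metis coeff_pCons eq_iff_diff_eq_0 coeff_0 gr0_conv_Suc nat.simps(5))
  have A0: "A i = 0" if "i < degree h" "i > 0" for i
  proof -
    have "peval \<kappa> (pcompose (A i) h) \<beta> = 0" using Zc[OF that(2)] coeffZ[of i] that(1)
      by (simp add: peval_pcompose[OF \<kappa>])
    then have "pcompose (A i) h = 0" using peval_transcendental_eq_0_iff by blast
    then show ?thesis using m by (simp add: pcompose_eq_0_iff)
  qed
  have "f = (\<Sum>i\<in>{0}. monom 1 i * pcompose (A i) h)"
    by (subst A, rule sum.mono_neutral_right) (use m A0 in \<open>auto\<close>)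
  then have "f = pcompose (A 0) h" by (simp add: monom_0 one_pCons[symmetric])
  then show thesis using that by blast
qed

text \<open>By Gauss the coefficients of the product over \<open>B\<close> are polynomials in
  \<beta>. Automorphisms that preserve \<open>B\<close> and carry \<beta> to \<open>b\<close> fix
  these coefficients, so the polynomials take equal values at \<beta> and \<open>b\<close>. The
  generator found among them has degree \<open>card B\<close> and is a right composition factor of
  \<open>f\<close>.\<close>

lemma block_card_indecomposable:
  assumes f: "indecomposable_poly f" "f \<noteq> 0" and B: "finite B" "\<beta> \<in> B"
    and C: "(\<Prod>b\<in>B. [:- b, 1:]) \<in> polys_over (range (fract_eval \<kappa> \<beta>))"
    and D: "D \<in> polys_over (range (fract_eval \<kappa> \<beta>))" "lead_coeff D = 1"
    and CD: "smult (\<kappa> (lead_coeff f)) ((\<Prod>b\<in>B. [:- b, 1:]) * D) = map_poly \<kappa> f - [:peval \<kappa> f \<beta>:]"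
    and \<sigma>: "\<And>b. b \<in> B \<Longrightarrow> \<exists>\<sigma>. is_field_hom \<sigma> \<and> (\<forall>a. \<sigma> (\<kappa> a) = \<kappa> a) \<and> \<sigma> \<beta> = b \<and> \<sigma> ` B = B"
  shows "card B = 1 \<or> card B = degree f"
proof -
  define u where "u = inverse (lead_coeff f)"
  have u: "u * lead_coeff f = 1" using f(2) by (simp add: u_def)
  have "(\<Prod>b\<in>B. [:- b, 1:]) * D = smult (\<kappa> u * \<kappa> (lead_coeff f)) ((\<Prod>b\<in>B. [:- b, 1:]) * D)"
    by (simp add: field_hom_mult[OF \<kappa>, symmetric] u field_hom_1[OF \<kappa>])
  also have "\<dots> = smult (\<kappa> u) (map_poly \<kappa> f - [:peval \<kappa> f \<beta>:])" unfolding CD[symmetric] by simp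
  also have "\<dots> = coeff_eval (smult [:u:] (map_poly (\<lambda>a. [:a:]) f - [:f:]))"
    by (rule poly_eqI)
      (simp add: coeff_coeff_eval coeff_map_field_hom[OF \<kappa>] map_field_hom_diff[OF \<kappa>] map_field_hom_mult[OF \<kappa>]
        map_field_hom_const[OF \<kappa>] coeff_pCons coeff_map_poly del: mult_pCons_left split: nat.split)
  finally obtain c where c: "(\<Prod>b\<in>B. [:- b, 1:]) = coeff_eval c"
    using monic_factors_integral[OF C lead_coeff_prod_linear D] by blast
  have inv: "peval \<kappa> (coeff c i) b = peval \<kappa> (coeff c i) \<beta>" if b: "b \<in> B" for b i
  proof -
    obtain \<sigma> where \<sigma>: "is_field_hom \<sigma>" "\<And>a. \<sigma> (\<kappa> a) = \<kappa> a" "\<sigma> \<beta> = b" "\<sigma> ` B = B" using \<sigma>[OF b] by blast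
    have inj: "inj_on \<sigma> B" using field_hom_eq_iff[OF \<sigma>(1)] by (auto simp: inj_on_def)
    have "map_poly \<sigma> (\<Prod>b\<in>B. [:- b, 1:]) = (\<Prod>b\<in>B. [:- \<sigma> b, 1:])"
      by (simp add: map_field_hom_prod[OF \<sigma>(1)] map_field_hom_linear[OF \<sigma>(1)])
    also have "\<dots> = (\<Prod>b\<in>\<sigma> ` B. [:- b, 1:])" by (subst prod.reindex[OF inj]) simp
    finally have "map_poly \<sigma> (coeff_eval c) = coeff_eval c" using \<sigma>(4) c by simp
    then have "\<sigma> (coeff (coeff_eval c) i) = coeff (coeff_eval c) i"
      by (metis coeff_map_field_hom[OF \<sigma>(1)])
    then have "\<sigma> (peval \<kappa> (coeff c i) \<beta>) = peval \<kappa> (coeff c i) \<beta>" by (simp add: coeff_coeff_eval)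
    moreover have "\<sigma> (peval \<kappa> (coeff c i) \<beta>) = peval \<kappa> (coeff c i) b"
      using field_hom_peval[OF \<kappa> is_subfield_UNIV, of \<sigma> \<beta> "coeff c i"] field_hom_hom_on[OF \<sigma>(1)] \<sigma>(2,3) by simp
    ultimately show ?thesis by simp
  qed
  obtain h where h: "degree h = card B" "\<And>b. b \<in> B \<Longrightarrow> peval \<kappa> h b = peval \<kappa> h \<beta>"
    using intermediate_generator[OF B c inv] by blast
  have "peval \<kappa> f b = peval \<kappa> f \<beta>" if "b \<in> B" for b
  proof -
    have "poly (map_poly \<kappa> f - [:peval \<kappa> f \<beta>:]) b = 0"
      unfolding CD[symmetric] using that poly_prod_linear_eq_0_iff[OF B(1), of b] by simp
    then show ?thesis by simp
  qed
  then obtain g where g: "f = pcompose g h" using decompose_through_generator[OF B h] by blast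
  then have "degree g = 1 \<or> degree h = 1" using f(1) unfolding indecomposable_poly_def by blast
  then show ?thesis using g h(1) degree_pcompose[of g h] by auto
qed

end

section \<open>The splitting field of the iterate\<close>

lemma poly_eq_prod_roots:
  fixes P :: "'a::field poly"
  assumes "P \<noteq> 0" "card {x. poly P x = 0} = degree P"
  shows "P = smult (lead_coeff P) (\<Prod>b\<in>{x. poly P x = 0}. [:- b, 1:])"
proof -
  let ?X = "{x. poly P x = 0}"
  have fin: "finite ?X" using poly_roots_finite[OF assms(1)] .
  obtain s where s: "P = (\<Prod>b\<in>?X. [:- b, 1:]) * s"
    using prod_linear_dvd[OF fin, of P] by (auto simp: dvd_def)
  have nz: "(\<Prod>b\<in>?X. [:- b, 1:]) \<noteq> 0" "s \<noteq> 0" using s assms(1) by auto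
  have "degree P = degree (\<Prod>b\<in>?X. [:- b, 1:]) + degree s"
    using degree_mult_eq[OF nz] s by metis
  then have "degree s = 0" using degree_prod_linear[OF fin] assms(2) by linarith
  then obtain c where c: "s = [:c:]" by (metis degree_eq_zeroE)
  have "P = smult c (\<Prod>b\<in>?X. [:- b, 1:])" by (subst s) (simp add: c)
  moreover from this have "lead_coeff P = c"
    using lead_coeff_prod_linear[of ?X] by (metis lead_coeff_smult mult.right_neutral)
  ultimately show ?thesis by simp
qed

text \<open>A deficit of zeros in one factor cannot be made up by the other, whose number of zeros
  is bounded by its degree.\<close>

lemma card_roots_dvd:
  fixes P :: "'a::field poly"
  assumes "P \<noteq> 0" "card {x. poly P x = 0} = degree P" "s dvd P"
  shows "card {x. poly s x = 0} = degree s"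
proof -
  obtain t where t: "P = s * t" using assms(3) by (auto simp: dvd_def)
  have nz: "s \<noteq> 0" "t \<noteq> 0" using t assms(1) by auto
  have "degree s + degree t = card {x. poly P x = 0}" using t nz assms(2) by (simp add: degree_mult_eq)
  also have "{x. poly P x = 0} = {x. poly s x = 0} \<union> {x. poly t x = 0}" using t by auto
  also have "card \<dots> \<le> card {x. poly s x = 0} + card {x. poly t x = 0}" by (rule card_Un_le)
  also have "card {x. poly t x = 0} \<le> degree t" by (rule card_poly_roots_bound[OF nz(2)])
  finally show ?thesis using card_poly_roots_bound[OF nz(1)] by simp
qed

lemma algebraic_over_alg_closed:
  fixes \<kappa> :: "'k::field \<Rightarrow> 'b::field"
  assumes ac: "alg_closed_field TYPE('k)" and \<kappa>: "is_field_hom \<kappa>" and p: "p \<noteq> 0" "peval \<kappa> p x = 0"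
  shows "x \<in> range \<kappa>"
  using p
proof (induction "degree p" arbitrary: p)
  case 0
  then obtain c where "p = [:c:]" by (metis degree_eq_zeroE)
  then show ?case using 0 by (simp add: map_field_hom_const[OF \<kappa>] field_hom_eq_0_iff[OF \<kappa>])
next
  case (Suc n)
  obtain a where a: "poly p a = 0" using alg_closed_root[OF ac, of p] Suc.hyps(2) by auto
  then obtain s where s: "p = [:-a, 1:] * s" by (metis dvd_def poly_eq_0_iff_dvd)
  have s0: "s \<noteq> 0" using s Suc.prems(1) by auto
  have ds: "degree p = Suc (degree s)" using s s0 by (simp add: degree_mult_eq del: mult_pCons_left)
  have "map_poly \<kappa> p = [:- \<kappa> a, 1:] * map_poly \<kappa> s"
    unfolding s map_field_hom_mult[OF \<kappa>] map_field_hom_linear[OF \<kappa>] ..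
  then have "(x - \<kappa> a) * peval \<kappa> s x = 0" using Suc.prems(2) by (simp del: mult_pCons_left)
  then have "x = \<kappa> a \<or> peval \<kappa> s x = 0" by simp
  then show ?case using Suc.hyps s0 ds by auto
qed

lemma hom_fixes_poly_over:
  assumes "p \<in> polys_over E" "\<And>y. y \<in> E \<Longrightarrow> \<tau> y = y" "0 \<in> E"
  shows "map_poly \<tau> p = p"
  using assms by (intro poly_eqI) (simp add: coeff_map_poly polys_over_def)

locale iterated_splitting_field =
  fixes f :: "'k::field poly" and d N :: nat and \<phi> :: "'k poly fract \<Rightarrow> 'L::field"
  assumes ac: "alg_closed_field TYPE('k)"
    and d: "d \<ge> 2" and N: "N \<ge> 1"
    and d2: "\<not> (d = 2 \<and> CHAR('k) = 2)"
    and f: "f \<in> H_set d N TYPE('k)"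
    and splitting: "is_splitting_field \<phi> (gal_poly f N)"
begin

definition \<kappa> :: "'k \<Rightarrow> 'L" where "\<kappa> a = \<phi> (Fract [:a:] 1)"

definition T :: 'L where "T = \<phi> (Fract [:0, 1:] 1)"

text \<open>The zeros of \<open>f^n(x) - t\<close> in the splitting field of
  \<open>f^N(x) - t\<close>. That there are \<open>d^n\<close> of them is established for
  \<open>n \<le> N\<close> in \<open>card_level\<close>.\<close>

definition level :: "nat \<Rightarrow> 'L set" where "level n = {x. (peval \<kappa> f ^^ n) x = T}"

definition level_poly :: "nat \<Rightarrow> 'L poly" where "level_poly n = map_poly \<kappa> (poly_iter f n) - [:T:]"

definition fiber :: "'L \<Rightarrow> 'L set" where "fiber \<alpha> = {x. peval \<kappa> f x = \<alpha>}"

abbreviation Gal :: "('L \<Rightarrow> 'L) set" where "Gal \<equiv> carrier (gal_group \<phi>)"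

lemma degree_f: "degree f = d"
  using H_set_degree[OF ac d N d2 f] .

lemma f_nonzero: "f \<noteq> 0"
  using degree_f d by auto

lemma \<phi>_hom: "is_field_hom \<phi>"
  using splitting by (simp add: is_splitting_field_def)

lemma \<kappa>_eq: "\<kappa> = (\<lambda>a. \<phi> (Fract [:a:] 1))"
  by (auto simp: \<kappa>_def)

lemma \<kappa>_hom: "is_field_hom \<kappa>" and T_transcendental: "transcendental_over \<kappa> T"
  and \<phi>_eq: "\<phi> = fract_eval \<kappa> T"
  using field_hom_fract_decomp[OF \<phi>_hom] unfolding \<kappa>_eq[symmetric] T_def[symmetric] by auto

lemma \<kappa>_range: "range \<kappa> \<subseteq> range \<phi>"
  by (auto simp: \<kappa>_def)

lemma peval_poly_iter: "peval \<kappa> (poly_iter f n) x = (peval \<kappa> f ^^ n) x"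
  by (induction n)
    (auto simp: poly_iter_Suc peval_pcompose[OF \<kappa>_hom] map_field_hom_pCons[OF \<kappa>_hom]
      field_hom_0[OF \<kappa>_hom] field_hom_1[OF \<kappa>_hom])

lemma level_iff: "x \<in> level n \<longleftrightarrow> peval \<kappa> (poly_iter f n) x = T"
  by (simp add: level_def peval_poly_iter)

lemma roots_level_poly: "{x. poly (level_poly n) x = 0} = level n"
  by (auto simp: level_poly_def level_iff)

lemma degree_level_poly: "degree (level_poly n) = d ^ n"
  by (simp add: level_poly_def degree_map_field_hom[OF \<kappa>_hom] degree_poly_iter degree_f)

lemma level_poly_nonzero: "level_poly n \<noteq> 0"
proof
  assume "level_poly n = 0"
  then have "poly (level_poly n) (\<kappa> 0) = 0" by simp
  then have "T = \<kappa> (poly (poly_iter f n) 0)" by (simp add: level_poly_def peval_field_hom[OF \<kappa>_hom])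
  then have "peval \<kappa> [:- poly (poly_iter f n) 0, 1:] T = 0"
    by (simp add: map_field_hom_linear[OF \<kappa>_hom])
  then show False using T_transcendental by (simp add: transcendental_over_def)
qed

lemma map_poly_gal_poly: "map_poly \<phi> (gal_poly f N) = level_poly N"
proof -
  have "map_poly \<phi> (map_poly (\<lambda>c. Fract [:c:] 1) p) = map_poly \<kappa> p" for p
    by (subst map_poly_map_poly) (auto simp: field_hom_0[OF \<phi>_hom] Zero_fract_def[symmetric] \<kappa>_eq o_def)
  then show ?thesis
    by (simp add: gal_poly_def level_poly_def map_field_hom_diff[OF \<phi>_hom] map_field_hom_const[OF \<phi>_hom] T_def)
qed

text \<open>An algebraic \<open>x\<close> would lie in the algebraically closed field of constants,
  and then so would \<open>T = f^n(x)\<close>. Thus every root generates a rational function field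
  over \<open>k\<close>.\<close>

lemma level_transcendental:
  assumes "x \<in> level n"
  shows "transcendental_over \<kappa> x"
  unfolding transcendental_over_def
proof (intro allI impI notI)
  fix p assume "p \<noteq> 0" "peval \<kappa> p x = 0"
  then obtain a where a: "x = \<kappa> a" using algebraic_over_alg_closed[OF ac \<kappa>_hom] by blast
  have "T = \<kappa> (poly (poly_iter f n) a)"
    using assms by (simp add: level_iff a peval_field_hom[OF \<kappa>_hom])
  then have "peval \<kappa> [:- poly (poly_iter f n) a, 1:] T = 0"
    by (simp add: map_field_hom_linear[OF \<kappa>_hom])
  then show False using T_transcendental by (simp add: transcendental_over_def)
qed

text \<open>The derivative has constant coefficients, since \<open>T\<close> disappears, and a
  nonzero polynomial over \<open>k\<close> has no transcendental zero.\<close>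

lemma level_poly_simple_roots:
  assumes "x \<in> level n"
  shows "poly (pderiv (level_poly n)) x \<noteq> 0"
proof -
  have "pderiv (level_poly n) = map_poly \<kappa> (pderiv (poly_iter f n))"
    by (simp add: level_poly_def pderiv_diff map_field_hom_pderiv[OF \<kappa>_hom])
  moreover have "peval \<kappa> (pderiv (poly_iter f n)) x \<noteq> 0"
    using level_transcendental[OF assms] H_set_pderiv_poly_iter_nonzero[OF ac d N d2 f]
    by (simp add: transcendental_over_def)
  ultimately show ?thesis by simp
qed

lemma card_level_N: "card (level N) = d ^ N"
proof -
  obtain c rs where rs: "level_poly N = smult c (\<Prod>r\<leftarrow>rs. [:- r, 1:])"
    using splitting map_poly_gal_poly by (auto simp: is_splitting_field_def)
  have c: "c \<noteq> 0" using rs level_poly_nonzero[of N] by auto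
  have "distinct rs"
  proof (rule ccontr)
    assume "\<not> distinct rs"
    then obtain xs ys zs y where y: "rs = xs @ [y] @ ys @ [y] @ zs" using not_distinct_decomp by blast
    define q where "q = smult c ((\<Prod>r\<leftarrow>xs. [:- r, 1:]) * (\<Prod>r\<leftarrow>ys. [:- r, 1:]) * (\<Prod>r\<leftarrow>zs. [:- r, 1:]))"
    have eq: "level_poly N = [:- y, 1:] * ([:- y, 1:] * q)"
      unfolding rs y q_def by (simp add: mult_ac del: mult_pCons_left mult_pCons_right)
    have "poly (level_poly N) y = 0" unfolding eq by (simp del: mult_pCons_left)
    then have "y \<in> level N" using roots_level_poly by blast
    then show False
      using level_poly_simple_roots[of y N] unfolding eq poly_pderiv_linear_mult by simp
  qed
  moreover have "set rs = level N"
  proof -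
    have "poly (\<Prod>r\<leftarrow>rs. [:- r, 1:]) x = 0 \<longleftrightarrow> x \<in> set rs" for x
      by (induction rs) (auto simp del: mult_pCons_left)
    then show ?thesis unfolding roots_level_poly[symmetric] rs using c by auto
  qed
  moreover have "degree (\<Prod>r\<leftarrow>rs. [:- r, 1:]) = length rs"
  proof (induction rs)
    case (Cons a rs)
    have "(\<Prod>r\<leftarrow>rs. [:- r, 1:]) \<noteq> 0" by (auto simp: prod_list_zero_iff)
    then show ?case using Cons by (simp add: degree_mult_eq del: mult_pCons_left)
  qed simp
  ultimately show ?thesis
    using degree_level_poly[of N] rs c by (simp add: distinct_card[symmetric])
qed

lemma finite_level: "finite (level n)"
  using poly_roots_finite[OF level_poly_nonzero[of n]] roots_level_poly by simp

lemma level_0: "level 0 = {T}"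
  by (auto simp: level_def)

lemma level_Suc_iff: "x \<in> level (Suc n) \<longleftrightarrow> peval \<kappa> f x \<in> level n"
  by (simp add: level_def funpow_swap1)

lemma level_Suc: "level (Suc n) = (\<Union>\<alpha>\<in>level n. fiber \<alpha>)"
  by (auto simp: level_Suc_iff fiber_def)

lemma fiber_poly: "degree (map_poly \<kappa> f - [:\<alpha>:]) = d" "map_poly \<kappa> f - [:\<alpha>:] \<noteq> 0"
  "fiber \<alpha> = {x. poly (map_poly \<kappa> f - [:\<alpha>:]) x = 0}"
proof -
  show deg: "degree (map_poly \<kappa> f - [:\<alpha>:]) = d"
    by (simp add: degree_map_field_hom[OF \<kappa>_hom] degree_f)
  show "map_poly \<kappa> f - [:\<alpha>:] \<noteq> 0"
  proof
    assume "map_poly \<kappa> f - [:\<alpha>:] = 0"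
    then have "degree (map_poly \<kappa> f - [:\<alpha>:]) = 0" by (simp only: degree_0)
    then show False using deg d by simp
  qed
  show "fiber \<alpha> = {x. poly (map_poly \<kappa> f - [:\<alpha>:]) x = 0}" by (auto simp: fiber_def)
qed

lemma finite_fiber: "finite (fiber \<alpha>)" and card_fiber_le: "card (fiber \<alpha>) \<le> d"
  using poly_roots_finite[OF fiber_poly(2)] card_poly_roots_bound[OF fiber_poly(2)] fiber_poly(1,3)
  by metis+

lemma card_level_Suc: "card (level (Suc n)) = (\<Sum>\<alpha>\<in>level n. card (fiber \<alpha>))"
  unfolding level_Suc using finite_level finite_fiber
  by (intro card_UN_disjoint) (auto simp: fiber_def)

lemma card_level_Suc_le: "card (level (Suc n)) \<le> d * card (level n)"
  unfolding card_level_Suc using sum_bounded_above[of "level n" "\<lambda>\<alpha>. card (fiber \<alpha>)" d] card_fiber_le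
  by (simp add: mult.commute)

text \<open>Splitting is given for level \<open>N\<close> only. Since every vertex has at most
  \<open>d\<close> children, a smaller level \<open>n\<close> could not have \<open>d^N\<close>
  descendants on level \<open>N\<close>.\<close>

lemma card_level:
  assumes "n \<le> N"
  shows "card (level n) = d ^ n"
proof -
  have "card (level (n + j)) \<le> d ^ j * card (level n)" for j
  proof (induction j)
    case (Suc j)
    then show ?case
      using order_trans[OF card_level_Suc_le[of "n + j"] mult_le_mono2[OF Suc, of d]] by (simp add: mult.assoc)
  qed simp
  from this[of "N - n"] have "d ^ (N - n) * d ^ n \<le> d ^ (N - n) * card (level n)"
    using assms card_level_N by (simp flip: power_add)
  then have "d ^ n \<le> card (level n)" using d by simp
  moreover have "card (level n) \<le> d ^ n"
    using card_poly_roots_bound[OF level_poly_nonzero[of n]] degree_level_poly roots_level_poly by simp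
  ultimately show ?thesis by simp
qed

text \<open>A single deficient fiber would leave the next level with too few elements.\<close>

lemma card_fiber:
  assumes "\<alpha> \<in> level n" "n < N"
  shows "card (fiber \<alpha>) = d"
proof (rule ccontr)
  assume "card (fiber \<alpha>) \<noteq> d"
  then have "card (fiber \<alpha>) < d" using card_fiber_le[of \<alpha>] by simp
  then have "(\<Sum>\<alpha>\<in>level n. card (fiber \<alpha>)) < (\<Sum>\<alpha>\<in>level n. d)"
    using assms(1) finite_level card_fiber_le by (intro sum_strict_mono_ex1) auto
  then show False using card_level[of n] card_level[of "Suc n"] assms(2) card_level_Suc[of n] by simp
qed

lemma level_poly_split: "n \<le> N \<Longrightarrow> card {x. poly (level_poly n) x = 0} = degree (level_poly n)"
  by (simp add: roots_level_poly card_level degree_level_poly)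

lemma level_poly_over: "level_poly n \<in> polys_over (range \<phi>)"
proof -
  have s: "is_subfield (range \<phi>)" by (rule is_subfield_range[OF \<phi>_hom])
  have "map_poly \<kappa> p \<in> polys_over (range \<phi>)" for p
    using \<kappa>_range by (auto simp: polys_over_def coeff_map_field_hom[OF \<kappa>_hom])
  moreover have "[:T:] \<in> polys_over (range \<phi>)" by (intro polys_over_const[OF s]) (auto simp: T_def)
  ultimately show ?thesis unfolding level_poly_def by (intro polys_over_diff[OF s])
qed

section \<open>The Galois group: extension of embeddings and invariant sets of roots\<close>

lemma Gal_iff: "\<sigma> \<in> Gal \<longleftrightarrow> bij \<sigma> \<and> is_field_hom \<sigma> \<and> (\<forall>z. \<sigma> (\<phi> z) = \<phi> z)"
  by (simp add: gal_group_def)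

lemma Gal_id: "id \<in> Gal"
  by (simp add: Gal_iff is_field_hom_def)

lemma Gal_comp: "\<sigma> \<in> Gal \<Longrightarrow> \<tau> \<in> Gal \<Longrightarrow> \<sigma> \<circ> \<tau> \<in> Gal"
  by (simp add: Gal_iff is_field_hom_def bij_comp)

lemma Gal_inv_apply: "\<sigma> \<in> Gal \<Longrightarrow> \<sigma> (inv_into UNIV \<sigma> x) = x" "\<sigma> \<in> Gal \<Longrightarrow> inv_into UNIV \<sigma> (\<sigma> x) = x"
  by (auto simp: Gal_iff bij_is_surj surj_f_inv_f bij_is_inj)

lemma Gal_eq_iff: "\<sigma> \<in> Gal \<Longrightarrow> \<sigma> x = \<sigma> y \<longleftrightarrow> x = y"
  by (metis Gal_inv_apply(2))

lemma Gal_inv: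
  assumes "\<sigma> \<in> Gal"
  shows "inv_into UNIV \<sigma> \<in> Gal"
proof -
  have h: "is_field_hom \<sigma>" using assms by (simp add: Gal_iff)
  have "inv_into UNIV \<sigma> (x + y) = inv_into UNIV \<sigma> x + inv_into UNIV \<sigma> y" "inv_into UNIV \<sigma> (x * y) = inv_into UNIV \<sigma> x * inv_into UNIV \<sigma> y" for x y
    by (metis Gal_inv_apply[OF assms] field_hom_add[OF h] field_hom_mult[OF h])+
  moreover have "inv_into UNIV \<sigma> 1 = 1" "inv_into UNIV \<sigma> (\<phi> z) = \<phi> z" for z
    using assms by (metis Gal_inv_apply(2) Gal_iff field_hom_1[OF h])+
  ultimately show ?thesis
    using assms by (simp add: Gal_iff is_field_hom_def bij_imp_bij_inv)
qed

lemma Gal_peval: "\<sigma> \<in> Gal \<Longrightarrow> \<sigma> (peval \<kappa> p x) = peval \<kappa> p (\<sigma> x)"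
  using field_hom_peval[OF \<kappa>_hom is_subfield_UNIV, of \<sigma> x p] field_hom_hom_on[of \<sigma>]
  by (simp add: Gal_iff \<kappa>_eq)

lemma Gal_level: "\<sigma> \<in> Gal \<Longrightarrow> x \<in> level n \<Longrightarrow> \<sigma> x \<in> level n"
  using Gal_peval[of \<sigma> "poly_iter f n" x] by (auto simp: level_iff Gal_iff T_def)

text \<open>Roots of level \<open>N\<close> are adjoined to \<open>E\<close> one at a time. The
  image of the minimal polynomial of such a root divides the split polynomial
  \<open>level_poly N\<close>, which \<tau> fixes, so it has a zero to which the root can be
  sent.\<close>

lemma Gal_extend:
  assumes "is_subfield E" "range \<phi> \<subseteq> E" "hom_on E \<tau>" "\<And>z. \<tau> (\<phi> z) = \<phi> z"
  shows "\<exists>\<sigma>\<in>Gal. \<forall>y\<in>E. \<sigma> y = \<tau> y"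
  using assms
proof (induction "card (level N - E)" arbitrary: E \<tau> rule: less_induct)
  case less
  show ?case
  proof (cases "level N \<subseteq> E")
    case True
    have gen: "S = UNIV" if "is_subfield S" "range \<phi> \<subseteq> S" "level N \<subseteq> S" for S
      using splitting that unfolding is_splitting_field_def map_poly_gal_poly roots_level_poly by blast
    have E: "E = UNIV" by (rule gen[OF less.prems(1,2) True])
    then have \<tau>: "is_field_hom \<tau>" using less.prems(3) by (simp add: is_field_hom_iff_hom_on)
    have inj: "inj \<tau>" using field_hom_eq_iff[OF \<tau>] by (auto simp: inj_on_def)
    have "\<tau> ` level N \<subseteq> level N"
    proof
      fix y assume "y \<in> \<tau> ` level N"
      then obtain x where x: "x \<in> level N" "y = \<tau> x" by blast
      have "\<tau> (peval \<kappa> (poly_iter f N) x) = peval \<kappa> (poly_iter f N) (\<tau> x)"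
        using field_hom_peval[OF \<kappa>_hom less.prems(1,3), of x] E less.prems(4) by (simp add: \<kappa>_eq)
      then show "y \<in> level N" using x less.prems(4) by (auto simp: level_iff T_def)
    qed
    \<comment> \<open>An injection of the finite set of roots into itself is onto. So the range of
      \<tau> is a subfield containing the generators of the splitting field, and \<tau> is
      bijective.\<close>
    then have im: "\<tau> ` level N = level N"
      using inj by (metis card_image card_subset_eq finite_level inj_on_subset subset_UNIV)
    have "range \<phi> \<subseteq> range \<tau>"
      using less.prems(4) by (metis image_subsetI rangeI)
    moreover have "level N \<subseteq> range \<tau>" by (subst im[symmetric]) blast
    ultimately have "range \<tau> = UNIV"
      by (intro gen is_subfield_range[OF \<tau>])
    then have "\<tau> \<in> Gal" using inj \<tau> less.prems(4) by (simp add: Gal_iff bij_def)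
    then show ?thesis by blast
  next
    case False
    then obtain x where x: "x \<in> level N" "x \<notin> E" by blast
    have LE: "level_poly N \<in> polys_over E" using level_poly_over less.prems(2) by (auto simp: polys_over_def)
    have "poly (level_poly N) x = 0" using x(1) roots_level_poly by blast
    then obtain m where m: "is_minpoly E x m" and mL: "\<exists>s\<in>polys_over E. level_poly N = m * s"
      using minpoly_exists[OF less.prems(1) LE level_poly_nonzero] LE unfolding is_minpoly_def by metis
    then obtain s where s: "s \<in> polys_over E" "level_poly N = m * s" by blast
    have mE: "m \<in> polys_over E" "m \<noteq> 0" "poly m x = 0" using m by (auto simp: is_minpoly_def)
    have "map_poly \<tau> (level_poly N) = level_poly N"
      by (rule hom_fixes_poly_over[OF level_poly_over])
        (use less.prems(4) subfield_0[OF is_subfield_range[OF \<phi>_hom]] in auto)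
    then have "map_poly \<tau> m dvd level_poly N"
      using map_poly_hom_on_mult[OF less.prems(1,3) mE(1) s(1)] s(2) by (metis dvd_triv_left)
    then have "card {x. poly (map_poly \<tau> m) x = 0} = degree (map_poly \<tau> m)"
      using card_roots_dvd[OF level_poly_nonzero level_poly_split[OF order_refl]] by blast
    also have "\<dots> = degree m" using degree_map_hom_on[OF less.prems(1,3) mE(1)] .
    also have "\<dots> > 0"
    proof (rule ccontr)
      assume "\<not> 0 < degree m"
      then obtain c where "m = [:c:]" by (metis degree_eq_zeroE neq0_conv)
      then show False using mE by simp
    qed
    finally obtain r where r: "poly (map_poly \<tau> m) r = 0" by (metis (mono_tags) Collect_empty_eq card.empty less_irrefl)
    obtain E' \<tau>' where E': "is_subfield E'" "E \<subseteq> E'" "x \<in> E'" "hom_on E' \<tau>'" "\<And>y. y \<in> E \<Longrightarrow> \<tau>' y = \<tau> y"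
      using hom_on_extend_root[OF less.prems(1,3) m r] by metis
    have "card (level N - E') < card (level N - E)"
      using x E'(2,3) finite_level by (intro psubset_card_mono) auto
    moreover have "range \<phi> \<subseteq> E'" using E'(2) less.prems(2) by blast
    moreover have "\<tau>' (\<phi> z) = \<phi> z" for z using E'(5) less.prems(2,4) by (metis range_subsetD)
    ultimately obtain \<sigma> where "\<sigma> \<in> Gal" "\<forall>y\<in>E'. \<sigma> y = \<tau>' y" using less.hyps E'(1,4) by blast
    then show ?thesis using E'(2,5) by (metis subsetD)
  qed
qed

text \<open>The zeros of the minimal polynomial of \<open>b\<close> over \<open>E\<close> are images
  of \<open>b\<close> under automorphisms over \<open>E\<close>, so an invariant set is a disjoint
  union of zero sets of minimal polynomials. For a singleton this says that an element fixed by all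
  automorphisms over \<open>E\<close> lies in \<open>E\<close>.\<close>

lemma Gal_invariant_prod:
  assumes E: "is_subfield E" "range \<phi> \<subseteq> E" and n: "n \<le> N" and B: "B \<subseteq> level n"
    and inv: "\<And>\<sigma> b. \<sigma> \<in> Gal \<Longrightarrow> (\<And>y. y \<in> E \<Longrightarrow> \<sigma> y = y) \<Longrightarrow> b \<in> B \<Longrightarrow> \<sigma> b \<in> B"
  shows "(\<Prod>b\<in>B. [:- b, 1:]) \<in> polys_over E"
  using B inv
proof (induction "card B" arbitrary: B rule: less_induct)
  case less
  have fin: "finite B" using less.prems(1) finite_level finite_subset by blast
  show ?case
  proof (cases "B = {}")
    case True then show ?thesis by (simp add: polys_over_1[OF E(1)])
  next
    case False
    then obtain b where b: "b \<in> B" by blast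
    have LE: "level_poly n \<in> polys_over E" using level_poly_over E(2) by (auto simp: polys_over_def)
    have "poly (level_poly n) b = 0" using b less.prems(1) roots_level_poly by blast
    then obtain m where m: "is_minpoly E b m" and mL: "m dvd level_poly n"
      using minpoly_exists[OF E(1) LE level_poly_nonzero] LE unfolding is_minpoly_def by (metis dvd_triv_left)
    have mE: "m \<in> polys_over E" "m \<noteq> 0" "poly m b = 0" using m by (auto simp: is_minpoly_def)
    define R where "R = {x. poly m x = 0}"
    have cR: "card R = degree m" unfolding R_def
      using card_roots_dvd[OF level_poly_nonzero level_poly_split[OF n] mL] .
    have mR: "m = smult (lead_coeff m) (\<Prod>b\<in>R. [:- b, 1:])"
      using poly_eq_prod_roots[OF mE(2)] cR unfolding R_def by blast
    have "smult (inverse (lead_coeff m)) m = (\<Prod>b\<in>R. [:- b, 1:])"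
      using mE(2) arg_cong[OF mR, of "smult (inverse (lead_coeff m))"] by simp
    moreover have "smult (inverse (lead_coeff m)) m \<in> polys_over E"
      using mE(1) by (intro polys_over_smult[OF E(1)] subfield_inverse[OF E(1)]) (auto simp: polys_over_def)
    ultimately have RE: "(\<Prod>b\<in>R. [:- b, 1:]) \<in> polys_over E" by simp
    have id: "hom_on E (\<lambda>y. y)" by (simp add: hom_on_def)
    have RB: "R \<subseteq> B"
    proof
      fix y assume "y \<in> R"
      then have y: "poly (map_poly (\<lambda>y. y) m) y = 0" by (simp add: R_def)
      obtain E' \<tau>' where E': "is_subfield E'" "E \<subseteq> E'" "b \<in> E'" "hom_on E' \<tau>'" "\<And>z. z \<in> E \<Longrightarrow> \<tau>' z = z" "\<tau>' b = y"
        using hom_on_extend_root[OF E(1) id m y] by metis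
      have "range \<phi> \<subseteq> E'" "\<And>z. \<tau>' (\<phi> z) = \<phi> z" using E(2) E'(2,5) by auto
      then obtain \<sigma> where \<sigma>: "\<sigma> \<in> Gal" "\<forall>z\<in>E'. \<sigma> z = \<tau>' z" using Gal_extend E'(1,4) by blast
      then have "\<sigma> b = y" "\<And>z. z \<in> E \<Longrightarrow> \<sigma> z = z" using E' by auto
      then show "y \<in> B" using less.prems(2)[OF \<sigma>(1) _ b] by blast
    qed
    have "b \<in> R" using mE(3) by (simp add: R_def)
    have "(\<Prod>b\<in>B - R. [:- b, 1:]) \<in> polys_over E"
    proof (rule less.hyps)
      show "card (B - R) < card B" using fin \<open>b \<in> R\<close> b by (intro psubset_card_mono) auto
      show "B - R \<subseteq> level n" using less.prems(1) by blast
      fix \<sigma> z assume \<sigma>: "\<sigma> \<in> Gal" "\<And>y. y \<in> E \<Longrightarrow> \<sigma> y = y" and z: "z \<in> B - R"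
      have h: "is_field_hom \<sigma>" using \<sigma>(1) by (simp add: Gal_iff)
      have "\<sigma> (poly m z) = poly (map_poly \<sigma> m) (\<sigma> z)" using peval_field_hom[OF h] by simp
      also have "map_poly \<sigma> m = m" using hom_fixes_poly_over[OF mE(1) \<sigma>(2) subfield_0[OF E(1)]] by blast
      finally have eq: "\<sigma> (poly m z) = poly m (\<sigma> z)" .
      have "poly m z \<noteq> 0" using z by (simp add: R_def)
      then have "\<sigma> z \<notin> R" using field_hom_eq_0_iff[OF h, of "poly m z"] by (simp add: R_def eq[symmetric])
      then show "\<sigma> z \<in> B - R" using less.prems(2)[OF \<sigma>] z by blast
    qed
    moreover have "(\<Prod>b\<in>B. [:- b, 1:]) = (\<Prod>b\<in>B - R. [:- b, 1:]) * (\<Prod>b\<in>R. [:- b, 1:])"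
      by (rule prod.subset_diff[OF RB fin])
    ultimately show ?thesis using polys_over_mult[OF E(1) _ RE] by simp
  qed
qed

text \<open>\<rho> substitutes \<open>f^n\<close> for \<open>t\<close> and is the same for all
  \<beta> of the level. Hence an isomorphism between the fields generated by two roots that sends
  one root to the other automatically fixes \<open>k(t)\<close>.\<close>

lemma \<phi>_through_level:
  obtains \<rho> where "\<And>\<beta> z. \<beta> \<in> level n \<Longrightarrow> \<phi> z = fract_eval \<kappa> \<beta> (\<rho> z)"
proof -
  have "\<exists>z'. \<forall>\<beta>\<in>level n. \<phi> z = fract_eval \<kappa> \<beta> z'" for z
  proof -
    obtain p q where z: "z = Fract p q" "q \<noteq> 0" by (cases z)
    let ?F = "poly_iter f n"
    have "degree ?F \<noteq> 0" using degree_poly_iter[of f n] degree_f d by simp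
    then have q: "pcompose q ?F \<noteq> 0" using z(2) by (simp add: pcompose_eq_0_iff)
    have "\<phi> z = fract_eval \<kappa> \<beta> (Fract (pcompose p ?F) (pcompose q ?F))" if \<beta>: "\<beta> \<in> level n" for \<beta>
      using \<beta> fract_eval_Fract[OF \<kappa>_hom T_transcendental z(2)]
      by (simp add: fract_eval_Fract[OF \<kappa>_hom level_transcendental[OF \<beta>] q] peval_pcompose[OF \<kappa>_hom] level_iff \<phi>_eq[THEN fun_cong] z(1))
    then show ?thesis by blast
  qed
  then show thesis using that by metis
qed

lemma range_\<phi>_level: "\<beta> \<in> level n \<Longrightarrow> range \<phi> \<subseteq> range (fract_eval \<kappa> \<beta>)"
  using \<phi>_through_level[of n] by (metis image_subsetI rangeI)

lemma level_element_in_range: "\<beta> \<in> level n \<Longrightarrow> \<beta> \<in> range (fract_eval \<kappa> \<beta>)"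
  using fract_eval_poly[OF \<kappa>_hom level_transcendental, of \<beta> n "[:0, 1:]"]
  by (simp add: map_field_hom_pCons[OF \<kappa>_hom] field_hom_0[OF \<kappa>_hom] field_hom_1[OF \<kappa>_hom] image_iff) metis

text \<open>All elements of a level are transcendental over the constants, so they have isomorphic
  simple extensions over \<open>k\<close>, compatibly with the embedding of \<open>k(t)\<close>.\<close>

lemma Gal_transitive:
  assumes "\<beta> \<in> level n" "\<beta>' \<in> level n"
  obtains \<sigma> where "\<sigma> \<in> Gal" "\<sigma> \<beta> = \<beta>'"
proof -
  let ?\<psi> = "fract_eval \<kappa> \<beta>" and ?\<psi>' = "fract_eval \<kappa> \<beta>'"
  have h: "is_field_hom ?\<psi>" "is_field_hom ?\<psi>'"
    using assms level_transcendental is_field_hom_fract_eval[OF \<kappa>_hom] by blast+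
  have X: "\<beta> = ?\<psi> (Fract [:0, 1:] 1)" "\<beta>' = ?\<psi>' (Fract [:0, 1:] 1)"
    using assms by (simp_all add: fract_eval_poly[OF \<kappa>_hom level_transcendental] map_field_hom_pCons[OF \<kappa>_hom]
        field_hom_0[OF \<kappa>_hom] field_hom_1[OF \<kappa>_hom])
  define \<tau> where "\<tau> y = ?\<psi>' (inv_into UNIV ?\<psi> y)" for y
  have inj: "inj ?\<psi>" using field_hom_eq_iff[OF h(1)] by (auto simp: inj_on_def)
  have \<tau>: "\<tau> (?\<psi> z) = ?\<psi>' z" for z unfolding \<tau>_def by (simp add: inv_f_f[OF inj])
  have "hom_on (range ?\<psi>) \<tau>"
    unfolding hom_on_def
  proof (intro conjI ballI)
    show "\<tau> 1 = 1" using \<tau>[of 1] field_hom_1[OF h(1)] field_hom_1[OF h(2)] by simp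
    fix x y assume "x \<in> range ?\<psi>" "y \<in> range ?\<psi>"
    then obtain a b where ab: "x = ?\<psi> a" "y = ?\<psi> b" by blast
    show "\<tau> (x + y) = \<tau> x + \<tau> y"
      unfolding ab field_hom_add[OF h(1), symmetric] \<tau> field_hom_add[OF h(2)] ..
    show "\<tau> (x * y) = \<tau> x * \<tau> y"
      unfolding ab field_hom_mult[OF h(1), symmetric] \<tau> field_hom_mult[OF h(2)] ..
  qed
  moreover have "\<tau> (\<phi> z) = \<phi> z" for z
  proof -
    obtain \<rho> where "\<And>\<beta> z. \<beta> \<in> level n \<Longrightarrow> \<phi> z = fract_eval \<kappa> \<beta> (\<rho> z)" using \<phi>_through_level by blast
    then show ?thesis using assms \<tau> by metis
  qed
  ultimately obtain \<sigma> where \<sigma>: "\<sigma> \<in> Gal" "\<forall>y\<in>range ?\<psi>. \<sigma> y = \<tau> y"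
    using Gal_extend[OF is_subfield_range[OF h(1)] range_\<phi>_level[OF assms(1)]] by blast
  then have "\<sigma> \<beta> = \<beta>'" using X \<tau> by (metis rangeI)
  then show thesis using that \<sigma>(1) by blast
qed

section \<open>Transpositions in the Galois group\<close>

text \<open>Only the action on level \<open>n\<close> is prescribed, not that on later levels.
  Equality of \<open>a\<close> and \<open>b\<close> is allowed in order to obtain an equivalence
  relation on the level.\<close>

definition swaps :: "nat \<Rightarrow> 'L \<Rightarrow> 'L \<Rightarrow> bool" where
  "swaps n a b \<longleftrightarrow> (\<exists>\<sigma>\<in>Gal. \<sigma> a = b \<and> \<sigma> b = a \<and> (\<forall>x\<in>level n - {a, b}. \<sigma> x = x))"

text \<open>Specialise \<open>t\<close> to the critical value \<open>c = f^n(w)\<close>. A maximal subfield of the splitting field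
  that embeds into \<open>k((t - c))\<close> contains all but two roots, because \<open>f^n - c\<close> has one double root
  and otherwise simple roots.\<close>

lemma transposition_exists:
  assumes n: "1 \<le> n" "n \<le> N"
  obtains a b where "a \<in> level n" "b \<in> level n" "a \<noteq> b" "swaps n a b"
proof -
  obtain w where w: "w \<in> critical_points f" using H_set_critical_point_exists[OF ac d N d2 f] .
  define F where "F = poly_iter f n"
  define c where "c = poly F w"
  obtain h where h: "F - [:c:] = [:-w, 1:] ^ 2 * h" "poly h w \<noteq> 0"
    and simple: "\<And>x. poly F x = c \<Longrightarrow> x \<noteq> w \<Longrightarrow> poly (pderiv F) x \<noteq> 0"
    using H_set_iter_double_root[OF ac d N d2 f w n] unfolding F_def c_def by blast
  \<comment> \<open>The image of \<open>t\<close> in \<open>k((X))\<close>, where \<open>X\<close>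
    stands for the local parameter \<open>t - c\<close>.\<close>
  define y where "y = fls_const c + fls_X"
  define R where "R = {Y. peval fls_const F Y = y}"
  have "h \<noteq> 0" using h(2) by auto
  then have cR: "card R + 2 = d ^ n"
    using card_roots_one_double_root[OF ac h simple] card_fls_roots[OF h(1) _ simple]
    by (simp add: R_def y_def F_def degree_poly_iter degree_f)
  define \<psi> where "\<psi> = fract_eval fls_const y"
  have y: "transcendental_over fls_const y" unfolding y_def by (rule transcendental_fls_X_plus_const)
  have \<psi>: "is_field_hom \<psi>" unfolding \<psi>_def by (rule is_field_hom_fract_eval[OF is_field_hom_fls_const y])
  have \<psi>_const: "\<psi> (Fract [:a:] 1) = fls_const a" for a
    unfolding \<psi>_def by (simp add: fract_eval_poly[OF is_field_hom_fls_const y] map_field_hom_const[OF is_field_hom_fls_const])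
  have \<psi>_t: "\<psi> (Fract [:0, 1:] 1) = y"
    unfolding \<psi>_def by (simp add: fract_eval_poly[OF is_field_hom_fls_const y] map_field_hom_pCons[OF is_field_hom_fls_const])
  \<comment> \<open>Subfields over \<open>k(t)\<close> with an embedding into the Laurent series
    that sends \<open>t\<close> to \<open>y\<close>. Below, \<open>E\<close> is chosen with as many
    roots of level \<open>n\<close> as possible.\<close>
  define good where "good = (\<lambda>(E, \<tau>). is_subfield E \<and> range \<phi> \<subseteq> E \<and> hom_on E \<tau> \<and> (\<forall>z. \<tau> (\<phi> z) = \<psi> z))"
  have "good (range \<phi>, \<lambda>x. \<psi> (inv_into UNIV \<phi> x))"
  proof -
    have inj: "inj \<phi>" using field_hom_eq_iff[OF \<phi>_hom] by (auto simp: inj_on_def)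
    have 1: "inv_into UNIV \<phi> (\<phi> z) = z" for z by (rule inv_f_f[OF inj])
    have "inv_into UNIV \<phi> 1 = 1" "inv_into UNIV \<phi> (\<phi> u + \<phi> v) = u + v" "inv_into UNIV \<phi> (\<phi> u * \<phi> v) = u * v" for u v
      using 1 by (metis field_hom_1[OF \<phi>_hom] field_hom_add[OF \<phi>_hom] field_hom_mult[OF \<phi>_hom])+
    then show ?thesis
      unfolding good_def hom_on_def using is_subfield_range[OF \<phi>_hom]
      by (auto simp: 1 field_hom_1[OF \<psi>] field_hom_add[OF \<psi>] field_hom_mult[OF \<psi>])
  qed
  moreover have "card (level n \<inter> fst p) < Suc (card (level n))" for p :: "'L set \<times> ('L \<Rightarrow> 'k fls)"
    using card_mono[OF finite_level, of "level n \<inter> fst p" n] by auto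
  ultimately obtain p where p: "good p" "\<And>p'. good p' \<Longrightarrow> card (level n \<inter> fst p') \<le> card (level n \<inter> fst p)"
    using ex_has_greatest_nat[of good _ "\<lambda>p. card (level n \<inter> fst p)" "Suc (card (level n))"] by (metis less_imp_le)
  obtain E \<tau> where p_eq: "p = (E, \<tau>)" by (cases p)
  have E: "is_subfield E" "range \<phi> \<subseteq> E" "hom_on E \<tau>" "\<And>z. \<tau> (\<phi> z) = \<psi> z"
    using p(1) by (auto simp: good_def p_eq)
  have LE: "level_poly n \<in> polys_over E" using level_poly_over E(2) by (auto simp: polys_over_def)
  have \<tau>L: "map_poly \<tau> (level_poly n) = map_poly fls_const F - [:y:]"
  proof (rule poly_eqI)
    fix i
    have "\<tau> (coeff (level_poly n) i) = \<tau> (\<phi> (Fract [:coeff F i:] 1 - (if i = 0 then Fract [:0, 1:] 1 else 0)))"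
      by (simp add: level_poly_def coeff_map_field_hom[OF \<kappa>_hom] F_def \<kappa>_def T_def
          field_hom_diff[OF \<phi>_hom] field_hom_0[OF \<phi>_hom] coeff_pCons split: nat.split del: diff_fract)
    also have "\<dots> = coeff (map_poly fls_const F - [:y:]) i"
      unfolding E(4)
      by (simp add: field_hom_diff[OF \<psi>] field_hom_0[OF \<psi>] \<psi>_const \<psi>_t coeff_map_field_hom[OF is_field_hom_fls_const]
          coeff_pCons split: nat.split del: diff_fract)
    finally show "coeff (map_poly \<tau> (level_poly n)) i = coeff (map_poly fls_const F - [:y:]) i"
      by (simp add: coeff_map_hom_on[OF E(1,3)])
  qed
  \<comment> \<open>By maximality every Laurent series root is the image of a root in
    \<open>E\<close>: otherwise \<open>hom_on_lift_root\<close> would enlarge \<open>E\<close> by a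
    preimage. Hence exactly two roots of the level lie outside \<open>E\<close>.\<close>
  have "\<tau> ` (level n \<inter> E) = R"
  proof (intro equalityI subsetI)
    fix Y assume "Y \<in> \<tau> ` (level n \<inter> E)"
    then obtain b where b: "b \<in> level n" "b \<in> E" "Y = \<tau> b" by blast
    have "poly (level_poly n) b = 0" using b(1) roots_level_poly by blast
    then have "poly (map_poly \<tau> (level_poly n)) Y = 0"
      using poly_map_hom_on[OF E(1,3) LE b(2)] hom_on_0[OF E(1,3)] b(3) by simp
    then show "Y \<in> R" unfolding \<tau>L R_def by simp
  next
    fix Y assume "Y \<in> R"
    then have "poly (map_poly \<tau> (level_poly n)) Y = 0" unfolding \<tau>L R_def by simp
    moreover have "\<exists>b. poly s b = 0" if "s dvd level_poly n" "degree s > 0" for s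
    proof -
      have "card {x. poly s x = 0} > 0"
        using card_roots_dvd[OF level_poly_nonzero level_poly_split[OF n(2)] that(1)] that(2) by simp
      then show ?thesis by (metis (mono_tags) Collect_empty_eq card.empty less_irrefl)
    qed
    ultimately obtain E' \<tau>' b where E': "is_subfield E'" "E \<subseteq> E'" "b \<in> E'" "hom_on E' \<tau>'"
      "\<And>y. y \<in> E \<Longrightarrow> \<tau>' y = \<tau> y" "\<tau>' b = Y" "poly (level_poly n) b = 0"
      using hom_on_lift_root[OF E(1,3) LE level_poly_nonzero] by metis
    have "good (E', \<tau>')"
      unfolding good_def using E' E(2,4) by (auto simp: range_subsetD)
    then have "card (level n \<inter> E') \<le> card (level n \<inter> E)" using p(2) p_eq by fastforce
    then have "level n \<inter> E = level n \<inter> E'"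
      using E'(2) finite_level by (intro card_seteq) auto
    moreover have "b \<in> level n" using E'(7) roots_level_poly by blast
    ultimately show "Y \<in> \<tau> ` (level n \<inter> E)" using E'(3,5,6) by blast
  qed
  moreover have "inj_on \<tau> (level n \<inter> E)"
    using hom_on_eq_iff[OF E(1,3)] by (auto simp: inj_on_def)
  ultimately have "card (level n \<inter> E) + 2 = card (level n)"
    using cR card_level[OF n(2)] card_image by metis
  then have "card (level n - E) = 2"
    using card_Diff_subset_Int[of "level n" E] finite_level by simp
  then obtain a b where ab: "level n - E = {a, b}" "a \<noteq> b" by (meson card_2_iff)
  have moves: "\<sigma> x \<in> {a, b}" if "\<sigma> \<in> Gal" "\<And>y. y \<in> E \<Longrightarrow> \<sigma> y = y" "x \<in> {a, b}" for \<sigma> x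
  proof -
    have x: "x \<in> level n" "x \<notin> E" using ab that(3) by auto
    have "\<sigma> x \<notin> E" using that(2)[of "\<sigma> x"] Gal_eq_iff[OF that(1)] x(2) by auto
    then show ?thesis using Gal_level[OF that(1) x(1)] ab(1) by blast
  qed
  \<comment> \<open>Automorphisms over \<open>E\<close> permute the two remaining roots. If none
    moved \<open>a\<close> to \<open>b\<close>, all would fix \<open>a\<close>, and \<open>a\<close>
    would lie in \<open>E\<close>.\<close>
  have "\<exists>\<sigma>\<in>Gal. (\<forall>y\<in>E. \<sigma> y = y) \<and> \<sigma> a = b"
  proof (rule ccontr)
    assume neg: "\<not> ?thesis"
    have "(\<Prod>x\<in>{a}. [:- x, 1:]) \<in> polys_over E"
    proof (rule Gal_invariant_prod[OF E(1,2) n(2)])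
      show "{a} \<subseteq> level n" using ab by blast
      show "\<sigma> x \<in> {a}" if "\<sigma> \<in> Gal" "\<And>y. y \<in> E \<Longrightarrow> \<sigma> y = y" "x \<in> {a}" for \<sigma> x
        using moves[OF that(1,2), of a] neg that by auto
    qed
    then have "- a \<in> E" using polys_over_pConsD(1)[of "- a" "[:1:]" E] by simp
    then have "a \<in> E" using subfield_uminus[OF E(1), of "- a"] by simp
    then show False using ab by blast
  qed
  then obtain \<sigma> where \<sigma>: "\<sigma> \<in> Gal" "\<And>y. y \<in> E \<Longrightarrow> \<sigma> y = y" "\<sigma> a = b" by blast
  have "\<sigma> b \<noteq> b" using Gal_eq_iff[OF \<sigma>(1), of b a] \<sigma>(3) ab(2) by auto
  then have "\<sigma> b = a" using moves[OF \<sigma>(1,2), of b] by auto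
  moreover have "\<forall>x\<in>level n - {a, b}. \<sigma> x = x" using \<sigma>(2) ab(1) by blast
  ultimately have "swaps n a b" unfolding swaps_def using \<sigma>(1,3) by blast
  then show thesis using that ab by blast
qed

section \<open>Swappable roots as a Galois-invariant relation\<close>

lemma swaps_refl: "swaps n a a"
  unfolding swaps_def using Gal_id by (intro bexI[of _ id]) auto

lemma swaps_conj:
  assumes "swaps n a b" "\<rho> \<in> Gal"
  shows "swaps n (\<rho> a) (\<rho> b)"
proof -
  obtain \<sigma> where \<sigma>: "\<sigma> \<in> Gal" "\<sigma> a = b" "\<sigma> b = a" "\<forall>x\<in>level n - {a, b}. \<sigma> x = x"
    using assms(1) unfolding swaps_def by blast
  let ?s = "\<rho> \<circ> \<sigma> \<circ> inv_into UNIV \<rho>"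
  have "?s \<in> Gal" by (intro Gal_comp \<sigma>(1) assms(2) Gal_inv)
  moreover have "?s (\<rho> a) = \<rho> b" "?s (\<rho> b) = \<rho> a" using \<sigma> by (auto simp: Gal_inv_apply[OF assms(2)])
  moreover have "?s x = x" if x: "x \<in> level n - {\<rho> a, \<rho> b}" for x
  proof -
    have "inv_into UNIV \<rho> x \<in> level n" using Gal_level[OF Gal_inv[OF assms(2)]] x by blast
    moreover have "inv_into UNIV \<rho> x \<notin> {a, b}" using x Gal_inv_apply(1)[OF assms(2), of x] by auto
    ultimately show ?thesis using \<sigma>(4) Gal_inv_apply[OF assms(2)] by simp
  qed
  ultimately show ?thesis unfolding swaps_def by blast
qed

text \<open>For distinct points, conjugating the transposition of \<open>b\<close> and
  \<open>c\<close> by that of \<open>a\<close> and \<open>b\<close> gives the transposition of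
  \<open>a\<close> and \<open>c\<close>.\<close>

lemma swaps_trans:
  assumes "swaps n a b" "swaps n b c" "c \<in> level n"
  shows "swaps n a c"
proof (cases "c = a \<or> c = b")
  case True
  then show ?thesis using assms swaps_refl by auto
next
  case False
  obtain \<sigma> where \<sigma>: "\<sigma> \<in> Gal" "\<sigma> a = b" "\<sigma> b = a" "\<forall>x\<in>level n - {a, b}. \<sigma> x = x"
    using assms(1) unfolding swaps_def by blast
  have "swaps n (\<sigma> b) (\<sigma> c)" using swaps_conj[OF assms(2) \<sigma>(1)] .
  then show ?thesis using \<sigma> False assms(3) by simp
qed

text \<open>If the parents differ, then \<open>a\<close> has a sibling other than \<open>a\<close>
  and \<open>b\<close>, because \<open>d \<ge> 2\<close>. The transposition fixes this sibling and
  hence the parent of \<open>a\<close>, yet it takes that parent to the parent of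
  \<open>b\<close>.\<close>

lemma swaps_siblings:
  assumes "swaps n a b" "a \<in> level n" "1 \<le> n" "n \<le> N"
  shows "peval \<kappa> f a = peval \<kappa> f b"
proof (rule ccontr)
  assume neq: "peval \<kappa> f a \<noteq> peval \<kappa> f b"
  obtain \<sigma> where \<sigma>: "\<sigma> \<in> Gal" "\<sigma> a = b" "\<sigma> b = a" "\<forall>x\<in>level n - {a, b}. \<sigma> x = x"
    using assms(1) unfolding swaps_def by blast
  obtain n' where n': "n = Suc n'" using assms(3) by (cases n) auto
  have par: "peval \<kappa> f a \<in> level n'" using assms(2) unfolding n' level_Suc_iff .
  then have "card (fiber (peval \<kappa> f a)) = d" using card_fiber assms(4) n' by simp
  then have "\<not> fiber (peval \<kappa> f a) \<subseteq> {a}" using d card_mono[of "{a}" "fiber (peval \<kappa> f a)"] by auto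
  then obtain x where x: "x \<noteq> a" "peval \<kappa> f x = peval \<kappa> f a" unfolding fiber_def by blast
  then have "x \<in> level n - {a, b}" using par neq unfolding n' level_Suc_iff[symmetric]
    by (auto simp: level_Suc_iff)
  then have "\<sigma> x = x" using \<sigma>(4) by blast
  then have "peval \<kappa> f (\<sigma> a) = peval \<kappa> f a"
    using Gal_peval[OF \<sigma>(1), of f x] Gal_peval[OF \<sigma>(1), of f a] x(2) by simp
  then show False using \<sigma>(2) neq by simp
qed

text \<open>The stabiliser of \<beta> preserves both \<open>B\<close> and the siblings outside
  \<open>B\<close>, so \<open>f(x) - f(\<beta>)\<close> factors over \<open>k(\<beta>)\<close> along
  this partition. The transpositions defining \<open>B\<close> themselves move \<beta> to any
  \<open>b\<close> of its class and preserve the class, as \<open>block_card_indecomposable\<close>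
  demands.\<close>

lemma sibling_class_trivial_or_full:
  assumes n: "1 \<le> n" "n \<le> N" and \<beta>: "\<beta> \<in> level n"
  defines "B \<equiv> {b \<in> level n. swaps n \<beta> b}"
  shows "B = {\<beta>} \<or> B = fiber (peval \<kappa> f \<beta>)"
proof -
  obtain n' where n': "n = Suc n'" using n(1) by (cases n) auto
  define A where "A = fiber (peval \<kappa> f \<beta>)"
  have par: "peval \<kappa> f \<beta> \<in> level n'" using \<beta> unfolding n' level_Suc_iff .
  have Alev: "A \<subseteq> level n" unfolding A_def n' level_Suc using par by blast
  have BA: "B \<subseteq> A" using swaps_siblings[OF _ \<beta> n] by (auto simp: A_def B_def fiber_def)
  have cA: "card A = d" using card_fiber[OF par] n n' by (simp add: A_def)
  have finA: "finite A" unfolding A_def by (rule finite_fiber)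
  have finB: "finite B" using BA finA finite_subset by blast
  have \<beta>B: "\<beta> \<in> B" using \<beta> swaps_refl by (simp add: B_def)
  have move: "\<sigma> b \<in> B" if "\<sigma> \<in> Gal" "\<sigma> \<beta> \<in> B" "b \<in> B" for \<sigma> b
  proof -
    have "swaps n (\<sigma> \<beta>) (\<sigma> b)" using that swaps_conj by (simp add: B_def)
    moreover have "\<sigma> b \<in> level n" using that Gal_level by (simp add: B_def)
    ultimately show ?thesis using that(2) swaps_trans[of n \<beta> "\<sigma> \<beta>" "\<sigma> b"] by (simp add: B_def)
  qed
  have imB: "\<sigma> ` B = B" if "\<sigma> \<in> Gal" "\<sigma> \<beta> \<in> B" for \<sigma>
  proof (rule card_subset_eq[OF finB])
    show "\<sigma> ` B \<subseteq> B" using move[OF that] by blast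
    show "card (\<sigma> ` B) = card B"
      using Gal_eq_iff[OF that(1)] by (intro card_image) (auto simp: inj_on_def)
  qed
  let ?E = "range (fract_eval \<kappa> \<beta>)"
  have tr: "transcendental_over \<kappa> \<beta>" by (rule level_transcendental[OF \<beta>])
  have E: "is_subfield ?E" "range \<phi> \<subseteq> ?E"
    using is_subfield_range[OF is_field_hom_fract_eval[OF \<kappa>_hom tr]] range_\<phi>_level[OF \<beta>] by auto
  have fix\<beta>: "\<sigma> \<beta> = \<beta>" if "\<And>y. y \<in> ?E \<Longrightarrow> \<sigma> y = y" for \<sigma>
    using that level_element_in_range[OF \<beta>] by blast
  have C: "(\<Prod>b\<in>B. [:- b, 1:]) \<in> polys_over ?E"
  proof (rule Gal_invariant_prod[OF E n(2)])
    show "B \<subseteq> level n" by (auto simp: B_def)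
    show "\<sigma> b \<in> B" if "\<sigma> \<in> Gal" "\<And>y. y \<in> ?E \<Longrightarrow> \<sigma> y = y" "b \<in> B" for \<sigma> b
      using move[OF that(1) _ that(3)] fix\<beta>[OF that(2)] \<beta>B by simp
  qed
  have D: "(\<Prod>b\<in>A - B. [:- b, 1:]) \<in> polys_over ?E"
  proof (rule Gal_invariant_prod[OF E n(2)])
    show "A - B \<subseteq> level n" using Alev by blast
    show "\<sigma> b \<in> A - B" if \<sigma>: "\<sigma> \<in> Gal" "\<And>y. y \<in> ?E \<Longrightarrow> \<sigma> y = y" and b: "b \<in> A - B" for \<sigma> b
    proof -
      have s\<beta>: "\<sigma> \<beta> = \<beta>" using fix\<beta>[OF \<sigma>(2)] .
      have "peval \<kappa> f (\<sigma> b) = peval \<kappa> f \<beta>"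
        using b Gal_peval[OF \<sigma>(1), of f b] Gal_peval[OF \<sigma>(1), of f \<beta>] s\<beta> by (simp add: A_def fiber_def)
      moreover have "\<sigma> b \<notin> B"
      proof
        assume "\<sigma> b \<in> B"
        then have "\<sigma> b \<in> \<sigma> ` B" using imB[OF \<sigma>(1)] s\<beta> \<beta>B by simp
        then show False using b Gal_eq_iff[OF \<sigma>(1)] by auto
      qed
      ultimately show ?thesis by (simp add: A_def fiber_def)
    qed
  qed
  have "map_poly \<kappa> f - [:peval \<kappa> f \<beta>:] = smult (lead_coeff (map_poly \<kappa> f - [:peval \<kappa> f \<beta>:])) (\<Prod>b\<in>A. [:- b, 1:])"
    using poly_eq_prod_roots[OF fiber_poly(2)] fiber_poly(1,3) cA unfolding A_def by metis
  also have "lead_coeff (map_poly \<kappa> f - [:peval \<kappa> f \<beta>:]) = \<kappa> (lead_coeff f)"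
    using d by (simp add: degree_map_field_hom[OF \<kappa>_hom] coeff_map_field_hom[OF \<kappa>_hom] degree_f coeff_pCons split: nat.split)
  also have "(\<Prod>b\<in>A. [:- b, 1:]) = (\<Prod>b\<in>B. [:- b, 1:]) * (\<Prod>b\<in>A - B. [:- b, 1:])"
    using prod.subset_diff[OF BA finA, of "\<lambda>b. [:- b, 1:]"] by (simp only: mult.commute)
  finally have CD: "smult (\<kappa> (lead_coeff f)) ((\<Prod>b\<in>B. [:- b, 1:]) * (\<Prod>b\<in>A - B. [:- b, 1:])) = map_poly \<kappa> f - [:peval \<kappa> f \<beta>:]"
    by simp
  have "\<exists>\<sigma>. is_field_hom \<sigma> \<and> (\<forall>a. \<sigma> (\<kappa> a) = \<kappa> a) \<and> \<sigma> \<beta> = b \<and> \<sigma> ` B = B" if b: "b \<in> B" for b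
  proof -
    obtain \<sigma> where \<sigma>: "\<sigma> \<in> Gal" "\<sigma> \<beta> = b" using b unfolding B_def swaps_def by blast
    then show ?thesis using imB[OF \<sigma>(1)] b by (intro exI[of _ \<sigma>]) (auto simp: Gal_iff \<kappa>_def)
  qed
  then have "card B = 1 \<or> card B = degree f"
    by (rule block_card_indecomposable[OF ac \<kappa>_hom tr H_set_indecomposable[OF ac d N d2 f] f_nonzero finB \<beta>B C D
        lead_coeff_prod_linear CD])
  then show ?thesis
  proof
    assume "card B = 1"
    then show ?thesis using \<beta>B by (metis card_1_singletonE singletonD)
  next
    assume "card B = degree f"
    then have "B = A" using BA finA cA degree_f by (intro card_subset_eq) auto
    then show ?thesis by (simp add: A_def)
  qed
qed

lemma all_siblings_swap:
  assumes n: "1 \<le> n" "n \<le> N" and \<beta>: "\<beta> \<in> level n" "\<beta>' \<in> level n" "peval \<kappa> f \<beta> = peval \<kappa> f \<beta>'"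
  shows "swaps n \<beta> \<beta>'"
proof -
  obtain a b where ab: "a \<in> level n" "b \<in> level n" "a \<noteq> b" "swaps n a b" using transposition_exists[OF n] .
  obtain \<sigma> where \<sigma>: "\<sigma> \<in> Gal" "\<sigma> a = \<beta>" using Gal_transitive[OF ab(1) \<beta>(1)] .
  have "swaps n \<beta> (\<sigma> b)" using swaps_conj[OF ab(4) \<sigma>(1)] \<sigma>(2) by simp
  moreover have "\<sigma> b \<noteq> \<beta>" using \<sigma> ab(3) Gal_eq_iff[OF \<sigma>(1), of b a] by auto
  moreover have "\<sigma> b \<in> level n" using Gal_level[OF \<sigma>(1) ab(2)] .
  ultimately have "{b \<in> level n. swaps n \<beta> b} \<noteq> {\<beta>}" by blast
  then have "{b \<in> level n. swaps n \<beta> b} = fiber (peval \<kappa> f \<beta>)"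
    using sibling_class_trivial_or_full[OF n \<beta>(1)] by blast
  moreover have "\<beta>' \<in> fiber (peval \<kappa> f \<beta>)" using \<beta>(3) by (simp add: fiber_def)
  ultimately show ?thesis by blast
qed

text \<open>Composing \<rho> with the transposition of \<open>x\<close> and \<open>\<rho> x\<close>
  makes \<open>x\<close> fixed and disturbs no fixed point, so the number of moved points
  drops.\<close>

lemma fiberwise_permutation_in_Gal:
  assumes n: "1 \<le> n" "n \<le> N"
    and "\<And>x. x \<in> level n \<Longrightarrow> \<rho> x \<in> level n" "inj_on \<rho> (level n)"
    "\<And>x. x \<in> level n \<Longrightarrow> peval \<kappa> f (\<rho> x) = peval \<kappa> f x"
  shows "\<exists>\<sigma>\<in>Gal. \<forall>x\<in>level n. \<sigma> x = \<rho> x"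
  using assms(3-)
proof (induction "card {x\<in>level n. \<rho> x \<noteq> x}" arbitrary: \<rho> rule: less_induct)
  case less
  show ?case
  proof (cases "\<forall>x\<in>level n. \<rho> x = x")
    case True
    then show ?thesis using Gal_id by (intro bexI[of _ id]) auto
  next
    case False
    then obtain x where x: "x \<in> level n" "\<rho> x \<noteq> x" by blast
    define y where "y = \<rho> x"
    have y: "y \<in> level n" using less.prems(1) x by (simp add: y_def)
    have "swaps n x y" using all_siblings_swap[OF n x(1) y] less.prems(3)[OF x(1)] by (simp add: y_def)
    then obtain \<sigma> where \<sigma>: "\<sigma> \<in> Gal" "\<sigma> x = y" "\<sigma> y = x" "\<forall>z\<in>level n - {x, y}. \<sigma> z = z"
      unfolding swaps_def by blast
    have \<sigma>f: "peval \<kappa> f (\<sigma> z) = peval \<kappa> f z" if "z \<in> level n" for z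
      using that \<sigma> less.prems(3)[OF x(1)] by (cases "z = x \<or> z = y") (auto simp: y_def)
    have fixed: "\<sigma> (\<rho> z) = z" if z: "z \<in> level n" "\<rho> z = z" for z
    proof -
      have "z \<noteq> x" "z \<noteq> y" using z x less.prems(2) y unfolding y_def by (auto dest: inj_onD)
      then show ?thesis using z \<sigma>(4) by simp
    qed
    have "card {z\<in>level n. (\<sigma> \<circ> \<rho>) z \<noteq> z} < card {z\<in>level n. \<rho> z \<noteq> z}"
    proof (rule psubset_card_mono)
      show "finite {z\<in>level n. \<rho> z \<noteq> z}" using finite_level by simp
      have "x \<notin> {z\<in>level n. (\<sigma> \<circ> \<rho>) z \<noteq> z}" using \<sigma>(3) by (simp add: y_def)
      then show "{z\<in>level n. (\<sigma> \<circ> \<rho>) z \<noteq> z} \<subset> {z\<in>level n. \<rho> z \<noteq> z}" using x fixed by auto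
    qed
    moreover have "inj_on (\<sigma> \<circ> \<rho>) (level n)"
      using less.prems(2) Gal_eq_iff[OF \<sigma>(1)] by (auto simp: inj_on_def)
    moreover have "(\<sigma> \<circ> \<rho>) z \<in> level n" if "z \<in> level n" for z
      using Gal_level[OF \<sigma>(1)] less.prems(1) that by simp
    moreover have "peval \<kappa> f ((\<sigma> \<circ> \<rho>) z) = peval \<kappa> f z" if "z \<in> level n" for z
      using \<sigma>f less.prems(1,3) that by simp
    ultimately obtain \<theta> where \<theta>: "\<theta> \<in> Gal" "\<forall>z\<in>level n. \<theta> z = (\<sigma> \<circ> \<rho>) z" using less.hyps by blast
    have "inv_into UNIV \<sigma> \<circ> \<theta> \<in> Gal" using Gal_comp Gal_inv \<sigma>(1) \<theta>(1) by blast
    moreover have "\<forall>z\<in>level n. (inv_into UNIV \<sigma> \<circ> \<theta>) z = \<rho> z" using \<theta>(2) Gal_inv_apply(2)[OF \<sigma>(1)] by simp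
    ultimately show ?thesis by blast
  qed
qed

end

section \<open>The action on the tree\<close>

definition words :: "nat \<Rightarrow> nat \<Rightarrow> nat list set" where
  "words d n = {v. length v = n \<and> set v \<subseteq> {0..<d}}"

lemma tree_verts_iff: "v \<in> tree_verts d N \<longleftrightarrow> length v \<le> N \<and> v \<in> words d (length v)"
  by (auto simp: tree_verts_def words_def)

lemma words_tree_verts: "v \<in> words d n \<Longrightarrow> n \<le> N \<Longrightarrow> v \<in> tree_verts d N"
  by (auto simp: tree_verts_def words_def)

lemma words_length: "v \<in> words d n \<Longrightarrow> length v = n"
  by (simp add: words_def)

lemma words_0: "words d 0 = {[]}"
  by (auto simp: words_def)

lemma words_Suc_cases:
  assumes "v \<in> words d (Suc n)"
  obtains u i where "v = u @ [i]" "u \<in> words d n" "i < d"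
proof -
  have "v \<noteq> []" using assms by (auto simp: words_def)
  then have v: "v = butlast v @ [last v]" by simp
  moreover have "butlast v \<in> words d n" "last v < d"
    using assms last_in_set[OF \<open>v \<noteq> []\<close>] by (auto simp: words_def dest: in_set_butlastD)
  ultimately show thesis using that by blast
qed

lemma words_snoc: "u \<in> words d n \<Longrightarrow> i < d \<Longrightarrow> u @ [i] \<in> words d (Suc n)"
  by (auto simp: words_def)

context iterated_splitting_field
begin

text \<open>An arbitrary numbering of the zeros of \<open>f - \<alpha>\<close>. The isomorphism with
  the tree automorphisms depends on these choices, but any of them works.\<close>

definition child :: "'L \<Rightarrow> nat \<Rightarrow> 'L" where
  "child \<alpha> = (SOME h. bij_betw h {0..<d} (fiber \<alpha>))"

definition label :: "nat list \<Rightarrow> 'L" where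
  "label v = foldl child T v"

text \<open>Labels are inverted separately for each word length. Outside the tree the value is the
  identity, as the carrier of \<open>wreath_power\<close> demands.\<close>

definition tree_act :: "('L \<Rightarrow> 'L) \<Rightarrow> nat list \<Rightarrow> nat list" where
  "tree_act \<sigma> v = (if v \<in> tree_verts d N
     then the_inv_into (words d (length v)) label (\<sigma> (label v)) else v)"

lemma child_bij:
  assumes "\<alpha> \<in> level n" "n < N"
  shows "bij_betw (child \<alpha>) {0..<d} (fiber \<alpha>)"
proof -
  have "\<exists>h. bij_betw h {0..<d} (fiber \<alpha>)"
    using ex_bij_betw_nat_finite[OF finite_fiber[of \<alpha>]] card_fiber[OF assms] by simp
  then show ?thesis unfolding child_def by (rule someI_ex)
qed

lemma label_Nil: "label [] = T" and label_snoc: "label (v @ [i]) = child (label v) i"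
  by (simp_all add: label_def)

lemma child_parent:
  assumes "\<alpha> \<in> level n" "n < N" "i < d"
  shows "peval \<kappa> f (child \<alpha> i) = \<alpha>"
  using bij_betwE[OF child_bij[OF assms(1,2)]] assms(3) by (simp add: fiber_def)

lemma label_bij: "n \<le> N \<Longrightarrow> bij_betw label (words d n) (level n)"
proof (induction n)
  case 0
  then show ?case by (simp add: words_0 level_0 label_Nil bij_betw_def)
next
  case (Suc n)
  then have IH: "bij_betw label (words d n) (level n)" and n: "n < N" by auto
  have lev: "label u \<in> level n" if "u \<in> words d n" for u using bij_betwE[OF IH] that by blast
  show ?case
  proof (rule bij_betwI')
    fix v v' assume v: "v \<in> words d (Suc n)" and v': "v' \<in> words d (Suc n)"
    obtain u i where u: "v = u @ [i]" "u \<in> words d n" "i < d" using words_Suc_cases[OF v] .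
    obtain u' i' where u': "v' = u' @ [i']" "u' \<in> words d n" "i' < d" using words_Suc_cases[OF v'] .
    show "(label v = label v') = (v = v')"
    proof
      assume eq: "label v = label v'"
      then have "label u = label u'"
        using child_parent[OF lev[OF u(2)] n u(3)] child_parent[OF lev[OF u'(2)] n u'(3)]
        unfolding u u' label_snoc by simp
      then have uu: "u = u'" using bij_betw_imp_inj_on[OF IH] u(2) u'(2) by (auto dest: inj_onD)
      then have "child (label u) i = child (label u) i'" using eq unfolding u u' label_snoc by simp
      then have "i = i'"
        using bij_betw_imp_inj_on[OF child_bij[OF lev[OF u(2)] n]] u(3) u'(3) by (auto dest: inj_onD)
      then show "v = v'" using uu u u' by simp
    qed simp
  next
    fix v assume v: "v \<in> words d (Suc n)"
    obtain u i where u: "v = u @ [i]" "u \<in> words d n" "i < d" using words_Suc_cases[OF v] .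
    show "label v \<in> level (Suc n)"
      unfolding u label_snoc level_Suc_iff child_parent[OF lev[OF u(2)] n u(3)] by (rule lev[OF u(2)])
  next
    fix x assume "x \<in> level (Suc n)"
    then have par: "peval \<kappa> f x \<in> level n" by (simp add: level_Suc_iff)
    then obtain u where u: "u \<in> words d n" "label u = peval \<kappa> f x"
      using bij_betw_imp_surj_on[OF IH] by (metis imageE)
    have "x \<in> fiber (label u)" using u by (simp add: fiber_def)
    then obtain i where "i < d" "x = child (label u) i"
      using bij_betw_imp_surj_on[OF child_bij[OF lev[OF u(1)] n]] by (metis atLeastLessThan_iff imageE)
    then show "\<exists>v\<in>words d (Suc n). x = label v"
      using words_snoc[OF u(1)] label_snoc by metis
  qed
qed

lemma label_level: "v \<in> words d n \<Longrightarrow> n \<le> N \<Longrightarrow> label v \<in> level n"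
  using bij_betwE[OF label_bij] by blast

lemma label_inj: "v \<in> words d n \<Longrightarrow> u \<in> words d n \<Longrightarrow> n \<le> N \<Longrightarrow> label v = label u \<Longrightarrow> v = u"
  using bij_betw_imp_inj_on[OF label_bij] by (auto dest: inj_onD)

lemma label_butlast:
  assumes "v \<in> words d (Suc n)" "Suc n \<le> N"
  shows "butlast v \<in> words d n" "peval \<kappa> f (label v) = label (butlast v)"
proof -
  obtain u i where u: "v = u @ [i]" "u \<in> words d n" "i < d" using words_Suc_cases[OF assms(1)] .
  show "butlast v \<in> words d n" using u by simp
  show "peval \<kappa> f (label v) = label (butlast v)"
    using child_parent[OF label_level[OF u(2)] _ u(3)] assms(2) u(1) by (simp add: label_snoc)
qed

lemma tree_act_words:
  assumes "\<sigma> \<in> Gal" "v \<in> words d n" "n \<le> N"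
  shows "tree_act \<sigma> v \<in> words d n" "label (tree_act \<sigma> v) = \<sigma> (label v)"
proof -
  have eq: "tree_act \<sigma> v = the_inv_into (words d n) label (\<sigma> (label v))"
    using assms words_tree_verts words_length by (simp add: tree_act_def)
  have x: "\<sigma> (label v) \<in> label ` words d n"
    using Gal_level[OF assms(1) label_level[OF assms(2,3)]] bij_betw_imp_surj_on[OF label_bij[OF assms(3)]] by simp
  note inj = bij_betw_imp_inj_on[OF label_bij[OF assms(3)]]
  show "tree_act \<sigma> v \<in> words d n" unfolding eq by (rule the_inv_into_into[OF inj x order_refl])
  show "label (tree_act \<sigma> v) = \<sigma> (label v)" unfolding eq by (rule f_the_inv_into_f[OF inj x])
qed

lemma tree_act_tree_verts:
  "\<sigma> \<in> Gal \<Longrightarrow> v \<in> tree_verts d N \<Longrightarrow> tree_act \<sigma> v \<in> tree_verts d N"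
  using tree_act_words(1) words_tree_verts tree_verts_iff by blast

lemma tree_act_comp:
  assumes "\<sigma> \<in> Gal" "\<tau> \<in> Gal"
  shows "tree_act (\<sigma> \<circ> \<tau>) = tree_act \<sigma> \<circ> tree_act \<tau>"
proof
  fix v
  show "tree_act (\<sigma> \<circ> \<tau>) v = (tree_act \<sigma> \<circ> tree_act \<tau>) v"
  proof (cases "v \<in> tree_verts d N")
    case True
    define n where "n = length v"
    have v: "v \<in> words d n" "n \<le> N" using True by (auto simp: tree_verts_iff n_def)
    note 1 = tree_act_words[OF assms(2) v]
    note 2 = tree_act_words[OF assms(1) 1(1) v(2)]
    note 3 = tree_act_words[OF Gal_comp[OF assms] v]
    show ?thesis using label_inj[OF 3(1) 2(1) v(2)] 1 2 3 by simp
  qed (simp add: tree_act_def)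
qed

lemma tree_act_id: "tree_act id = id"
proof
  fix v
  show "tree_act id v = id v"
  proof (cases "v \<in> tree_verts d N")
    case True
    then have v: "v \<in> words d (length v)" "length v \<le> N" by (auto simp: tree_verts_iff)
    show ?thesis using label_inj[OF tree_act_words(1)[OF Gal_id v] v] tree_act_words(2)[OF Gal_id v] by simp
  qed (simp add: tree_act_def)
qed

lemma tree_act_in_wreath_power:
  assumes "\<sigma> \<in> Gal"
  shows "tree_act \<sigma> \<in> carrier (wreath_power d N)"
proof -
  let ?i = "inv_into UNIV \<sigma>"
  have "\<sigma> \<circ> ?i = id" "?i \<circ> \<sigma> = id" using Gal_inv_apply[OF assms] by auto
  then have inv: "tree_act \<sigma> (tree_act ?i v) = v" "tree_act ?i (tree_act \<sigma> v) = v" for v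
    using tree_act_comp[OF assms Gal_inv[OF assms]] tree_act_comp[OF Gal_inv[OF assms] assms] tree_act_id
    by (metis comp_apply id_apply)+
  have "bij_betw (tree_act \<sigma>) (tree_verts d N) (tree_verts d N)"
    by (rule bij_betw_byWitness[of _ "tree_act ?i"])
      (use inv tree_act_tree_verts assms Gal_inv in auto)
  moreover have "length (tree_act \<sigma> v) = length v \<and> tree_act \<sigma> (butlast v) = butlast (tree_act \<sigma> v)"
    if "v \<in> tree_verts d N" for v
  proof -
    have v: "v \<in> words d (length v)" "length v \<le> N" using that by (auto simp: tree_verts_iff)
    note s = tree_act_words[OF assms v]
    have len: "length (tree_act \<sigma> v) = length v" using words_length[OF s(1)] .
    show ?thesis
    proof (cases "length v")
      case 0
      then show ?thesis using len by simp
    next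
      case (Suc n)
      have v': "v \<in> words d (Suc n)" "Suc n \<le> N" and s': "tree_act \<sigma> v \<in> words d (Suc n)" using v s Suc by auto
      note b = label_butlast[OF v'] and b' = label_butlast[OF s' v'(2)]
      have n: "n \<le> N" using v'(2) by simp
      note t = tree_act_words[OF assms b(1) n]
      have "label (butlast (tree_act \<sigma> v)) = peval \<kappa> f (\<sigma> (label v))" using b'(2) s(2) by simp
      also have "\<dots> = \<sigma> (label (butlast v))" using Gal_peval[OF assms, of f "label v"] b(2) by simp
      also have "\<dots> = label (tree_act \<sigma> (butlast v))" using t(2) by simp
      finally show ?thesis using label_inj[OF b'(1) t(1) n] len by simp
    qed
  qed
  ultimately show ?thesis by (simp add: wreath_power_def tree_act_def)
qed

text \<open>The set where two automorphisms agree is a subfield; if it contains \<open>k(t)\<close>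
  and all roots of level \<open>N\<close>, it is the whole splitting field.\<close>

lemma tree_act_inj: "inj_on tree_act Gal"
proof (rule inj_onI)
  fix \<sigma> \<tau> assume \<sigma>: "\<sigma> \<in> Gal" and \<tau>: "\<tau> \<in> Gal" and eq: "tree_act \<sigma> = tree_act \<tau>"
  have h: "is_field_hom \<sigma>" "is_field_hom \<tau>" using \<sigma> \<tau> by (auto simp: Gal_iff)
  define S where "S = {x. \<sigma> x = \<tau> x}"
  have "is_subfield S" unfolding is_subfield_def S_def
    by (simp add: field_hom_0[OF h(1)] field_hom_0[OF h(2)] field_hom_1[OF h(1)] field_hom_1[OF h(2)]
        field_hom_add[OF h(1)] field_hom_add[OF h(2)] field_hom_mult[OF h(1)] field_hom_mult[OF h(2)]
        field_hom_uminus[OF h(1)] field_hom_uminus[OF h(2)] field_hom_inverse[OF h(1)] field_hom_inverse[OF h(2)])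
  moreover have "range \<phi> \<subseteq> S" using \<sigma> \<tau> by (auto simp: S_def Gal_iff)
  moreover have "level N \<subseteq> S"
  proof
    fix x assume "x \<in> level N"
    then obtain v where v: "v \<in> words d N" "x = label v"
      using bij_betw_imp_surj_on[OF label_bij[OF order_refl]] by (metis imageE)
    then show "x \<in> S"
      using tree_act_words(2)[OF \<sigma> v(1)] tree_act_words(2)[OF \<tau> v(1)] eq by (simp add: S_def)
  qed
  ultimately have "S = UNIV"
    using splitting unfolding is_splitting_field_def map_poly_gal_poly roots_level_poly by blast
  then show "\<sigma> = \<tau>" by (auto simp: S_def)
qed

text \<open>If \<sigma> realises \<pi> on level \<open>n\<close>, then \<sigma> inverse after \<pi>
  preserves parents on level \<open>n + 1\<close>. There it is realised by some \<theta> in the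
  group, and \<open>\<sigma> \<circ> \<theta>\<close> realises \<pi> on that level.\<close>

lemma tree_act_surj:
  assumes "\<pi> \<in> carrier (wreath_power d N)"
  obtains \<sigma> where "\<sigma> \<in> Gal" "tree_act \<sigma> = \<pi>"
proof -
  have \<pi>: "bij_betw \<pi> (tree_verts d N) (tree_verts d N)" "\<And>v. v \<notin> tree_verts d N \<Longrightarrow> \<pi> v = v"
    "\<And>v. v \<in> tree_verts d N \<Longrightarrow> length (\<pi> v) = length v"
    "\<And>v. v \<in> tree_verts d N \<Longrightarrow> \<pi> (butlast v) = butlast (\<pi> v)"
    using assms by (auto simp: wreath_power_def)
  have \<pi>_words: "\<pi> v \<in> words d n" if "v \<in> words d n" "n \<le> N" for v n
  proof -
    have "v \<in> tree_verts d N" using words_tree_verts that by blast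
    then have "\<pi> v \<in> tree_verts d N" "length (\<pi> v) = n" using bij_betwE[OF \<pi>(1)] \<pi>(3) words_length[OF that(1)] by auto
    then show ?thesis by (auto simp: tree_verts_iff)
  qed
  have \<pi>_label: "peval \<kappa> f (label (\<pi> v)) = label (\<pi> (butlast v))" if "v \<in> words d (Suc n)" "Suc n \<le> N" for v n
    using label_butlast(2)[OF \<pi>_words[OF that] that(2)] \<pi>(4)[OF words_tree_verts[OF that]] by simp
  have "\<exists>\<sigma>\<in>Gal. \<forall>v\<in>words d n. \<sigma> (label v) = label (\<pi> v)" if "n \<le> N" for n
    using that
  proof (induction n)
    case 0
    have "\<pi> [] = []" using \<pi>_words[of "[]" 0] by (simp add: words_0)
    then show ?case using Gal_id by (intro bexI[of _ id]) (auto simp: words_0)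
  next
    case (Suc n)
    then obtain \<sigma> where \<sigma>: "\<sigma> \<in> Gal" "\<And>v. v \<in> words d n \<Longrightarrow> \<sigma> (label v) = label (\<pi> v)" by auto
    note bij = label_bij[OF Suc.prems]
    \<comment> \<open>The correction, \<sigma> inverse after \<pi>, transported from words to
      roots.\<close>
    define \<rho> where "\<rho> x = inv_into UNIV \<sigma> (label (\<pi> (the_inv_into (words d (Suc n)) label x)))" for x
    have \<rho>: "\<rho> (label v) = inv_into UNIV \<sigma> (label (\<pi> v))" if "v \<in> words d (Suc n)" for v
      unfolding \<rho>_def using the_inv_into_f_f[OF bij_betw_imp_inj_on[OF bij] that] by simp
    have lev: "\<exists>v\<in>words d (Suc n). x = label v" if "x \<in> level (Suc n)" for x
      using bij_betw_imp_surj_on[OF bij] that by blast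
    have "\<exists>\<theta>\<in>Gal. \<forall>x\<in>level (Suc n). \<theta> x = \<rho> x"
    proof (rule fiberwise_permutation_in_Gal)
      show "1 \<le> Suc n" "Suc n \<le> N" using Suc.prems by auto
      show "inj_on \<rho> (level (Suc n))"
      proof (rule inj_onI)
        fix x y assume "x \<in> level (Suc n)" "y \<in> level (Suc n)" and eq: "\<rho> x = \<rho> y"
        then obtain u v where uv: "u \<in> words d (Suc n)" "x = label u" "v \<in> words d (Suc n)" "y = label v"
          using lev by meson
        have "label (\<pi> u) = label (\<pi> v)"
          using eq \<rho>[OF uv(1)] \<rho>[OF uv(3)] uv Gal_inv_apply(1)[OF \<sigma>(1)] by metis
        then have "\<pi> u = \<pi> v" using label_inj \<pi>_words uv Suc.prems by blast
        then have "u = v"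
          using bij_betw_imp_inj_on[OF \<pi>(1)] words_tree_verts uv Suc.prems by (metis inj_onD)
        then show "x = y" using uv by simp
      qed
      fix x assume "x \<in> level (Suc n)"
      then obtain v where v: "v \<in> words d (Suc n)" "x = label v" using lev by blast
      show "\<rho> x \<in> level (Suc n)"
        using \<rho>[OF v(1)] v Gal_level[OF Gal_inv[OF \<sigma>(1)]] label_level[OF \<pi>_words[OF v(1) Suc.prems] Suc.prems] by simp
      have "peval \<kappa> f (\<rho> x) = inv_into UNIV \<sigma> (label (\<pi> (butlast v)))"
        using Gal_peval[OF Gal_inv[OF \<sigma>(1)], of f "label (\<pi> v)"] \<pi>_label[OF v(1) Suc.prems] \<rho>[OF v(1)] v(2) by simp
      also have "\<dots> = label (butlast v)"
        using \<sigma>(2)[OF label_butlast(1)[OF v(1) Suc.prems]] Gal_inv_apply(2)[OF \<sigma>(1)] by metis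
      finally show "peval \<kappa> f (\<rho> x) = peval \<kappa> f x"
        using label_butlast(2)[OF v(1) Suc.prems] v(2) by simp
    qed
    then obtain \<theta> where \<theta>: "\<theta> \<in> Gal" "\<And>x. x \<in> level (Suc n) \<Longrightarrow> \<theta> x = \<rho> x" by blast
    have "(\<sigma> \<circ> \<theta>) (label v) = label (\<pi> v)" if "v \<in> words d (Suc n)" for v
      using \<theta>(2)[OF label_level[OF that Suc.prems]] \<rho>[OF that] Gal_inv_apply(1)[OF \<sigma>(1)] by simp
    then show ?case using Gal_comp[OF \<sigma>(1) \<theta>(1)] by blast
  qed
  from this[OF order_refl] obtain \<sigma> where \<sigma>: "\<sigma> \<in> Gal" "\<forall>v\<in>words d N. \<sigma> (label v) = label (\<pi> v)" by blast
  \<comment> \<open>The induction recorded agreement on one level at a time. Agreement on level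
    \<open>N\<close> descends, since every \<open>v\<close> is the parent of \<open>v @ [0]\<close>
    and both actions commute with passing to the parent.\<close>
  have all: "\<forall>v\<in>words d n. \<sigma> (label v) = label (\<pi> v)" if "n \<le> N" for n
    using that
  proof (induction rule: inc_induct)
    case base
    then show ?case using \<sigma>(2) .
  next
    case (step n)
    show ?case
    proof
      fix v assume "v \<in> words d n"
      then have v: "v @ [0] \<in> words d (Suc n)" using words_snoc d by simp
      have n: "Suc n \<le> N" using step by simp
      have "\<sigma> (label v) = \<sigma> (peval \<kappa> f (label (v @ [0])))" using label_butlast(2)[OF v n] by simp
      also have "\<dots> = peval \<kappa> f (label (\<pi> (v @ [0])))" using Gal_peval[OF \<sigma>(1)] step.IH v by simp
      also have "\<dots> = label (\<pi> v)" using \<pi>_label[OF v n] by simp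
      finally show "\<sigma> (label v) = label (\<pi> v)" .
    qed
  qed
  have "tree_act \<sigma> = \<pi>"
  proof
    fix v
    show "tree_act \<sigma> v = \<pi> v"
    proof (cases "v \<in> tree_verts d N")
      case True
      then have v: "v \<in> words d (length v)" "length v \<le> N" by (auto simp: tree_verts_iff)
      show ?thesis
        using label_inj[OF tree_act_words(1)[OF \<sigma>(1) v] \<pi>_words[OF v] v(2)] tree_act_words(2)[OF \<sigma>(1) v] all[OF v(2)] v(1)
        by simp
    qed (simp add: tree_act_def \<pi>(2))
  qed
  then show thesis using that \<sigma>(1) by blast
qed

theorem gal_group_iso_wreath_power: "gal_group \<phi> \<cong> wreath_power d N"
proof -
  have "tree_act \<in> hom (gal_group \<phi>) (wreath_power d N)"
    using tree_act_in_wreath_power tree_act_comp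
    by (intro homI) (auto simp: gal_group_def wreath_power_def)
  moreover have "tree_act ` Gal = carrier (wreath_power d N)"
    using tree_act_in_wreath_power tree_act_surj by (metis (no_types, lifting) image_eqI image_subsetI subsetI subset_antisym)
  ultimately show ?thesis
    using tree_act_inj unfolding is_iso_def iso_def bij_betw_def by blast
qed

end

theorem theorem3p7:
  fixes f :: "'k::field poly" and d N :: nat
    and \<phi> :: "'k poly fract \<Rightarrow> 'L::field"
  assumes "alg_closed_field TYPE('k)"
    and "d \<ge> 2" and "N \<ge> 1"
    and "\<not> (d = 2 \<and> CHAR('k) = 2)"
    and "f \<in> H_set d N TYPE('k)"
    and "is_splitting_field \<phi> (gal_poly f N)"
  shows "gal_group \<phi> \<cong> wreath_power d N"
proof -
  interpret iterated_splitting_field f d N \<phi>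
    using assms by unfold_locales
  show ?thesis by (rule gal_group_iso_wreath_power)
qed

end
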